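(* For integers $n\ge 1$ and $g\ge 0$, let $C_{n,g}$ be the number of rooted cubic maps with $2n$ vertices on the orientable surface of genus $g$, let $J_{n,f}$ be the number of rooted cubic maps with $2n$ vertices and $f$ faces, and let $C_n=\sum_{g\ge 0}C_{n,g}$. Then: (a) The genus distribution of cubic graphs is asymptotically normal with mean asymptotic to $\frac{n-\ln n}{2}$ and variance asymptotic to $\frac{\ln n}{4}$; that is, for every fixed real $t$, as $n\to\infty$, \[ \sum_{g\le \frac{n-\ln n}{2}+\frac{t\sqrt{\ln n}}{2}}\frac{C_{n,g}}{C_n}\to \frac{1}{\sqrt{2\pi}}\int_{-\infty}^t e^{-x^2/2}\,dx . \] (b) The region (face) distribution of cubic graphs, i.e. the distribution $(J_{n,f}/C_n : f\ge 1)$, is asymptotically normal with mean and variance both asymptotic to $\ln n$.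
   Context: A map on the orientable surface $\Sigma_g$ of genus $g$ is a connected graph (loops and multiple edges allowed) embedded in $\Sigma_g$ so that every component of the complement (a face) is homeomorphic to an open disk. A map is rooted if a vertex and an edge incident to it are distinguished; rooted maps are counted up to homeomorphism preserving the root, with no labelling of vertices or edges. A map is cubic if every vertex has degree $3$. By Euler's formula a cubic map with $2n$ vertices and genus $g$ has $f=n+2-2g$ faces, so $C_{n,g}=J_{n,n+2-2g}$. The genus distribution of cubic graphs is the sequence $(C_{n,g}2^{3n-1}(3n-1)!:g\ge0)$ and the region distribution is $(J_{n,f}2^{3n-1}(3n-1)!:f\ge1)$; normalizing either by its total gives the probability distributions $C_{n,g}/C_n$ and $J_{n,f}/C_n$. *)

theory Defs
  imports "HOL-Combinatorics.Combinatorics" "HOL-Probability.Probability"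
begin

text \<open>
  A map on an oriented closed surface is represented by its rotation system (Heffter, Edmonds).
  Cutting every edge in the middle yields two darts per edge; for a dart \<open>d\<close> at a vertex \<open>v\<close>,
  \<open>rotation d\<close> is the next dart counterclockwise around \<open>v\<close>, and \<open>reversal d\<close> is the other half
  of the same edge.  The cycles of \<open>rotation\<close>, \<open>reversal\<close> and \<open>rotation \<circ> reversal\<close> are
  then the vertices, the edges and the boundary walks of the faces.  Gluing one open disk along each
  boundary walk reconstructs the surface, so that every face is a disk by construction.

  A root is a dart.  This is a vertex together with an edge incident to it, where in the case of
  a loop one of its two ends is chosen.
\<close>

record rooted_rotation_system =
  darts :: "nat set"
  rotation :: "nat \<Rightarrow> nat"
  reversal :: "nat \<Rightarrow> nat"
  root_dart :: nat

definition dart_step :: "rooted_rotation_system \<Rightarrow> (nat \<times> nat) set" where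
  "dart_step M = {(x, y). x \<in> darts M \<and> (y = rotation M x \<or> y = reversal M x)}"

text \<open>
  The last conjunct says that the underlying graph is connected: moving from a dart to any other
  one around vertices and along edges is always possible.
\<close>

definition rooted_map :: "rooted_rotation_system \<Rightarrow> bool" where
  "rooted_map M \<longleftrightarrow>
     finite (darts M) \<and>
     root_dart M \<in> darts M \<and>
     rotation M permutes darts M \<and>
     reversal M permutes darts M \<and>
     (\<forall>d\<in>darts M. reversal M d \<noteq> d \<and> reversal M (reversal M d) = d) \<and>
     (\<forall>d\<in>darts M. \<forall>e\<in>darts M. (d, e) \<in> (dart_step M)\<^sup>*)"

definition map_vertices :: "rooted_rotation_system \<Rightarrow> nat set set" where
  "map_vertices M = orbit (rotation M) ` darts M"

definition map_edges :: "rooted_rotation_system \<Rightarrow> nat set set" where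
  "map_edges M = orbit (reversal M) ` darts M"

definition map_faces :: "rooted_rotation_system \<Rightarrow> nat set set" where
  "map_faces M = orbit (rotation M \<circ> reversal M) ` darts M"

text \<open>
  The genus of the surface carrying the map, by its Euler characteristic \<open>2 - 2 * g\<close>.
\<close>

definition map_genus :: "rooted_rotation_system \<Rightarrow> nat \<Rightarrow> bool" where
  "map_genus M g \<longleftrightarrow>
     int (card (map_vertices M)) - int (card (map_edges M)) + int (card (map_faces M))
       = 2 - 2 * int g"

text \<open>
  The degree of a vertex is its number of darts, so a loop contributes 2.
\<close>

definition cubic_map :: "rooted_rotation_system \<Rightarrow> bool" where
  "cubic_map M \<longleftrightarrow> (\<forall>v\<in>map_vertices M. card v = 3)"

text \<open>
  Isomorphisms of rotation systems correspond to orientation-preserving homeomorphisms of the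
  surfaces that carry one embedded graph onto the other, up to isotopy.
\<close>

definition rooted_map_iso :: "(rooted_rotation_system \<times> rooted_rotation_system) set" where
  "rooted_map_iso = {(M, N). rooted_map M \<and> rooted_map N \<and>
     (\<exists>h. bij_betw h (darts M) (darts N) \<and>
          h (root_dart M) = root_dart N \<and>
          (\<forall>d\<in>darts M. h (rotation M d) = rotation N (h d) \<and>
                         h (reversal M d) = reversal N (h d)))}"

definition rooted_cubic_maps :: "nat \<Rightarrow> rooted_rotation_system set" where
  "rooted_cubic_maps n = {M. rooted_map M \<and> cubic_map M \<and> card (map_vertices M) = 2 * n}"

definition cubic_genus_count :: "nat \<Rightarrow> nat \<Rightarrow> nat" where
  "cubic_genus_count n g = card ({M \<in> rooted_cubic_maps n. map_genus M g} // rooted_map_iso)"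

definition cubic_face_count :: "nat \<Rightarrow> nat \<Rightarrow> nat" where
  "cubic_face_count n f =
     card ({M \<in> rooted_cubic_maps n. card (map_faces M) = f} // rooted_map_iso)"

definition cubic_count :: "nat \<Rightarrow> real" where
  "cubic_count n = (\<Sum>g. real (cubic_genus_count n g))"

definition genus_distribution :: "nat \<Rightarrow> nat \<Rightarrow> real" where
  "genus_distribution n g = real (cubic_genus_count n g) / cubic_count n"

definition region_distribution :: "nat \<Rightarrow> nat \<Rightarrow> real" where
  "region_distribution n f = real (cubic_face_count n f) / cubic_count n"

definition distribution_mean :: "(nat \<Rightarrow> real) \<Rightarrow> real" where
  "distribution_mean p = (\<Sum>k. real k * p k)"

definition distribution_variance :: "(nat \<Rightarrow> real) \<Rightarrow> real" where
  "distribution_variance p = (\<Sum>k. (real k - distribution_mean p)\<^sup>2 * p k)"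

end

theory Submission
  imports Defs "HOL-Real_Asymp.Real_Asymp"
begin

hide_const (open) Finite_Cartesian_Product.transpose

text \<open>
  A rooted cubic map with \<^term>\<open>2 * n\<close> vertices is, up to relabelling, a pair of permutations of
  \<^term>\<open>6 * n\<close> darts, one with all cycles of length 3 and one a perfect matching, that act
  transitively; the faces are the cycles of the product.  Fix the first permutation and reveal the
  uniform matching one edge at a time.  If a dart of the current permutation lies on a cycle of length
  at least 3 and is matched with one of the other \<^term>\<open>2 * m - 1\<close> free darts, a face is completed
  exactly when the partner is one of the two neighbours on the cycle, so with probability
  \<^term>\<open>2 / (2 * m - 1)\<close> whatever happened before.  The number of faces is therefore a sum
  of independent Bernoulli variables with these parameters, of mean and variance close to
  \<^term>\<open>ln n\<close>, up to the moment when all remaining cycles have length at most 2.  An exponential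
  potential of the number of short cycles shows that the number of darts left then has bounded
  exponential moments.  Pairs that are not transitive have probability of order \<^term>\<open>1 / n\<close>, and
  Euler's formula turns faces into genus.
\<close>

section \<open>Permutations, matchings and revealing one edge\<close>

text \<open>The obstacle is the dependence between steps. At a fixed point the chance of closing a
  face depends on the rest of the permutation, and at a 2-cycle two faces may close at once; on a
  longer cycle the chance is one number for every history, so edges are revealed only there. No
  stopping time is formalised. A test function of the face count is compared with a function
  \<open>A\<close> of the number of free edges and of the faces closed so far, a supersolution of
  the backward equation of the Bernoulli walk. One induction then serves the mean, the variance, the
  fourth moment and the characteristic function, each with its own \<open>A\<close>; two-sided
  estimates come from a function and its negative. An error \<open>2 ^ m\<close> at breakdown covers
  every polynomial loss, and the potential pays for it, being at least \<open>2 * m\<close> by then.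
  The fourth moment is there for the passage to connected pairs: an event of probability of order
  \<open>1 / n\<close> could a priori carry a second moment of order \<open>n\<close>, which a
  polylogarithmic fourth moment rules out.\<close>

definition del :: "'a \<Rightarrow> ('a \<Rightarrow> 'a) \<Rightarrow> 'a \<Rightarrow> 'a" where
  "del x p = transpose x (p x) \<circ> p"

definition ncyc :: "('a \<Rightarrow> 'a) \<Rightarrow> 'a set \<Rightarrow> nat" where
  "ncyc p U = card (orbit p ` U)"

definition matchings :: "'a set \<Rightarrow> ('a \<Rightarrow> 'a) set" where
  "matchings U = {\<beta>. \<beta> permutes U \<and> (\<forall>x\<in>U. \<beta> x \<noteq> x \<and> \<beta> (\<beta> x) = x)}"

definition mavg :: "'a set \<Rightarrow> (('a \<Rightarrow> 'a) \<Rightarrow> real) \<Rightarrow> real" where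
  "mavg U F = (\<Sum>\<beta>\<in>matchings U. F \<beta>) / real (card (matchings U))"

text \<open>The double factorial \<open>(2 * m - 1)!!\<close>, the number of perfect matchings of
  \<open>2 * m\<close> points.\<close>

fun odd_fact :: "nat \<Rightarrow> nat" where
  "odd_fact 0 = 1"
| "odd_fact (Suc m) = (2 * m + 1) * odd_fact m"

lemma odd_fact_pos: "odd_fact m > 0"
  by (induction m) auto

lemma del_apply:
  assumes "inj p"
  shows "del x p y = (if y = x then x else if p y = x then p x else p y)"
  using assms by (auto simp: del_def transpose_def inj_eq)

lemma del_permutes:
  assumes "p permutes U" "x \<in> U"
  shows "del x p permutes (U - {x})"
proof (rule permutes_superset)
  show "del x p permutes U"
    unfolding del_def using assms
    by (intro permutes_compose permutes_swap_id) (auto simp: permutes_in_image)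
  show "del x p y = y" if "y \<in> U - (U - {x})" for y
    using that del_apply[OF permutes_inj[OF assms(1)], of x y] by auto
qed

text \<open>\<open>del x p\<close> bypasses \<open>x\<close>: its predecessor is sent straight to
  its successor and \<open>x\<close> becomes fixed. A walk along \<open>p\<close> from another point
  is therefore imitated with the visit to \<open>x\<close> skipped.\<close>

lemma orbit_del:
  assumes "p permutes U" "y \<noteq> x"
  shows "orbit (del x p) y = orbit p y - {x}"
proof -
  have i: "inj p" using assms(1) by (rule permutes_inj)
  note da = del_apply[OF i]
  have ne: "p x \<noteq> x" if "p z = x" "z \<noteq> x" for z
  proof
    assume "p x = x"
    then have "p z = p x" using that by simp
    then show False using i that(2) by (simp add: inj_eq)
  qed
  have 1: "z \<in> orbit p y - {x}" if "z \<in> orbit (del x p) y" for z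
    using that
  proof induct
    case base
    show ?case
    proof (cases "p y = x")
      case True
      have "p (p y) \<in> orbit p y" by (intro orbit.step orbit.base)
      then show ?thesis using True assms(2) ne[of y] by (simp add: da[of x y])
    next
      case False
      then show ?thesis using orbit.base[of p y] assms(2) by (simp add: da[of x y])
    qed
  next
    case (step z)
    then have z: "z \<in> orbit p y" "z \<noteq> x" by auto
    show ?case
    proof (cases "p z = x")
      case True
      have "p (p z) \<in> orbit p y" using z by (intro orbit.step)
      then show ?thesis using True z ne[of z] by (simp add: da[of x z])
    next
      case False
      then show ?thesis using orbit.step[OF z(1)] z by (simp add: da[of x z])
    qed
  qed
  \<comment> \<open>At \<open>z = x\<close> the bypassing walk has no position of its own, so the
    invariant records that it has already reached the successor \<open>p x\<close>.\<close>
  have 2: "(z \<noteq> x \<longrightarrow> z \<in> orbit (del x p) y) \<and> (z = x \<longrightarrow> p x \<in> orbit (del x p) y)"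
    if "z \<in> orbit p y" for z
    using that
  proof induct
    case base
    show ?case using orbit.base[of "del x p" y] assms(2) by (cases "p y = x") (simp_all add: da[of x y])
  next
    case (step z)
    consider "z = x" | "z \<noteq> x" "p z = x" | "z \<noteq> x" "p z \<noteq> x" by blast
    then show ?case
    proof cases
      case 1
      then show ?thesis using step by auto
    next
      case 2
      then show ?thesis using step orbit.step[of z "del x p" y] by (simp add: da[of x z])
    next
      case 3
      then show ?thesis using step orbit.step[of z "del x p" y] by (simp add: da[of x z])
    qed
  qed
  show ?thesis using 1 2 by blast
qed

text \<open>A cycle disappears only if the deleted point was alone on it. Otherwise distinct cycles
  stay distinct, because each keeps a point other than \<open>x\<close>.\<close>

lemma ncyc_del:
  assumes "finite U" "p permutes U" "x \<in> U"
  shows "ncyc p U = ncyc (del x p) (U - {x}) + (if p x = x then 1 else 0)"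
proof -
  have perm: "permutation p" using assms by (auto simp: permutation_permutes)
  have im: "orbit (del x p) ` (U - {x}) = (\<lambda>A. A - {x}) ` orbit p ` (U - {x})"
    unfolding image_image by (intro image_cong refl) (auto simp: orbit_del[OF assms(2)])
  have self: "y \<in> orbit p y" for y by (rule permutation_self_in_orbit[OF perm])
  have eqo: "orbit p y = orbit p z" if "y \<in> orbit p z" for y z
    using orbit_cyclic_eq3[OF cyclic_on_orbit'[OF perm] that] .
  show ?thesis
  proof (cases "p x = x")
    case True
    then have ox: "orbit p x = {x}" by (simp add: orbit_eq_singleton_iff)
    have nx: "x \<notin> orbit p y" if "y \<noteq> x" for y
      using eqo[of x y] ox self[of y] that by auto
    have "orbit (del x p) ` (U - {x}) = orbit p ` (U - {x})"
      by (intro image_cong refl) (use nx orbit_del[OF assms(2)] in auto)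
    moreover have "orbit p ` U = insert {x} (orbit p ` (U - {x}))"
      using assms(3) ox by (metis image_insert insert_Diff)
    moreover have "{x} \<notin> orbit p ` (U - {x})" using nx by force
    ultimately show ?thesis unfolding ncyc_def using True assms(1) by simp
  next
    case False
    have "orbit p x = orbit p (p x)" using permutation_orbit_step[OF perm] by metis
    moreover have "p x \<in> U - {x}" using False assms by (auto simp: permutes_in_image)
    ultimately have 1: "orbit p ` U = orbit p ` (U - {x})" by auto
    have "inj_on (\<lambda>A. A - {x}) (orbit p ` (U - {x}))"
    proof (rule inj_onI)
      fix A B assume A: "A \<in> orbit p ` (U - {x})" and B: "B \<in> orbit p ` (U - {x})"
        and eq: "A - {x} = B - {x}"
      from A obtain y where y: "y \<in> U - {x}" "A = orbit p y" by auto
      from B obtain z where z: "B = orbit p z" by auto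
      have "y \<in> B" using y self[of y] eq by blast
      then show "A = B" using eqo y z by auto
    qed
    then show ?thesis unfolding ncyc_def im 1 using False by (simp add: card_image)
  qed
qed

lemma ncyc_le_card: "finite U \<Longrightarrow> ncyc p U \<le> card U"
  unfolding ncyc_def by (rule card_image_le)

section \<open>Perfect matchings and conditioning on one partner\<close>

lemma matchings_empty [simp]: "matchings {} = {id}"
  by (auto simp: matchings_def)

lemma finite_matchings [simp]: "finite U \<Longrightarrow> finite (matchings U)"
  unfolding matchings_def by (rule finite_subset[OF _ finite_permutations]) auto

text \<open>A matching amounts to the partner \<open>e\<close> of \<open>d\<close> and a matching of
  the other points. The smaller matching fixes \<open>d\<close> and \<open>e\<close>, so composing
  with the transposition restores the pair, and composing once more removes it; this gives the
  inverse map.\<close>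

lemma bij_betw_matchings:
  assumes "d \<in> U"
  shows "bij_betw (\<lambda>(e, \<beta>). transpose d e \<circ> \<beta>) (SIGMA e : U - {d}. matchings (U - {d, e})) (matchings U)"
proof (rule bij_betw_byWitness[where f' = "\<lambda>\<beta>. (\<beta> d, transpose d (\<beta> d) \<circ> \<beta>)"])
  show "\<forall>a\<in>SIGMA e:U - {d}. matchings (U - {d, e}).
     (case case a of (e, \<beta>) \<Rightarrow> transpose d e \<circ> \<beta> of \<beta> \<Rightarrow> (\<beta> d, transpose d (\<beta> d) \<circ> \<beta>)) = a"
  proof
    fix a assume "a \<in> (SIGMA e:U - {d}. matchings (U - {d, e}))"
    then obtain e \<beta> where a: "a = (e, \<beta>)" "\<beta> \<in> matchings (U - {d, e})" by auto
    then have "\<beta> d = d" by (auto simp: matchings_def permutes_not_in)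
    then show "(case case a of (e, \<beta>) \<Rightarrow> transpose d e \<circ> \<beta> of \<beta> \<Rightarrow> (\<beta> d, transpose d (\<beta> d) \<circ> \<beta>)) = a"
      by (simp add: fun_eq_iff a)
  qed
  show "\<forall>\<beta>\<in>matchings U. (case (\<beta> d, transpose d (\<beta> d) \<circ> \<beta>) of (e, \<beta>) \<Rightarrow> transpose d e \<circ> \<beta>) = \<beta>"
    by (auto simp: fun_eq_iff)
  show "(\<lambda>(e, \<beta>). transpose d e \<circ> \<beta>) ` (SIGMA e:U - {d}. matchings (U - {d, e})) \<subseteq> matchings U"
  proof
    fix \<gamma> assume "\<gamma> \<in> (\<lambda>(e, \<beta>). transpose d e \<circ> \<beta>) ` (SIGMA e:U - {d}. matchings (U - {d, e}))"
    then obtain e \<beta> where g: "\<gamma> = transpose d e \<circ> \<beta>"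
      and e: "e \<in> U" "e \<noteq> d" and b: "\<beta> \<in> matchings (U - {d, e})" by auto
    have b1: "\<beta> permutes U - {d, e}" using b by (simp add: matchings_def)
    have bU: "\<beta> permutes U" using b1 by (rule permutes_subset) auto
    have "transpose d e \<circ> \<beta> permutes U"
      using bU e assms by (intro permutes_compose permutes_swap_id) auto
    moreover have "(transpose d e \<circ> \<beta>) x \<noteq> x \<and> (transpose d e \<circ> \<beta>) ((transpose d e \<circ> \<beta>) x) = x" if "x \<in> U" for x
    proof (cases "x \<in> {d, e}")
      case True
      moreover have "\<beta> d = d" "\<beta> e = e" using b1 by (auto intro: permutes_not_in)
      ultimately show ?thesis using e by auto
    next
      case False
      then have x: "x \<in> U - {d, e}" using that by auto
      then have "\<beta> x \<in> U - {d, e}" using permutes_in_image[OF b1] by blast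
      with x b show ?thesis by (auto simp: matchings_def)
    qed
    ultimately show "\<gamma> \<in> matchings U" unfolding g by (simp add: matchings_def)
  qed
  show "(\<lambda>\<beta>. (\<beta> d, transpose d (\<beta> d) \<circ> \<beta>)) ` matchings U \<subseteq> (SIGMA e:U - {d}. matchings (U - {d, e}))"
  proof clarify
    fix \<beta> assume b: "\<beta> \<in> matchings U"
    let ?e = "\<beta> d"
    have bp: "\<beta> permutes U" and inv: "\<And>x. x \<in> U \<Longrightarrow> \<beta> x \<noteq> x \<and> \<beta> (\<beta> x) = x"
      using b by (auto simp: matchings_def)
    have e: "?e \<in> U" using assms bp by (simp add: permutes_in_image)
    have ed: "?e \<noteq> d" using inv assms by auto
    have val: "(transpose d ?e \<circ> \<beta>) x = \<beta> x" if "x \<in> U - {d, ?e}" for x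
    proof -
      have "\<beta> x \<noteq> d" using that inv[of x] by auto
      moreover have "\<beta> x \<noteq> \<beta> d" using that permutes_inj[OF bp] by (auto simp: inj_eq)
      ultimately show ?thesis by simp
    qed
    have mem: "\<beta> x \<in> U - {d, ?e}" if "x \<in> U - {d, ?e}" for x
      using that inv[of x] inv[of d] assms bp by (auto simp: permutes_in_image)
    have "transpose d ?e \<circ> \<beta> permutes U - {d, ?e}"
    proof (rule permutes_superset)
      show "transpose d ?e \<circ> \<beta> permutes U"
        using bp e assms by (intro permutes_compose permutes_swap_id) auto
      show "(transpose d ?e \<circ> \<beta>) x = x" if "x \<in> U - (U - {d, ?e})" for x using that inv assms by auto
    qed
    moreover have "(transpose d ?e \<circ> \<beta>) x \<noteq> x \<and> (transpose d ?e \<circ> \<beta>) ((transpose d ?e \<circ> \<beta>) x) = x"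
      if "x \<in> U - {d, ?e}" for x
      using val[OF that] val[OF mem[OF that]] inv[of x] that by auto
    ultimately show "?e \<in> U - {d} \<and> transpose d ?e \<circ> \<beta> \<in> matchings (U - {d, ?e})"
      using e ed by (auto simp: matchings_def)
  qed
qed

lemma sum_matchings:
  assumes "finite U" "d \<in> U"
  shows "(\<Sum>\<beta>\<in>matchings U. F \<beta>) = (\<Sum>e\<in>U - {d}. \<Sum>\<beta>\<in>matchings (U - {d, e}). F (transpose d e \<circ> \<beta>))"
proof -
  have "(\<Sum>\<beta>\<in>matchings U. F \<beta>) = (\<Sum>(e, \<beta>)\<in>(SIGMA e : U - {d}. matchings (U - {d, e})). F (transpose d e \<circ> \<beta>))"
    using sum.reindex_bij_betw[OF bij_betw_matchings[OF assms(2)], of F] by (simp add: split_def)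
  also have "\<dots> = (\<Sum>e\<in>U - {d}. \<Sum>\<beta>\<in>matchings (U - {d, e}). F (transpose d e \<circ> \<beta>))"
    using assms(1) by (subst sum.Sigma) auto
  finally show ?thesis .
qed

lemma card_matchings:
  assumes "finite U" "card U = 2 * m"
  shows "card (matchings U) = odd_fact m"
  using assms
proof (induction m arbitrary: U)
  case 0
  then show ?case by simp
next
  case (Suc m)
  then have "U \<noteq> {}" by auto
  then obtain d where d: "d \<in> U" by auto
  have c: "card (U - {d, e}) = 2 * m" if "e \<in> U - {d}" for e
    using that d Suc.prems by (auto simp: card_Diff_subset)
  have "card (matchings U) = (\<Sum>e\<in>U - {d}. card (matchings (U - {d, e})))"
    using sum_matchings[OF Suc.prems(1) d, of "\<lambda>_. 1::nat"] by simp
  also have "\<dots> = (\<Sum>e\<in>U - {d}. odd_fact m)"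
    using c Suc.IH Suc.prems(1) by (intro sum.cong refl) auto
  finally show ?case using Suc.prems d by simp
qed

lemma matchings_odd:
  assumes "finite U" "odd (card U)"
  shows "matchings U = {}"
  using assms
proof (induction "card U" arbitrary: U rule: less_induct)
  case less
  then have "U \<noteq> {}" by auto
  then obtain d where d: "d \<in> U" by auto
  have "matchings (U - {d, e}) = {}" if "e \<in> U - {d}" for e
  proof (rule less.hyps)
    have "card {d, e} = 2" "{d, e} \<subseteq> U" using that d by auto
    then have *: "card (U - {d, e}) = card U - 2" "card U \<ge> 2" 
      using less.prems card_mono[of U "{d, e}"] by (auto simp: card_Diff_subset)
    then show "card (U - {d, e}) < card U" "odd (card (U - {d, e}))" using less.prems by auto
  qed (use less.prems in auto)
  then have "card (matchings U) = 0"
    using sum_matchings[OF less.prems(1) d, of "\<lambda>_. 1::nat"] by simp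
  then show ?case using less.prems by simp
qed

text \<open>This is the revealing step: the partner of \<open>d\<close> is uniform among
  \<open>2 * m - 1\<close> points, and given the partner the rest is again a uniform matching, since
  all the smaller sets have equally many matchings.\<close>

lemma mavg_rec:
  assumes "finite U" "card U = 2 * m" "d \<in> U"
  shows "mavg U F = (\<Sum>e\<in>U - {d}. mavg (U - {d, e}) (\<lambda>\<beta>. F (transpose d e \<circ> \<beta>))) / real (2 * m - 1)"
proof -
  obtain k where m: "m = Suc k" using assms by (cases m) auto
  have c: "card (matchings (U - {d, e})) = odd_fact k" if "e \<in> U - {d}" for e
    using that assms m by (intro card_matchings) (auto simp: card_Diff_subset)
  have "(\<Sum>e\<in>U - {d}. mavg (U - {d, e}) (\<lambda>\<beta>. F (transpose d e \<circ> \<beta>)))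
      = (\<Sum>e\<in>U - {d}. (\<Sum>\<beta>\<in>matchings (U - {d, e}). F (transpose d e \<circ> \<beta>)) / real (odd_fact k))"
    unfolding mavg_def using c by (intro sum.cong refl) simp
  also have "\<dots> = (\<Sum>\<beta>\<in>matchings U. F \<beta>) / real (odd_fact k)"
    by (simp add: sum_matchings[OF assms(1,3)] sum_divide_distrib)
  finally show ?thesis
    using card_matchings[OF assms(1,2)] m unfolding mavg_def
    by (simp add: algebra_simps)
qed

section \<open>Removing a matched pair of darts\<close>

definition peel :: "('a \<Rightarrow> 'a) \<Rightarrow> 'a \<Rightarrow> 'a \<Rightarrow> 'a \<Rightarrow> 'a" where
  "peel s d e = del e (del d (s \<circ> transpose d e))"

lemma peel_permutes:
  assumes "s permutes U" "d \<in> U" "e \<in> U" "d \<noteq> e"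
  shows "peel s d e permutes (U - {d, e})"
proof -
  have "s \<circ> transpose d e permutes U"
    using assms by (intro permutes_compose permutes_swap_id)
  then have "del d (s \<circ> transpose d e) permutes U - {d}" using assms(2) by (rule del_permutes)
  then have "peel s d e permutes (U - {d} - {e})"
    unfolding peel_def by (rule del_permutes) (use assms in auto)
  then show ?thesis by (metis Diff_insert2 insert_commute)
qed

text \<open>Deletion commutes with the unrevealed part of the matching, so it can be carried out
  before that part is known.\<close>

lemma del_comp:
  assumes "b x = x" "inj p"
  shows "del x (p \<circ> b) = del x p \<circ> b"
  using assms by (auto simp: del_def fun_eq_iff)

text \<open>Once \<open>d\<close> and \<open>e\<close> are matched, the product maps
  \<open>d\<close> to \<open>s e\<close> and \<open>e\<close> to \<open>s d\<close>, whatever the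
  rest of the matching is. Deleting the two darts loses a cycle when one of them is fixed at its
  turn, that is when \<open>s e = d\<close> or \<open>s d = e\<close>. The hypothesis on
  \<open>s (s d)\<close> makes these cases exclusive and keeps the first deletion from changing the
  image of \<open>e\<close>.\<close>

lemma ncyc_peel:
  assumes fin: "finite U" and s: "s permutes U" and d: "d \<in> U" and e: "e \<in> U" and de: "d \<noteq> e"
    and b: "\<beta> permutes (U - {d, e})" and sd: "s (s d) \<noteq> d"
  shows "ncyc (s \<circ> (transpose d e \<circ> \<beta>)) U
    = ncyc (peel s d e \<circ> \<beta>) (U - {d, e}) + (if s d = e \<or> s e = d then 1 else 0)"
proof -
  define t where "t = s \<circ> transpose d e"
  have sd1: "s d \<noteq> d" using sd by auto
  have ss: "\<not> (s d = e \<and> s e = d)" using sd by auto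
  have tp: "t permutes U" unfolding t_def
    using s d e by (intro permutes_compose permutes_swap_id)
  have bU: "\<beta> permutes U" using b by (rule permutes_subset) auto
  have bU': "\<beta> permutes (U - {d})" using b by (rule permutes_subset) auto
  have bd: "\<beta> d = d" "\<beta> e = e" using b by (auto simp: permutes_not_in)
  have ti: "inj t" using tp by (rule permutes_inj)
  have p1: "del d t permutes U - {d}" using tp d by (rule del_permutes)
  have i1: "inj (del d t)" using p1 by (rule permutes_inj)
  have "ncyc (t \<circ> \<beta>) U = ncyc (del d (t \<circ> \<beta>)) (U - {d}) + (if (t \<circ> \<beta>) d = d then 1 else 0)"
    using fin tp bU d by (intro ncyc_del permutes_compose)
  also have "del d (t \<circ> \<beta>) = del d t \<circ> \<beta>" using bd ti by (intro del_comp)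
  also have "ncyc (del d t \<circ> \<beta>) (U - {d})
      = ncyc (del e (del d t \<circ> \<beta>)) (U - {d} - {e}) + (if (del d t \<circ> \<beta>) e = e then 1 else 0)"
    using fin p1 bU' e de by (intro ncyc_del permutes_compose) auto
  also have "del e (del d t \<circ> \<beta>) = peel s d e \<circ> \<beta>"
    unfolding peel_def t_def[symmetric] using bd i1 by (intro del_comp)
  also have "U - {d} - {e} = U - {d, e}" by auto
  also have "(if (t \<circ> \<beta>) d = d then 1 else 0) = (if s e = d then 1 else (0::nat))"
    using bd by (simp add: t_def)
  also have "(if (del d t \<circ> \<beta>) e = e then 1 else 0) = (if s d = e then 1 else (0::nat))"
    using bd sd1 de by (simp add: del_apply[OF ti]) (simp add: t_def)
  finally show ?thesis
    using ss by (auto simp: t_def comp_def)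
qed

section \<open>The peeling comparison\<close>

text \<open>
  A fixed point weighs 3 and a 2-cycle weighs 2, so the potential drops even when a fixed point is
  merged with a 3-cycle, which leaves a 2-cycle.
\<close>

definition short_pot :: "('a \<Rightarrow> 'a) \<Rightarrow> 'a set \<Rightarrow> nat" where
  "short_pot s U = card {x \<in> U. s (s x) = x} + 2 * card {x \<in> U. s x = x}"

lemma peel_apply:
  assumes s: "inj s" and de: "d \<noteq> e" and sd: "s d \<noteq> d" and x: "x \<notin> {d, e}"
  shows "peel s d e x =
    (let y = (if s x = d then s e else s x) in if y = e then s d else y)"
proof -
  define t where "t = s \<circ> transpose d e"
  have ti: "inj t" unfolding t_def using s by (intro inj_compose) (auto simp: bij_is_inj)
  have qi: "inj (del d t)" unfolding del_def using ti
    by (intro inj_compose) (auto simp: bij_is_inj)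
  have q: "del d t z = (if z = d then d else if t z = d then t d else t z)" for z
    using del_apply[OF ti] .
  have t: "t d = s e" "t e = s d" "t x = s x" using x by (auto simp: t_def)
  have qe: "del d t e = s d" using q[of e] t de sd by auto
  have qx: "del d t x = (if s x = d then s e else s x)" using q[of x] t x by auto
  show ?thesis
    unfolding peel_def t_def[symmetric] del_apply[OF qi, of e x] qe qx using x
    by (simp add: Let_def)
qed

lemma card_inj_vimage_le:
  assumes "inj s" "finite T"
  shows "finite {x \<in> U. s x \<in> T} \<and> card {x \<in> U. s x \<in> T} \<le> card T"
proof
  have "s ` {x \<in> U. s x \<in> T} \<subseteq> T" by auto
  moreover have "inj_on s {x \<in> U. s x \<in> T}" using assms(1) by (auto simp: inj_on_def inj_def)
  ultimately show "finite {x \<in> U. s x \<in> T}" "card {x \<in> U. s x \<in> T} \<le> card T"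
    using assms(2) by (auto intro: inj_on_finite card_inj_on_le)
qed

text \<open>The new permutation differs from \<open>s\<close> only at the predecessors of
  \<open>d\<close> and \<open>e\<close>. These give at most two new fixed points, each counted
  twice, and at most four new points of period dividing 2, namely the two predecessors and their own
  predecessors under the new permutation; hence the 8.\<close>

lemma short_pot_peel_le:
  assumes fin: "finite U" and s: "s permutes U" and de: "d \<in> U" "e \<in> U" "d \<noteq> e" and sd: "s d \<noteq> d"
  shows "short_pot (peel s d e) (U - {d, e}) \<le> short_pot s U + 8"
proof -
  let ?f = "peel s d e" and ?V = "U - {d, e}"
  have si: "inj s" using s by (rule permutes_inj)
  have fp: "?f permutes ?V" using s de by (intro peel_permutes)
  have fi: "inj ?f" using fp by (rule permutes_inj)
  define T where "T = {x \<in> ?V. s x \<in> {d, e}}"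
  have T: "finite T" "card T \<le> 2"
    using card_inj_vimage_le[OF si, of "{d, e}" ?V] de by (auto simp: T_def)
  define T' where "T' = {x \<in> ?V. ?f x \<in> T}"
  have T': "finite T'" "card T' \<le> 2"
    using card_inj_vimage_le[OF fi T(1), of ?V] T by (auto simp: T'_def)
  have eq: "?f x = s x" if "x \<in> ?V" "x \<notin> T" for x
  proof -
    have "s x \<noteq> d" "s x \<noteq> e" using that by (auto simp: T_def)
    then show ?thesis using peel_apply[OF si de(3) sd, of x] that by auto
  qed
  have mem: "?f x \<in> ?V" if "x \<in> ?V" for x using that permutes_in_image[OF fp] by blast
  have "{x \<in> ?V. ?f x = x} \<subseteq> {x \<in> U. s x = x} \<union> T" using eq by auto
  then have "card {x \<in> ?V. ?f x = x} \<le> card ({x \<in> U. s x = x} \<union> T)"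
    using fin T by (intro card_mono) auto
  also have "\<dots> \<le> card {x \<in> U. s x = x} + card T" by (rule card_Un_le)
  finally have 1: "card {x \<in> ?V. ?f x = x} \<le> card {x \<in> U. s x = x} + 2" using T by simp
  have "{x \<in> ?V. ?f (?f x) = x} \<subseteq> {x \<in> U. s (s x) = x} \<union> (T \<union> T')"
  proof
    fix x assume x: "x \<in> {x \<in> ?V. ?f (?f x) = x}"
    show "x \<in> {x \<in> U. s (s x) = x} \<union> (T \<union> T')"
    proof (cases "x \<in> T \<union> T'")
      case False
      then have fx: "?f x = s x" using eq x by auto
      have "?f x \<notin> T" using False x by (auto simp: T'_def)
      then have "?f (?f x) = s (s x)" using eq[of "?f x"] mem[of x] x fx by auto
      then show ?thesis using x by auto
    qed auto
  qed
  then have "card {x \<in> ?V. ?f (?f x) = x} \<le> card ({x \<in> U. s (s x) = x} \<union> (T \<union> T'))"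
    using fin T T' by (intro card_mono) auto
  also have "\<dots> \<le> card {x \<in> U. s (s x) = x} + (card T + card T')"
    by (intro order.trans[OF card_Un_le] add_mono order_refl card_Un_le)
  finally show ?thesis unfolding short_pot_def using 1 T T' by simp
qed

text \<open>
  Only the at most six partners at distance at most 3 from \<^term>\<open>d\<close> on its cycle can create
  new short cycles, and any other partner on a short cycle lowers the potential.
\<close>

lemma short_pot_peel_generic:
  assumes fin: "finite U" and s: "s permutes U" and de: "d \<in> U" "e \<in> U" "d \<noteq> e"
    and sd: "s (s d) \<noteq> d"
    and ge: "e \<noteq> s d" "e \<noteq> s (s d)" "e \<noteq> s (s (s d))"
    and gd: "d \<noteq> s e" "d \<noteq> s (s e)" "d \<noteq> s (s (s e))"
  shows "short_pot (peel s d e) (U - {d, e}) + (if s (s e) = e then 1 else 0) \<le> short_pot s U"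
proof -
  let ?f = "peel s d e" and ?V = "U - {d, e}"
  have si: "inj s" using s by (rule permutes_inj)
  have sd1: "s d \<noteq> d" using sd by auto
  have fp: "?f permutes ?V" using s de by (intro peel_permutes)
  have mem: "?f x \<in> ?V" if "x \<in> ?V" for x using that permutes_in_image[OF fp] by blast
  let ?Y = "{x \<in> U. s (s x) = x}" and ?A = "{x \<in> U. s x = x}"
  show ?thesis
  proof (cases "s e = e")
    case True
    \<comment> \<open>Peeling now deletes the fixed point \<open>e\<close> and closes the gap left
      by \<open>d\<close>. If \<open>d\<close> was on a 3-cycle, its two neighbours become a 2-cycle
      and \<open>?Y\<close> gains 2; but \<open>?Y\<close> loses \<open>e\<close>, and so does the
      doubled count of fixed points. The net change is at most
      \<open>2 - 1 - 2 = - 1\<close>.\<close>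
    have f: "?f x = (if s x = d then s d else s x)" if "x \<in> ?V" for x
    proof -
      have "s x \<noteq> e" using that True si by (metis DiffE injD insertCI)
      then show ?thesis using peel_apply[OF si de(3) sd1, of x] that True by auto
    qed
    have "{x \<in> ?V. ?f x = x} \<subseteq> ?A - {e}" using f sd by (auto split: if_splits)
    then have "card {x \<in> ?V. ?f x = x} \<le> card (?A - {e})" using fin by (intro card_mono) auto
    also have "\<dots> = card ?A - 1" using True de by (subst card_Diff_singleton) auto
    finally have 1: "card {x \<in> ?V. ?f x = x} \<le> card ?A - 1" .
    have A: "card ?A > 0" using True de fin by (auto simp: card_gt_0_iff)
    have "{x \<in> ?V. ?f (?f x) = x} \<subseteq> (?Y - {e}) \<union> ({s d} \<union> {x \<in> ?V. s x \<in> {d}})"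
    proof
      fix x assume x: "x \<in> {x \<in> ?V. ?f (?f x) = x}"
      then have xV: "x \<in> ?V" by auto
      show "x \<in> (?Y - {e}) \<union> ({s d} \<union> {x \<in> ?V. s x \<in> {d}})"
      proof (cases "s x = d")
        case False
        then have "?f x = s x" using f xV by auto
        then have "x = (if s (s x) = d then s d else s (s x))" using f[of "?f x"] mem[OF xV] x by auto
        then show ?thesis using xV by (auto split: if_splits)
      qed (use x in auto)
    qed
    then have "card {x \<in> ?V. ?f (?f x) = x} \<le> card ((?Y - {e}) \<union> ({s d} \<union> {x \<in> ?V. s x \<in> {d}}))"
      using fin by (intro card_mono) auto
    also have "\<dots> \<le> card (?Y - {e}) + (card {s d} + card {x \<in> ?V. s x \<in> {d}})"
      by (intro order.trans[OF card_Un_le] add_mono order_refl card_Un_le)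
    also have "card (?Y - {e}) = card ?Y - 1" using True de by (subst card_Diff_singleton) auto
    finally have "card {x \<in> ?V. ?f (?f x) = x} \<le> (card ?Y - 1) + (1 + 1)"
      using card_inj_vimage_le[OF si, of "{d}" ?V] by simp
    moreover have "card ?Y > 0" using True de fin by (auto simp: card_gt_0_iff)
    ultimately show ?thesis using 1 A True unfolding short_pot_def by simp
  next
    case False
    have f: "?f x = (if s x = d then s e else if s x = e then s d else s x)" if "x \<in> ?V" for x
      using peel_apply[OF si de(3) sd1, of x] that False by auto
    have "{x \<in> ?V. ?f x = x} \<subseteq> ?A" using f ge gd by (auto split: if_splits)
    then have 1: "card {x \<in> ?V. ?f x = x} \<le> card ?A" using fin by (intro card_mono) auto
    have Ysub: "{x \<in> ?V. ?f (?f x) = x} \<subseteq> ?Y - {e}"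
    proof
      fix x assume x: "x \<in> {x \<in> ?V. ?f (?f x) = x}"
      then have xV: "x \<in> ?V" by auto
      have ff: "?f (?f x) = x" using x by auto
      have f2: "?f (?f x) = (if s (?f x) = d then s e else if s (?f x) = e then s d else s (?f x))"
        using f mem[OF xV] by blast
      have cd: "s x = s y \<longleftrightarrow> x = y" for x y using si by (simp add: inj_eq)
      \<comment> \<open>A rerouted point that returns after two steps would force one of the six
        excluded coincidences or \<open>s (s d) = d\<close>.\<close>
      consider "s x = d" | "s x = e" | "s x \<noteq> d" "s x \<noteq> e" by blast
      then have "s (s x) = x"
      proof cases
        case 1
        then have "?f x = s e" using f[OF xV] by auto
        then show ?thesis using f2 ff gd ge 1 sd by (auto split: if_splits)
      next
        case 2
        then have "?f x = s d" using f[OF xV] de by auto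
        then show ?thesis using f2 ff gd ge 2 sd by (auto split: if_splits)
      next
        case 3
        then have "?f x = s x" using f[OF xV] by auto
        then show ?thesis using f2 ff gd ge 3 sd by (auto split: if_splits)
      qed
      then show "x \<in> ?Y - {e}" using xV by auto
    qed
    then have 2: "card {x \<in> ?V. ?f (?f x) = x} \<le> card (?Y - {e})" using fin by (intro card_mono) auto
    show ?thesis
    proof (cases "s (s e) = e")
      case True
      have "card (?Y - {e}) = card ?Y - 1" using True de by (subst card_Diff_singleton) auto
      moreover have "card ?Y > 0" using True de fin by (auto simp: card_gt_0_iff)
      ultimately show ?thesis using 1 2 True unfolding short_pot_def by simp
    next
      case False
      then have "?Y - {e} = ?Y" by auto
      then show ?thesis using 1 2 False unfolding short_pot_def by simp
    qed
  qed
qed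

section \<open>Expected change of the potential in one step\<close>

lemma sum_indicator_real:
  "finite A \<Longrightarrow> (\<Sum>x\<in>A. indicator B x :: real) = real (card (A \<inter> B))"
  by (induction A rule: finite_induct) (auto simp: Int_insert_left)

text \<open>At most six partners lie within distance 3 of \<open>d\<close>; each multiplies
  \<open>2 ^ short_pot\<close> by at most \<open>2 ^ 8 = 256\<close>, and
  \<open>6 * 256 = 1536\<close>. Every other partner leaves it no larger, and at least halves it
  when it lies on a short cycle. So the average shrinks as soon as short cycles are
  numerous.\<close>

lemma sum_short_pot_peel:
  assumes fin: "finite U" and s: "s permutes U" and d: "d \<in> U" and sd: "s (s d) \<noteq> d"
  shows "(\<Sum>e\<in>U - {d}. (2::real) ^ short_pot (peel s d e) (U - {d, e}))
    \<le> 2 ^ short_pot s U * (real (card U) - 1 + 1536 - real (card {x \<in> U. s (s x) = x}) / 2)"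
proof -
  let ?Z = "short_pot s U" and ?Y = "{x \<in> U. s (s x) = x}"
  have si: "inj s" using s by (rule permutes_inj)
  have sd1: "s d \<noteq> d" using sd by auto
  define X where "X = {s d, s (s d), s (s (s d))} \<union> ({x \<in> U. s x \<in> {d}} \<union> ({x \<in> U. (s \<circ> s) x \<in> {d}}
    \<union> {x \<in> U. (s \<circ> (s \<circ> s)) x \<in> {d}}))"
  have i2: "inj (s \<circ> s)" "inj (s \<circ> (s \<circ> s))" using si by (auto intro: inj_compose)
  have c1: "card {x \<in> U. s x \<in> {d}} \<le> 1" "card {x \<in> U. (s \<circ> s) x \<in> {d}} \<le> 1"
      "card {x \<in> U. (s \<circ> (s \<circ> s)) x \<in> {d}} \<le> 1"
    using card_inj_vimage_le[OF si, of "{d}" U] card_inj_vimage_le[OF i2(1), of "{d}" U]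
      card_inj_vimage_le[OF i2(2), of "{d}" U] by simp_all
  have "card {s d, s (s d), s (s (s d))} \<le> 3" by (simp add: card_insert_le_m1)
  then have "card X \<le> 3 + (1 + (1 + 1))" unfolding X_def
    using c1 by (intro order.trans[OF card_Un_le] add_mono) 
  then have cX: "card X \<le> 6" by simp
  have finX: "finite X" unfolding X_def using fin by auto
  have pt: "(2::real) ^ short_pot (peel s d e) (U - {d, e})
      \<le> 2 ^ ?Z * (1 + 256 * indicator X e - indicator ?Y e / 2)" if "e \<in> U - {d}" for e
  proof (cases "e \<in> X")
    case True
    have "short_pot (peel s d e) (U - {d, e}) \<le> ?Z + 8"
      using that d fin s sd1 by (intro short_pot_peel_le) auto
    then have "(2::real) ^ short_pot (peel s d e) (U - {d, e}) \<le> 2 ^ (?Z + 8)"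
      by (intro power_increasing) auto
    also have "\<dots> = 2 ^ ?Z * 256" by (simp add: power_add)
    also have "\<dots> \<le> 2 ^ ?Z * (1 + 256 * indicator X e - indicator ?Y e / 2)"
      using True by (intro mult_left_mono) (auto simp: indicator_def)
    finally show ?thesis .
  next
    case False
    have le: "short_pot (peel s d e) (U - {d, e}) + (if s (s e) = e then 1 else 0) \<le> ?Z"
      using that d fin s sd False by (intro short_pot_peel_generic) (auto simp: X_def)
    show ?thesis
    proof (cases "s (s e) = e")
      case True
      then have "Suc (short_pot (peel s d e) (U - {d, e})) \<le> ?Z" using le by simp
      then have "(2::real) ^ Suc (short_pot (peel s d e) (U - {d, e})) \<le> 2 ^ ?Z"
        by (intro power_increasing) auto
      then show ?thesis using False True that by simp
    next
      case no: False
      then have "(2::real) ^ (short_pot (peel s d e) (U - {d, e})) \<le> 2 ^ ?Z"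
        using le by (intro power_increasing) auto
      then show ?thesis using False no by simp
    qed
  qed
  have "(\<Sum>e\<in>U - {d}. (2::real) ^ short_pot (peel s d e) (U - {d, e}))
      \<le> (\<Sum>e\<in>U - {d}. 2 ^ ?Z * (1 + 256 * indicator X e - indicator ?Y e / 2))"
    using pt by (intro sum_mono)
  also have "\<dots> = 2 ^ ?Z * (real (card (U - {d})) + 256 * real (card ((U - {d}) \<inter> X))
      - real (card ((U - {d}) \<inter> ?Y)) / 2)"
    using fin by (simp add: sum_distrib_left[symmetric] sum.distrib sum_subtractf
        sum_divide_distrib[symmetric] sum_indicator_real)
  also have "(U - {d}) \<inter> ?Y = ?Y" using sd by auto
  also have "real (card (U - {d})) = real (card U) - 1"
  proof -
    have "card U > 0" using fin d by (auto simp: card_gt_0_iff)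
    then show ?thesis using d by (simp add: of_nat_diff)
  qed
  also have "2 ^ ?Z * (real (card U) - 1 + 256 * real (card ((U - {d}) \<inter> X)) - real (card ?Y) / 2)
      \<le> 2 ^ ?Z * (real (card U) - 1 + 1536 - real (card ?Y) / 2)"
  proof -
    have "card ((U - {d}) \<inter> X) \<le> card X" using finX by (intro card_mono) auto
    then have "card ((U - {d}) \<inter> X) \<le> 6" using cX by simp
    then have "256 * real (card ((U - {d}) \<inter> X)) \<le> 1536" by simp
    then show ?thesis by (intro mult_left_mono) auto
  qed
  finally show ?thesis .
qed

text \<open>\<open>1538\<close> is \<open>1536 + 2\<close>, the 2 being withheld in the induction to
  pay for the growth of the factor \<open>1 / m\<close>. The drift is positive only with fewer than
  \<open>2 * 1538\<close> points on short cycles, and each such point contributes at most 3 to the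
  potential; hence the exponent \<open>6 * 1538\<close>.\<close>

definition peel_const :: real where "peel_const = 1538 * 2 ^ (6 * 1538)"

lemma peel_const_nonneg: "peel_const \<ge> 0" by (simp add: peel_const_def)

lemma power_drift_le:
  assumes "Z \<le> 3 * Y"
  shows "(2::real) ^ Z * (real N - real Y / 2) \<le> real N * 2 ^ (6 * N)"
proof (cases "Y < 2 * N")
  case True
  then have "(2::real) ^ Z \<le> 2 ^ (6 * N)" using assms by (intro power_increasing) auto
  then have "(2::real) ^ Z * (real N - real Y / 2) \<le> 2 ^ (6 * N) * real N"
    using True by (intro mult_mono) auto
  then show ?thesis by (simp add: mult.commute)
next
  case False
  then have "(2::real) ^ Z * (real N - real Y / 2) \<le> 0" by (intro mult_nonneg_nonpos) auto
  also have "0 \<le> real N * 2 ^ (6 * N)" by simp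
  finally show ?thesis .
qed

lemma mavg_le:
  assumes "finite U" "card U = 2 * m" "\<And>\<beta>. \<beta> \<in> matchings U \<Longrightarrow> F \<beta> \<le> c"
  shows "mavg U F \<le> c"
proof -
  have "card (matchings U) > 0" using card_matchings[OF assms(1,2)] odd_fact_pos by simp
  moreover have "(\<Sum>\<beta>\<in>matchings U. F \<beta>) \<le> (\<Sum>\<beta>\<in>matchings U. c)" using assms(3) by (intro sum_mono)
  ultimately show ?thesis by (simp add: mavg_def field_simps)
qed

section \<open>Comparison with a sum of independent Bernoulli variables\<close>

definition close_prob :: "nat \<Rightarrow> real" where "close_prob m = 2 / (2 * real m - 1)"

text \<open>Here \<open>j\<close> counts the faces already completed. The error term has to survive
  the averaging over partners and to cover \<open>\<kappa> * 2 ^ m\<close> at breakdown. The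
  exponential potential divided by \<open>m\<close> does both, up to a remainder of order
  \<open>1 / m ^ 2\<close> per step that telescopes into
  \<open>peel_const * (1 - 1 / m)\<close>.\<close>

lemma peeling_comparison:
  fixes A :: "nat \<Rightarrow> nat \<Rightarrow> real" and \<phi> :: "nat \<Rightarrow> real"
  assumes rec: "\<And>m j. m \<ge> 2 \<Longrightarrow>
      (1 - close_prob m) * A (m - 1) j + close_prob m * A (m - 1) (Suc j) \<le> A m j"
    and brk: "\<And>m j f. m \<ge> 1 \<Longrightarrow> f \<le> 2 * m \<Longrightarrow> \<phi> (j + f) \<le> A m j + \<kappa> * 2 ^ m"
    and k0: "\<kappa> \<ge> 0"
    and "finite U" "s permutes U" "card U = 2 * m" "m \<ge> 1"
  shows "mavg U (\<lambda>\<beta>. \<phi> (j + ncyc (s \<circ> \<beta>) U))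
    \<le> A m j + \<kappa> * (2 ^ short_pot s U / real m + peel_const * (1 - 1 / real m))"
  using assms(4-)
proof (induction m arbitrary: U s j rule: less_induct)
  case (less m)
  note fin = less.prems(1) and s = less.prems(2) and cU = less.prems(3) and m1 = less.prems(4)
  show ?case
  proof (cases "\<forall>x\<in>U. s (s x) = x")
    case True
    \<comment> \<open>At breakdown all \<open>2 * m\<close> darts are on short cycles, so the
      potential is at least \<open>2 * m\<close>, and \<open>4 ^ m / m \<ge> 2 ^ m\<close> covers
      the permitted error.\<close>
    then have "{x \<in> U. s (s x) = x} = U" by auto
    then have Z: "2 * m \<le> short_pot s U" unfolding short_pot_def using cU by simp
    have "real m \<le> 2 ^ m" by (metis less_imp_le of_nat_less_two_power)
    then have "real m * 2 ^ m \<le> 2 ^ m * 2 ^ m" by (intro mult_right_mono) auto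
    also have "\<dots> = (2::real) ^ (2 * m)" by (simp add: power_add[symmetric] mult_2)
    also have "\<dots> \<le> 2 ^ short_pot s U" using Z by (intro power_increasing) auto
    finally have "2 ^ m \<le> (2::real) ^ short_pot s U / real m" using m1 by (simp add: field_simps)
    also have "\<dots> \<le> 2 ^ short_pot s U / real m + peel_const * (1 - 1 / real m)"
      using m1 peel_const_nonneg by simp
    finally have b: "\<kappa> * 2 ^ m \<le> \<kappa> * (2 ^ short_pot s U / real m + peel_const * (1 - 1 / real m))"
      using k0 by (intro mult_left_mono)
    have "\<phi> (j + ncyc (s \<circ> \<beta>) U) \<le> A m j + \<kappa> * 2 ^ m" for \<beta>
      using ncyc_le_card[OF fin, of "s \<circ> \<beta>"] cU m1 by (intro brk) auto
    then have "mavg U (\<lambda>\<beta>. \<phi> (j + ncyc (s \<circ> \<beta>) U)) \<le> A m j + \<kappa> * 2 ^ m"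
      using fin cU by (intro mavg_le)
    then show ?thesis using b by linarith
  next
    case False
    then obtain d where d: "d \<in> U" and sd: "s (s d) \<noteq> d" by auto
    have si: "inj s" using s by (rule permutes_inj)
    have sd1: "s d \<noteq> d" using sd by auto
    have sdU: "s d \<in> U" "s (s d) \<in> U" using d permutes_in_image[OF s] by auto
    \<comment> \<open>A cycle of length at least 3 in a set of even size needs four points.\<close>
    have m2: "m \<ge> 2"
    proof -
      have "card {d, s d, s (s d)} = 3" using sd sd1 si by (auto simp: inj_eq)
      moreover have "card {d, s d, s (s d)} \<le> card U"
        using d sdU fin by (intro card_mono) auto
      ultimately show ?thesis using cU by simp
    qed
    let ?Z = "short_pot s U" and ?Y = "{x \<in> U. s (s x) = x}"
    define c where "c e = (if s d = e \<or> s e = d then 1 else 0::nat)" for e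
    define G where "G e = (2::real) ^ short_pot (peel s d e) (U - {d, e})" for e
    have each: "mavg (U - {d, e}) (\<lambda>\<beta>. \<phi> (j + ncyc (s \<circ> (transpose d e \<circ> \<beta>)) U))
        \<le> A (m - 1) (j + c e) + \<kappa> * (G e / real (m - 1) + peel_const * (1 - 1 / real (m - 1)))"
      if e: "e \<in> U - {d}" for e
    proof -
      have "mavg (U - {d, e}) (\<lambda>\<beta>. \<phi> (j + ncyc (s \<circ> (transpose d e \<circ> \<beta>)) U))
        = mavg (U - {d, e}) (\<lambda>\<beta>. \<phi> ((j + c e) + ncyc (peel s d e \<circ> \<beta>) (U - {d, e})))"
        unfolding mavg_def
      proof (intro arg_cong2[where f = "(/)"] sum.cong refl)
        fix \<beta> assume "\<beta> \<in> matchings (U - {d, e})"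
        then have "\<beta> permutes (U - {d, e})" by (simp add: matchings_def)
        then show "\<phi> (j + ncyc (s \<circ> (transpose d e \<circ> \<beta>)) U)
            = \<phi> ((j + c e) + ncyc (peel s d e \<circ> \<beta>) (U - {d, e}))"
          using ncyc_peel[OF fin s d _ _ _ sd, of e \<beta>] e by (auto simp: c_def)
      qed
      also have "\<dots> \<le> A (m - 1) (j + c e) + \<kappa> * (G e / real (m - 1) + peel_const * (1 - 1 / real (m - 1)))"
        unfolding G_def
      proof (rule less.IH)
        show "peel s d e permutes U - {d, e}" using s d e by (intro peel_permutes) auto
        show "card (U - {d, e}) = 2 * (m - 1)" using e d cU by (auto simp: card_Diff_subset)
      qed (use m2 fin in auto)
      finally show ?thesis .
    qed
    let ?N = "2 * real m - 1"
    have N: "real (2 * m - 1) = ?N" using m1 by (simp add: of_nat_diff)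
    have "mavg U (\<lambda>\<beta>. \<phi> (j + ncyc (s \<circ> \<beta>) U)) =
        (\<Sum>e\<in>U - {d}. mavg (U - {d, e}) (\<lambda>\<beta>. \<phi> (j + ncyc (s \<circ> (transpose d e \<circ> \<beta>)) U))) / ?N"
      using mavg_rec[OF fin cU d] N by simp
    also have "\<dots> \<le> (\<Sum>e\<in>U - {d}. A (m - 1) (j + c e)
        + \<kappa> * (G e / real (m - 1) + peel_const * (1 - 1 / real (m - 1)))) / ?N"
      using each m1 by (intro divide_right_mono sum_mono) auto
    also have "\<dots> = (\<Sum>e\<in>U - {d}. A (m - 1) (j + c e)) / ?N
        + \<kappa> * ((\<Sum>e\<in>U - {d}. G e) / real (m - 1) + ?N * (peel_const * (1 - 1 / real (m - 1)))) / ?N"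
    proof -
      have "real (card (U - {d})) = ?N" using d fin cU N by simp
      then show ?thesis
        by (simp add: sum.distrib sum_distrib_left[symmetric] sum_divide_distrib[symmetric]
            add_divide_distrib)
    qed
    also have "(\<Sum>e\<in>U - {d}. A (m - 1) (j + c e)) / ?N
        = (1 - close_prob m) * A (m - 1) j + close_prob m * A (m - 1) (Suc j)"
    proof -
      \<comment> \<open>The closing partners are the successor and the predecessor of
        \<open>d\<close>; they differ because \<open>s (s d) \<noteq> d\<close>.\<close>
      obtain p where p: "s p = d" using permutes_surj[OF s] by (metis surjD)
      have pU: "p \<in> U" using p d permutes_in_image[OF s] by metis
      have ps: "p \<noteq> s d" "p \<noteq> d" using p sd sd1 by auto
      have "(\<Sum>e\<in>U - {d}. A (m - 1) (j + c e))
          = (\<Sum>e\<in>U - {d} - {s d, p}. A (m - 1) (j + c e)) + (\<Sum>e\<in>{s d, p}. A (m - 1) (j + c e))"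
        using fin pU ps sdU sd1 by (intro sum.subset_diff) auto
      also have "(\<Sum>e\<in>{s d, p}. A (m - 1) (j + c e)) = 2 * A (m - 1) (Suc j)"
        using ps p by (auto simp: c_def)
      also have "(\<Sum>e\<in>U - {d} - {s d, p}. A (m - 1) (j + c e)) = (\<Sum>e\<in>U - {d} - {s d, p}. A (m - 1) j)"
      proof (intro sum.cong refl)
        fix e assume e: "e \<in> U - {d} - {s d, p}"
        then have "s e \<noteq> d" using p si by (auto simp: inj_def)
        then show "A (m - 1) (j + c e) = A (m - 1) j" using e by (auto simp: c_def)
      qed
      also have "\<dots> = real (card (U - {d} - {s d, p})) * A (m - 1) j" by simp
      also have "card (U - {d} - {s d, p}) = 2 * m - 3"
        using fin pU ps sdU sd1 d cU by (subst card_Diff_subset) auto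
      also have "real (2 * m - 3) = ?N - 2" using m2 by (simp add: of_nat_diff)
      finally have S: "(\<Sum>e\<in>U - {d}. A (m - 1) (j + c e))
          = (?N - 2) * A (m - 1) j + 2 * A (m - 1) (Suc j)" .
      have "((N - 2) * a + 2 * b) / N = (1 - 2 / N) * a + 2 / N * b" if "N > 0" for N a b :: real
        using that by (simp add: field_simps)
      from this[of ?N] show ?thesis unfolding S close_prob_def using m1 by simp
    qed
    also have "\<dots> \<le> A m j" using rec[OF m2] .
    also have "\<kappa> * ((\<Sum>e\<in>U - {d}. G e) / real (m - 1) + ?N * (peel_const * (1 - 1 / real (m - 1)))) / ?N
        \<le> \<kappa> * (2 ^ ?Z / real m + peel_const * (1 - 1 / real m))"
    proof -
      define k where "k = real m - 1"
      have k: "real (m - 1) = k" "real m = k + 1" "k \<ge> 1" using m2 by (auto simp: k_def of_nat_diff)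
      have N2: "?N = 2 * k + 1" using k by simp
      have ZY: "?Z \<le> 3 * card ?Y"
      proof -
        have "card {x \<in> U. s x = x} \<le> card ?Y" using fin by (intro card_mono) auto
        then show ?thesis unfolding short_pot_def by simp
      qed
      have "(\<Sum>e\<in>U - {d}. G e) \<le> 2 ^ ?Z * (real (card U) - 1 + 1536 - real (card ?Y) / 2)"
        unfolding G_def using fin s d sd by (intro sum_short_pot_peel)
      \<comment> \<open>With \<open>k = m - 1\<close> the main factor is lowered from
        \<open>2 * k + 1\<close> to \<open>2 * k - 1\<close>. Then
        \<open>(2 * k - 1) / (k * (2 * k + 1)) \<le> 1 / (k + 1)\<close>, so the weight
        \<open>1 / k\<close> of the smaller problem is brought back to \<open>1 / m\<close>.\<close>
      also have "\<dots> = 2 ^ ?Z * (?N - 2) + 2 ^ ?Z * (1538 - real (card ?Y) / 2)"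
        using cU by (simp add: algebra_simps)
      also have "2 ^ ?Z * (1538 - real (card ?Y) / 2) \<le> peel_const"
        unfolding peel_const_def using power_drift_le[OF ZY, of 1538] by (simp only: of_nat_numeral)
      finally have S: "(\<Sum>e\<in>U - {d}. G e) \<le> 2 ^ ?Z * (2 * k - 1) + peel_const"
        using N2 by simp
      have "(\<Sum>e\<in>U - {d}. G e) / (k * (2 * k + 1)) \<le> (2 ^ ?Z * (2 * k - 1) + peel_const) / (k * (2 * k + 1))"
        using S k by (intro divide_right_mono) auto
      also have "\<dots> = 2 ^ ?Z * ((2 * k - 1) / (k * (2 * k + 1))) + peel_const * (1 / (k * (2 * k + 1)))"
        by (simp add: add_divide_distrib)
      also have "\<dots> \<le> 2 ^ ?Z * (1 / (k + 1)) + peel_const * (1 / k - 1 / (k + 1))"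
      proof (intro add_mono mult_left_mono)
        show "(2 * k - 1) / (k * (2 * k + 1)) \<le> 1 / (k + 1)"
        proof -
          have "a / b \<le> c / d" if "a * d \<le> c * b" "b > 0" "d > 0" for a b c d :: real
            using that by (simp add: field_simps)
          moreover have "(2 * k - 1) * (k + 1) \<le> 1 * (k * (2 * k + 1))" by (simp add: algebra_simps)
          ultimately show ?thesis using k by simp
        qed
        have "1 / (k * (2 * k + 1)) \<le> 1 / (k * (k + 1))"
          using k by (intro divide_left_mono mult_left_mono) auto
        also have "\<dots> = 1 / k - 1 / (k + 1)" using k by (simp add: field_simps)
        finally show "1 / (k * (2 * k + 1)) \<le> 1 / k - 1 / (k + 1)" .
      qed (use peel_const_nonneg in auto)
      finally have "(\<Sum>e\<in>U - {d}. G e) / (k * (2 * k + 1)) + peel_const * (1 - 1 / k)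
          \<le> 2 ^ ?Z / (k + 1) + peel_const * (1 - 1 / (k + 1))"
        by (simp add: algebra_simps)
      moreover have "((\<Sum>e\<in>U - {d}. G e) / k + (2 * k + 1) * (peel_const * (1 - 1 / k))) / (2 * k + 1)
          = (\<Sum>e\<in>U - {d}. G e) / (k * (2 * k + 1)) + peel_const * (1 - 1 / k)"
        using k by (simp add: add_divide_distrib)
      ultimately have "((\<Sum>e\<in>U - {d}. G e) / k + (2 * k + 1) * (peel_const * (1 - 1 / k))) / (2 * k + 1)
          \<le> 2 ^ ?Z / (k + 1) + peel_const * (1 - 1 / (k + 1))" by simp
      then have "\<kappa> * (((\<Sum>e\<in>U - {d}. G e) / k + (2 * k + 1) * (peel_const * (1 - 1 / k))) / (2 * k + 1))
          \<le> \<kappa> * (2 ^ ?Z / (k + 1) + peel_const * (1 - 1 / (k + 1)))"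
        using k0 by (intro mult_left_mono)
      then show ?thesis unfolding N2 k(1) unfolding k(2) by (simp only: times_divide_eq_right)
    qed
    finally show ?thesis by simp
  qed
qed

section \<open>Moments and characteristic function of the number of faces\<close>

abbreviation expect :: "'a pmf \<Rightarrow> ('a \<Rightarrow> 'b) \<Rightarrow> 'b::{banach, second_countable_topology}" where
  "expect \<equiv> measure_pmf.expectation"

text \<open>The sum starts at 2 because a cycle of length at least 3 requires four free darts;
  moreover \<open>close_prob 1 = 2\<close> is not a probability.\<close>

definition peel_mean :: "nat \<Rightarrow> real" where
  "peel_mean m = (\<Sum>k=2..m. close_prob k)"

definition peel_var :: "nat \<Rightarrow> real" where
  "peel_var m = (\<Sum>k=2..m. close_prob k * (1 - close_prob k))"

definition peel_char :: "real \<Rightarrow> nat \<Rightarrow> complex" where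
  "peel_char \<theta> m = (\<Prod>k=2..m. 1 + close_prob k * (cis \<theta> - 1))"

text \<open>
  All that is used about the law of the number of faces: \<^term>\<open>A m j\<close> plays the role of the
  mean of \<^term>\<open>\<phi>\<close> at \<^term>\<open>j\<close> plus a sum of independent Bernoulli variables with parameters
  \<^term>\<open>close_prob k\<close>, \<^term>\<open>k \<le> m\<close>, and the error allowed after the breakdown of the
  revealing procedure with \<^term>\<open>2 * m\<close> darts left may grow exponentially in \<^term>\<open>m\<close>.
\<close>

definition peel_law :: "nat \<Rightarrow> nat pmf \<Rightarrow> bool" where
  "peel_law m \<mu> \<longleftrightarrow> set_pmf \<mu> \<subseteq> {..2 * m} \<and> (\<forall>A \<phi> \<kappa>. \<kappa> \<ge> 0 \<longrightarrow>
     (\<forall>m j. m \<ge> 2 \<longrightarrow> (1 - close_prob m) * A (m - 1) j + close_prob m * A (m - 1) (Suc j) \<le> A m j) \<longrightarrow>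
     (\<forall>m j f. m \<ge> 1 \<longrightarrow> f \<le> 2 * m \<longrightarrow> \<phi> (j + f) \<le> A m j + \<kappa> * 2 ^ m) \<longrightarrow>
     expect \<mu> \<phi> \<le> A m 0 + \<kappa> * (1 + peel_const))"

lemma peel_lawD:
  assumes "peel_law m \<mu>" "\<kappa> \<ge> 0"
    and "\<And>m j. m \<ge> 2 \<Longrightarrow> (1 - close_prob m) * A (m - 1) j + close_prob m * A (m - 1) (Suc j) \<le> A m j"
    and "\<And>m j f. m \<ge> 1 \<Longrightarrow> f \<le> 2 * m \<Longrightarrow> \<phi> (j + f) \<le> A m j + \<kappa> * 2 ^ m"
  shows "expect \<mu> \<phi> \<le> A m 0 + \<kappa> * (1 + peel_const)"
  using assms unfolding peel_law_def by blast

section \<open>Recursions and elementary bounds\<close>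

lemma close_prob_bounds:
  assumes "k \<ge> 2" shows "0 \<le> close_prob k" "close_prob k \<le> 1"
proof -
  have "real k \<ge> 2" using assms by simp
  then show "0 \<le> close_prob k" "close_prob k \<le> 1" unfolding close_prob_def by (simp_all add: field_simps)
qed

lemma sum_from_2_rec:
  fixes f :: "nat \<Rightarrow> real"
  assumes "m \<ge> 2" shows "(\<Sum>k=2..m. f k) = (\<Sum>k=2..m - 1. f k) + f m"
  using assms by (cases m) (auto simp: sum.cl_ivl_Suc)

lemma peel_mean_rec: "m \<ge> 2 \<Longrightarrow> peel_mean m = peel_mean (m - 1) + close_prob m"
  unfolding peel_mean_def by (rule sum_from_2_rec)

lemma peel_var_rec: "m \<ge> 2 \<Longrightarrow> peel_var m = peel_var (m - 1) + close_prob m * (1 - close_prob m)"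
  unfolding peel_var_def by (rule sum_from_2_rec)

lemma peel_char_rec: "m \<ge> 2 \<Longrightarrow> peel_char \<theta> m = peel_char \<theta> (m - 1) * (1 + close_prob m * (cis \<theta> - 1))"
  unfolding peel_char_def by (cases m) (auto simp: prod.cl_ivl_Suc)

lemma sum_from_2_bounds:
  fixes f :: "nat \<Rightarrow> real"
  assumes "\<And>k. k \<ge> 2 \<Longrightarrow> 0 \<le> f k \<and> f k \<le> 1"
  shows "0 \<le> (\<Sum>k=2..m. f k)" "(\<Sum>k=2..m. f k) \<le> real m"
proof -
  show "0 \<le> (\<Sum>k=2..m. f k)" using assms by (intro sum_nonneg) auto
  have "(\<Sum>k=2..m. f k) \<le> (\<Sum>k=2..m. 1)" using assms by (intro sum_mono) auto
  also have "\<dots> \<le> real m" by simp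
  finally show "(\<Sum>k=2..m. f k) \<le> real m" .
qed

lemma peel_mean_bounds: "0 \<le> peel_mean m" "peel_mean m \<le> real m"
  unfolding peel_mean_def using close_prob_bounds by (auto intro!: sum_from_2_bounds)

lemma peel_var_bounds: "0 \<le> peel_var m" "peel_var m \<le> real m"
  unfolding peel_var_def using close_prob_bounds
  by (auto intro!: sum_from_2_bounds mult_nonneg_nonneg mult_le_one)

lemma le_two_power: "real m \<le> 2 ^ m"
  by (metis less_imp_le of_nat_less_two_power)

lemma power4_le_two_power: "m ^ 4 \<le> 32 * (2::nat) ^ m"
proof (cases "m < 6")
  case True
  then have "m \<in> {0, 1, 2, 3, 4, 5}" by auto
  then show ?thesis by auto
next
  case False
  then have "6 \<le> m" by simp
  then show ?thesis
  proof (induction m rule: nat_induct_at_least)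
    case base
    then show ?case by simp
  next
    case (Suc m)
    \<comment> \<open>From 6 on, consecutive fourth powers have ratio at most
      \<open>(7 / 6) ^ 4 = 2401 / 1296\<close>, which is below 2.\<close>
    have "6 * (m + 1) \<le> 7 * m" using Suc.hyps by simp
    then have "(6 * (m + 1)) ^ 4 \<le> (7 * m) ^ 4" by (rule power_mono) simp
    then have "1296 * (m + 1) ^ 4 \<le> 2401 * m ^ 4" unfolding power_mult_distrib by simp
    also have "\<dots> \<le> 2592 * m ^ 4" by simp
    finally have "(m + 1) ^ 4 \<le> 2 * m ^ 4" by simp
    then show ?case using Suc.IH by simp
  qed
qed

lemma power2_le_two_power: "m ^ 2 \<le> 2 * (2::nat) ^ m"
proof (cases "m < 4")
  case True
  then have "m \<in> {0, 1, 2, 3}" by auto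
  then show ?thesis by auto
next
  case False
  then have "4 \<le> m" by simp
  then show ?thesis
  proof (induction m rule: nat_induct_at_least)
    case base
    then show ?case by simp
  next
    case (Suc m)
    have "4 * m \<le> m * m" using Suc.hyps by (intro mult_right_mono) auto
    moreover have "(Suc m)\<^sup>2 = m * m + 2 * m + 1" by (simp add: power2_eq_square)
    ultimately have "(Suc m)\<^sup>2 \<le> 2 * m\<^sup>2" using Suc.hyps unfolding power2_eq_square by linarith
    then show ?case using Suc.IH by simp
  qed
qed

lemma peel_deviation_le:
  assumes "f \<le> 2 * k" shows "(real f - peel_mean k)\<^sup>2 \<le> 8 * 2 ^ k"
proof -
  have "real f \<le> 2 * real k" using assms by simp
  then have "\<bar>real f - peel_mean k\<bar> \<le> 2 * real k" using peel_mean_bounds[of k] by (simp add: abs_le_iff)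
  then have "(real f - peel_mean k)\<^sup>2 \<le> (2 * real k)\<^sup>2" by (metis abs_ge_zero power2_abs power_mono)
  also have "\<dots> = 4 * real (k ^ 2)" by (simp add: power2_eq_square)
  also have "real (k ^ 2) \<le> real (2 * 2 ^ k)" using power2_le_two_power[of k] of_nat_mono by blast
  finally show ?thesis by simp
qed

lemma Re_of_real_mult: "Re (complex_of_real r * z) = r * Re z"
  by simp

lemma norm_cis_minus_1: "cmod (cis x - 1) \<le> \<bar>x\<bar>"
  using iexp_approx1[of x 0] by (simp add: cis_conv_exp)

lemma norm_bernoulli_char:
  assumes "k \<ge> 2" shows "cmod (1 + close_prob k * (cis \<theta> - 1)) \<le> 1"
proof -
  note q = close_prob_bounds[OF assms]
  have "1 + close_prob k * (cis \<theta> - 1) = complex_of_real (1 - close_prob k) + close_prob k * cis \<theta>"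
    by (simp add: algebra_simps)
  also have "cmod \<dots> \<le> cmod (complex_of_real (1 - close_prob k)) + cmod (close_prob k * cis \<theta>)"
    by (rule norm_triangle_ineq)
  also have "\<dots> = 1" using q by (simp add: norm_mult del: of_real_diff)
  finally show ?thesis .
qed

section \<open>Moments and characteristic function under the peeling law\<close>

context
  fixes m :: nat and \<mu> :: "nat pmf"
  assumes law: "peel_law m \<mu>"
begin

lemma finite_support: "finite (set_pmf \<mu>)"
  using law finite_subset unfolding peel_law_def by blast

lemma integrable_law [simp]: "integrable (measure_pmf \<mu>) (f :: nat \<Rightarrow> 'b :: {banach, second_countable_topology})"
  using finite_support by (rule integrable_measure_pmf_finite)

lemma peel_law_mean:
  "\<bar>expect \<mu> real - peel_mean m\<bar> \<le> 2 * (1 + peel_const)"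
proof -
  have "expect \<mu> real \<le> (real 0 + peel_mean m) + 2 * (1 + peel_const)"
  proof (rule peel_lawD[OF law, where A = "\<lambda>m j. real j + peel_mean m"])
    show "real (j + f) \<le> real j + peel_mean m + 2 * 2 ^ m" if "f \<le> 2 * m" for m j f
    proof -
      have "real f \<le> 2 * real m" using that by simp
      then have "real f \<le> 2 * 2 ^ m" using le_two_power[of m] by linarith
      then show ?thesis using peel_mean_bounds[of m] by simp
    qed
  qed (auto simp: peel_mean_rec algebra_simps)
  moreover have "expect \<mu> (\<lambda>f. - real f) \<le> - (real 0 + peel_mean m) + 1 * (1 + peel_const)"
  proof (rule peel_lawD[OF law, where A = "\<lambda>m j. - (real j + peel_mean m)"])
    show "- real (j + f) \<le> - (real j + peel_mean m) + 1 * 2 ^ m" for m j f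
      using le_two_power[of m] peel_mean_bounds[of m] unfolding of_nat_add by linarith
  qed (auto simp: peel_mean_rec algebra_simps)
  ultimately show ?thesis using peel_const_nonneg by (simp add: abs_le_iff)
qed

text \<open>The conditional second moment about the fixed centre \<open>?h\<close> solves the
  backward equation with equality, so any real multiple \<open>c\<close> of it is admissible. The
  factor \<open>s\<close> is 1 for the upper and -1 for the lower estimate.\<close>

lemma peel_law_quadratic:
  assumes "\<kappa> \<ge> 0"
    and brk: "\<And>k f y. f \<le> 2 * k \<Longrightarrow>
      s * (y + (real f - peel_mean k))\<^sup>2 \<le> c * (y\<^sup>2 + peel_var k) + \<kappa> * 2 ^ k"
  shows "expect \<mu> (\<lambda>f. s * (real f - peel_mean m)\<^sup>2)
    \<le> c * peel_var m + \<kappa> * (1 + peel_const)"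
proof -
  let ?h = "peel_mean m"
  have "expect \<mu> (\<lambda>f. s * (real f - ?h)\<^sup>2)
    \<le> c * ((real 0 + peel_mean m - ?h)\<^sup>2 + peel_var m) + \<kappa> * (1 + peel_const)"
  proof (rule peel_lawD[OF law assms(1), where A = "\<lambda>m j. c * ((real j + peel_mean m - ?h)\<^sup>2 + peel_var m)"])
    fix k j :: nat assume k: "k \<ge> 2"
    define x q v where "x = real j + peel_mean (k - 1) - ?h" and "q = close_prob k" and "v = peel_var (k - 1)"
    have e: "real (Suc j) + peel_mean (k - 1) - ?h = x + 1" "real j + peel_mean k - ?h = x + q"
      "peel_var k = v + q * (1 - q)" "real j + peel_mean (k - 1) - ?h = x"
      using peel_mean_rec[OF k] peel_var_rec[OF k] by (auto simp: x_def q_def v_def)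
    then show "(1 - close_prob k) * (c * ((real j + peel_mean (k - 1) - ?h)\<^sup>2 + peel_var (k - 1)))
      + close_prob k * (c * ((real (Suc j) + peel_mean (k - 1) - ?h)\<^sup>2 + peel_var (k - 1)))
      \<le> c * ((real j + peel_mean k - ?h)\<^sup>2 + peel_var k)"
      unfolding e q_def[symmetric] v_def[symmetric]
      by (simp add: power2_eq_square algebra_simps)
  next
    fix k j f :: nat assume "f \<le> 2 * k"
    then show "s * (real (j + f) - ?h)\<^sup>2 \<le> c * ((real j + peel_mean k - ?h)\<^sup>2 + peel_var k) + \<kappa> * 2 ^ k"
      using brk[of f k "real j + peel_mean k - ?h"] by (simp add: algebra_simps)
  qed
  then show ?thesis by simp
qed

text \<open>At breakdown the cross term between the accumulated deviation \<open>y\<close> and the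
  remainder \<open>r\<close> is not of size \<open>2 ^ k\<close>, since \<open>y\<close> is
  unbounded. Young's inequality absorbs it into a factor \<open>1 + l\<close> at the cost of
  \<open>8 / l\<close>; later \<open>l\<close> is \<open>1 / sqrt (ln n)\<close>.\<close>

lemma peel_law_second_moment_upper:
  assumes "l > 0"
  shows "expect \<mu> (\<lambda>f. (real f - peel_mean m)\<^sup>2)
    \<le> (1 + l) * peel_var m + (8 + 8 / l) * (1 + peel_const)"
proof -
  have "1 * (y + (real f - peel_mean k))\<^sup>2 \<le> (1 + l) * (y\<^sup>2 + peel_var k) + (8 + 8 / l) * 2 ^ k"
    if "f \<le> 2 * k" for f k y
  proof -
    define r where "r = real f - peel_mean k"
    have r: "r\<^sup>2 \<le> 8 * 2 ^ k" unfolding r_def using that by (rule peel_deviation_le)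
    have "(y + r)\<^sup>2 = (1 + l) * y\<^sup>2 + (1 + 1 / l) * r\<^sup>2 - (l * y - r)\<^sup>2 / l"
      using assms by (simp add: power2_eq_square field_simps)
    also have "\<dots> \<le> (1 + l) * y\<^sup>2 + (1 + 1 / l) * r\<^sup>2" using assms by simp
    also have "\<dots> \<le> (1 + l) * (y\<^sup>2 + peel_var k) + (1 + 1 / l) * (8 * 2 ^ k)"
      using assms r peel_var_bounds[of k] by (intro add_mono mult_left_mono) auto
    finally show ?thesis by (simp add: r_def algebra_simps)
  qed
  then show ?thesis using peel_law_quadratic[of "8 + 8 / l" 1 "1 + l"] assms by simp
qed

lemma peel_law_second_moment_lower:
  assumes "0 < l" "l \<le> 1"
  shows "expect \<mu> (\<lambda>f. (real f - peel_mean m)\<^sup>2)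
    \<ge> (1 - l) * peel_var m - (1 + 8 / l) * (1 + peel_const)"
proof -
  have "(-1) * (y + (real f - peel_mean k))\<^sup>2 \<le> - (1 - l) * (y\<^sup>2 + peel_var k) + (1 + 8 / l) * 2 ^ k"
    if "f \<le> 2 * k" for f k y
  proof -
    define r where "r = real f - peel_mean k"
    have r: "r\<^sup>2 \<le> 8 * 2 ^ k" unfolding r_def using that by (rule peel_deviation_le)
    have v: "(1 - l) * peel_var k \<le> 2 ^ k"
    proof -
      have "(1 - l) * peel_var k \<le> 1 * peel_var k"
        using assms peel_var_bounds[of k] by (intro mult_right_mono) auto
      then show ?thesis using le_two_power[of k] peel_var_bounds[of k] by linarith
    qed
    have "(1 - l) * y\<^sup>2 = (y + r)\<^sup>2 + r\<^sup>2 / l - r\<^sup>2 - (l * y + r)\<^sup>2 / l"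
      using assms by (simp add: power2_eq_square field_simps)
    also have "\<dots> \<le> (y + r)\<^sup>2 + r\<^sup>2 / l"
    proof -
      have "r\<^sup>2 \<ge> 0" "(l * y + r)\<^sup>2 / l \<ge> 0" using assms by auto
      then show ?thesis by linarith
    qed
    also have "r\<^sup>2 / l \<le> (8 * 2 ^ k) / l" using r assms by (intro divide_right_mono) auto
    finally show ?thesis using v by (simp add: r_def algebra_simps)
  qed
  then have "expect \<mu> (\<lambda>f. (-1) * (real f - peel_mean m)\<^sup>2)
      \<le> - (1 - l) * peel_var m + (1 + 8 / l) * (1 + peel_const)"
    using assms by (intro peel_law_quadratic) auto
  then show ?thesis by (simp add: left_diff_distrib)
qed

text \<open>Only the order of magnitude matters, so an explicit supersolution replaces the true
  fourth moment. For \<open>x \<ge> 1\<close> one has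
  \<open>(x + 1) ^ 4 - x ^ 4 \<le> 16 * x ^ 3\<close>, which the shift of \<open>x\<close> by
  \<open>4 * q\<close> dominates; the summand 1 ensures \<open>x \<ge> 1\<close>. The 8 comes from
  \<open>(a + b) ^ 4 \<le> 8 * a ^ 4 + 8 * b ^ 4\<close>, and 4096 is
  \<open>8 * 16 * 32\<close>.\<close>

lemma peel_law_fourth_moment:
  "expect \<mu> (\<lambda>f. real f ^ 4) \<le> 8 * (1 + 4 * peel_mean m) ^ 4 + 4096 * (1 + peel_const)"
proof -
  have "expect \<mu> (\<lambda>f. real f ^ 4)
      \<le> 8 * (real 0 + 1 + 4 * peel_mean m) ^ 4 + 4096 * (1 + peel_const)"
  proof (rule peel_lawD[OF law, where A = "\<lambda>m j. 8 * (real j + 1 + 4 * peel_mean m) ^ 4"])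
    fix k j :: nat assume k: "k \<ge> 2"
    define x q where "x = real j + 1 + 4 * peel_mean (k - 1)" and "q = close_prob k"
    have x: "x \<ge> 1" unfolding x_def using peel_mean_bounds by simp
    have q: "q \<ge> 0" unfolding q_def using close_prob_bounds k by simp
    have e: "real j + 1 + 4 * peel_mean k = x + 4 * q" "real (Suc j) + 1 + 4 * peel_mean (k - 1) = x + 1"
      "real j + 1 + 4 * peel_mean (k - 1) = x"
      using peel_mean_rec[OF k] by (auto simp: x_def q_def)
    have "x ^ 2 \<le> x ^ 3" "x \<le> x ^ 3" "1 \<le> x ^ 3"
      using x power_increasing[of 2 3 x] power_increasing[of 1 3 x] by auto
    then have "6 * x ^ 2 + 4 * x + 1 \<le> 12 * x ^ 3" by simp
    then have "q * (6 * x ^ 2 + 4 * x + 1) \<le> q * (12 * x ^ 3)" using q by (intro mult_left_mono)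
    moreover have "0 \<le> 96 * (x\<^sup>2 * q\<^sup>2) + 256 * (x * q ^ 3) + 256 * q ^ 4" using x q by simp
    ultimately have "(1 - q) * x ^ 4 + q * (x + 1) ^ 4 \<le> (x + 4 * q) ^ 4"
      by (simp add: power2_eq_square power3_eq_cube power4_eq_xxxx algebra_simps)
    then show "(1 - close_prob k) * (8 * (real j + 1 + 4 * peel_mean (k - 1)) ^ 4)
      + close_prob k * (8 * (real (Suc j) + 1 + 4 * peel_mean (k - 1)) ^ 4)
      \<le> 8 * (real j + 1 + 4 * peel_mean k) ^ 4"
      unfolding e q_def[symmetric] by (simp add: algebra_simps)
  next
    fix k j f :: nat assume f: "f \<le> 2 * k"
    have sq: "(a + b)\<^sup>2 \<le> 2 * a\<^sup>2 + 2 * b\<^sup>2" for a b :: real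
      using zero_le_power2[of "a - b"] by (simp add: power2_eq_square algebra_simps)
    have "(real j + real f) ^ 4 = ((real j + real f)\<^sup>2)\<^sup>2" by (simp flip: power_mult)
    also have "\<dots> \<le> (2 * (real j)\<^sup>2 + 2 * (real f)\<^sup>2)\<^sup>2" using sq by (intro power_mono) auto
    also have "\<dots> \<le> 2 * (2 * (real j)\<^sup>2)\<^sup>2 + 2 * (2 * (real f)\<^sup>2)\<^sup>2" by (rule sq)
    also have "\<dots> = 8 * real j ^ 4 + 8 * real f ^ 4" by (simp add: power_mult_distrib flip: power_mult)
    also have "real j ^ 4 \<le> (real j + 1 + 4 * peel_mean k) ^ 4"
      using peel_mean_bounds by (intro power_mono) auto
    also have "real f ^ 4 \<le> real (2 * k) ^ 4" using f by (intro power_mono of_nat_mono) auto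
    also have "real (2 * k) ^ 4 = 16 * real (k ^ 4)" by (simp add: power_mult_distrib)
    also have "real (k ^ 4) \<le> real (32 * 2 ^ k)" using power4_le_two_power[of k] of_nat_mono by blast
    finally show "real (j + f) ^ 4 \<le> 8 * (real j + 1 + 4 * peel_mean k) ^ 4 + 4096 * 2 ^ k" by simp
  qed auto
  then show ?thesis by simp
qed

text \<open>The law admits real test functions only. It is applied to the real part after
  multiplication by a unit \<open>c\<close>; the conjugate phase of the difference, taken as
  \<open>c\<close>, recovers its modulus. The factor 3 adds 2 for at most \<open>2 * k\<close>
  remaining faces and 1 for at most \<open>k\<close> Bernoulli variables.\<close>

lemma peel_law_char:
  "cmod (expect \<mu> (\<lambda>f. cis (\<theta> * real f)) - peel_char \<theta> m) \<le> 3 * \<bar>\<theta>\<bar> * (1 + peel_const)"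
proof -
  have brk: "cmod (cis (\<theta> * real f) - peel_char \<theta> k) \<le> 3 * \<bar>\<theta>\<bar> * 2 ^ k" if "f \<le> 2 * k" for f k
  proof -
    have "cmod (peel_char \<theta> k - (\<Prod>i=2..k. 1)) \<le> (\<Sum>i=2..k. cmod (1 + close_prob i * (cis \<theta> - 1) - 1))"
      unfolding peel_char_def by (rule norm_prod_diff) (auto intro: norm_bernoulli_char)
    also have "\<dots> \<le> (\<Sum>i=2..k. \<bar>\<theta>\<bar>)"
    proof (intro sum_mono)
      fix i assume "i \<in> {2..k}"
      then have q: "0 \<le> close_prob i" "close_prob i \<le> 1" using close_prob_bounds by auto
      have "cmod (1 + close_prob i * (cis \<theta> - 1) - 1) = close_prob i * cmod (cis \<theta> - 1)"
        using q by (simp add: norm_mult)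
      also have "\<dots> \<le> 1 * \<bar>\<theta>\<bar>" using q norm_cis_minus_1 by (intro mult_mono) auto
      finally show "cmod (1 + close_prob i * (cis \<theta> - 1) - 1) \<le> \<bar>\<theta>\<bar>" by simp
    qed
    also have "\<dots> \<le> real k * \<bar>\<theta>\<bar>" by (simp add: mult_right_mono)
    finally have 1: "cmod (peel_char \<theta> k - 1) \<le> real k * \<bar>\<theta>\<bar>" by simp
    have "cmod (cis (\<theta> * real f) - 1) \<le> \<bar>\<theta> * real f\<bar>" by (rule norm_cis_minus_1)
    also have "\<dots> \<le> \<bar>\<theta>\<bar> * (2 * real k)" using that by (simp add: abs_mult mult_left_mono)
    finally have 2: "cmod (cis (\<theta> * real f) - 1) \<le> \<bar>\<theta>\<bar> * (2 * real k)" .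
    have "cmod (cis (\<theta> * real f) - peel_char \<theta> k) \<le> cmod (cis (\<theta> * real f) - 1) + cmod (peel_char \<theta> k - 1)"
      by (metis dist_norm dist_triangle3 dist_commute)
    also have "\<dots> \<le> 3 * \<bar>\<theta>\<bar> * real k" using 1 2 by (simp add: algebra_simps)
    also have "\<dots> \<le> 3 * \<bar>\<theta>\<bar> * 2 ^ k" using le_two_power by (intro mult_left_mono) auto
    finally show ?thesis .
  qed
  let ?E = "expect \<mu> (\<lambda>f. cis (\<theta> * real f))"
  have dir: "Re (c * (?E - peel_char \<theta> m)) \<le> 3 * \<bar>\<theta>\<bar> * (1 + peel_const)" if c: "cmod c = 1" for c
  proof -
    have "expect \<mu> (\<lambda>f. Re (c * cis (\<theta> * real f)))
        \<le> Re (c * cis (\<theta> * real 0) * peel_char \<theta> m) + 3 * \<bar>\<theta>\<bar> * (1 + peel_const)"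
    proof (rule peel_lawD[OF law, where A = "\<lambda>m j. Re (c * cis (\<theta> * real j) * peel_char \<theta> m)"])
      fix k j :: nat assume k: "k \<ge> 2"
      have "(1 - close_prob k) * (c * cis (\<theta> * real j) * peel_char \<theta> (k - 1))
          + close_prob k * (c * cis (\<theta> * real (Suc j)) * peel_char \<theta> (k - 1))
          = c * cis (\<theta> * real j) * peel_char \<theta> k"
        unfolding peel_char_rec[OF k] by (simp add: algebra_simps flip: cis_mult)
      then have "Re ((1 - close_prob k) * (c * cis (\<theta> * real j) * peel_char \<theta> (k - 1))
          + close_prob k * (c * cis (\<theta> * real (Suc j)) * peel_char \<theta> (k - 1)))
          = Re (c * cis (\<theta> * real j) * peel_char \<theta> k)" by (rule arg_cong)
      then show "(1 - close_prob k) * Re (c * cis (\<theta> * real j) * peel_char \<theta> (k - 1))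
          + close_prob k * Re (c * cis (\<theta> * real (Suc j)) * peel_char \<theta> (k - 1))
          \<le> Re (c * cis (\<theta> * real j) * peel_char \<theta> k)"
        by (simp only: plus_complex.sel Re_of_real_mult order_refl)
    next
      fix k j f :: nat assume f: "f \<le> 2 * k"
      have "Re (c * cis (\<theta> * real (j + f))) - Re (c * cis (\<theta> * real j) * peel_char \<theta> k)
          = Re (c * cis (\<theta> * real j) * (cis (\<theta> * real f) - peel_char \<theta> k))"
        by (simp add: algebra_simps flip: cis_mult)
      also have "\<dots> \<le> cmod (c * cis (\<theta> * real j) * (cis (\<theta> * real f) - peel_char \<theta> k))"
        by (rule complex_Re_le_cmod)
      also have "\<dots> \<le> 3 * \<bar>\<theta>\<bar> * 2 ^ k" using brk[OF f] c by (simp add: norm_mult)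
      finally show "Re (c * cis (\<theta> * real (j + f))) \<le> Re (c * cis (\<theta> * real j) * peel_char \<theta> k) + 3 * \<bar>\<theta>\<bar> * 2 ^ k"
        by simp
    qed auto
    moreover have "expect \<mu> (\<lambda>f. Re (c * cis (\<theta> * real f))) = Re (c * ?E)"
      by (subst integral_mult_right_zero[symmetric], subst integral_Re) auto
    ultimately show ?thesis by (simp add: algebra_simps)
  qed
  show ?thesis
  proof (cases "?E = peel_char \<theta> m")
    case True
    then show ?thesis using peel_const_nonneg by simp
  next
    case False
    define z where "z = ?E - peel_char \<theta> m"
    have z: "z \<noteq> 0" using False by (simp add: z_def)
    have "(cnj z / cmod z) * z = complex_of_real (cmod z)"
      using z by (simp add: complex_norm_square[symmetric] mult.commute power2_eq_square field_simps)
    moreover have "cmod (cnj z / cmod z) = 1" using z by (simp add: norm_divide)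
    ultimately show ?thesis using dir[of "cnj z / cmod z"] unfolding z_def[symmetric] by simp
  qed
qed

end

section \<open>Asymptotics and the central limit theorem\<close>

text \<open>\<open>close_prob k\<close> is the value of \<open>1 / x\<close> at the midpoint of
  \<open>[k - 1, k]\<close>, hence by convexity at most \<open>ln k - ln (k - 1)\<close>. It is also
  at least \<open>1 / k\<close>, which exceeds \<open>ln (k + 1) - ln k\<close>.\<close>

lemma peel_mean_ln:
  assumes "m \<ge> 1"
  shows "ln (real m + 1) - ln 2 \<le> peel_mean m" "peel_mean m \<le> ln (real m)"
  using assms
proof (induction m rule: nat_induct_at_least)
  case base
  { case 1 then show ?case by (simp add: peel_mean_def) }
  { case 2 then show ?case by (simp add: peel_mean_def) }
next
  case (Suc m)
  have r: "peel_mean (Suc m) = peel_mean m + close_prob (Suc m)"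
    using peel_mean_rec[of "Suc m"] Suc.hyps by simp
  {
    case 1
    have "ln (real (Suc m) + 1) - ln (real (Suc m)) \<le> 1 / real (Suc m)"
      using ln_diff_le_inverse[of "real (Suc m)"] by simp
    also have "\<dots> \<le> close_prob (Suc m)" by (simp add: close_prob_def field_simps)
    finally show ?case using Suc.IH r by (simp add: add.commute)
  next
    case 2
    have "close_prob (Suc m) = 2 * (real (Suc m) - real m) / (real m + real (Suc m))"
      by (simp add: close_prob_def)
    also have "\<dots> \<le> ln (real (Suc m)) - ln (real m)"
      using Suc.hyps by (intro ln_inverse_approx_ge) auto
    finally show ?case using Suc.IH r by simp
  }
qed

lemma peel_mean_3n:
  assumes "n \<ge> 1" shows "\<bar>peel_mean (3 * n) - ln (real n)\<bar> \<le> 2"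
proof -
  have n: "real n > 0" using assms by simp
  have m: "3 * n \<ge> 1" using assms by simp
  have "peel_mean (3 * n) \<le> ln (3 * real n)" using peel_mean_ln(2)[OF m] by simp
  also have "\<dots> = ln 3 + ln (real n)" using n by (simp add: ln_mult)
  also have "ln (3::real) \<le> 2" using ln_le_minus_one[of "3::real"] by simp
  finally have u: "peel_mean (3 * n) \<le> 2 + ln (real n)" by simp
  have "ln 2 + ln (real n) = ln (2 * real n)" using n by (simp add: ln_mult)
  also have "\<dots> \<le> ln (real (3 * n) + 1)" using n by (intro ln_mono) auto
  also have "\<dots> \<le> peel_mean (3 * n) + ln 2" using peel_mean_ln(1)[OF m] by simp
  finally show ?thesis using u by (simp add: abs_le_iff)
qed

lemma sum_close_prob_sq: "(\<Sum>k=2..m. (close_prob k)\<^sup>2) \<le> 1 - 1 / real (max m 1)"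
proof (induction m)
  case (Suc m)
  show ?case
  proof (cases "m \<ge> 1")
    case True
    have m: "real m \<ge> 1" using True by simp
    have "(close_prob (Suc m))\<^sup>2 = 4 / ((2 * real m + 1)\<^sup>2)"
      by (simp add: close_prob_def power_divide add.commute)
    also have "\<dots> \<le> 4 / (4 * real m * (real m + 1))"
      using m by (intro divide_left_mono) (auto simp: power2_eq_square algebra_simps intro!: add_nonneg_pos mult_pos_pos)
    also have "\<dots> = 1 / real m - 1 / (real m + 1)" using m by (simp add: divide_simps)
    finally have "(close_prob (Suc m))\<^sup>2 \<le> 1 / real m - 1 / (real m + 1)" .
    moreover have "(\<Sum>k=2..Suc m. (close_prob k)\<^sup>2) = (\<Sum>k=2..m. (close_prob k)\<^sup>2) + (close_prob (Suc m))\<^sup>2"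
      using sum_from_2_rec[of "Suc m"] True by simp
    ultimately show ?thesis using Suc.IH True by (simp add: max_def add.commute)
  qed simp
qed simp

lemma sum_close_prob_sq_le: "(\<Sum>k=2..m. (close_prob k)\<^sup>2) \<le> 1"
  using sum_close_prob_sq[of m] by (smt (verit) divide_nonneg_nonneg of_nat_0_le_iff)

lemma peel_var_mean: "peel_mean m - 1 \<le> peel_var m" "peel_var m \<le> peel_mean m"
proof -
  have "peel_var m = peel_mean m - (\<Sum>k=2..m. (close_prob k)\<^sup>2)"
    unfolding peel_var_def peel_mean_def sum_subtractf[symmetric]
    by (intro sum.cong) (auto simp: power2_eq_square algebra_simps)
  moreover have "0 \<le> (\<Sum>k=2..m. (close_prob k)\<^sup>2)" by (intro sum_nonneg) auto
  ultimately show "peel_mean m - 1 \<le> peel_var m" "peel_var m \<le> peel_mean m"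
    using sum_close_prob_sq_le[of m] by auto
qed

text \<open>Poisson approximation of the Bernoulli sum. All factors of both products have modulus at
  most 1, so the errors of the factors add up; each is quadratic in
  \<open>close_prob k * \<theta>\<close>, and the squares of \<open>close_prob\<close> sum to at
  most 1. The bound is therefore uniform in \<open>m\<close>.\<close>

lemma peel_char_approx:
  "cmod (peel_char \<theta> m - exp (peel_mean m * (cis \<theta> - 1))) \<le> exp 2 * \<theta>\<^sup>2"
proof -
  define w where "w k = close_prob k * (cis \<theta> - 1)" for k
  have e: "exp (peel_mean m * (cis \<theta> - 1)) = (\<Prod>k=2..m. exp (w k))"
    unfolding peel_mean_def w_def by (simp add: sum_distrib_right exp_sum)
  have "cmod (peel_char \<theta> m - exp (peel_mean m * (cis \<theta> - 1))) \<le> (\<Sum>k=2..m. cmod (1 + w k - exp (w k)))"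
    unfolding e peel_char_def w_def
  proof (rule norm_prod_diff)
    fix k assume "k \<in> {2..m}"
    then have k: "k \<ge> 2" by simp
    show "cmod (1 + close_prob k * (cis \<theta> - 1)) \<le> 1" using norm_bernoulli_char[OF k] .
    have "close_prob k * (cos \<theta> - 1) \<le> 0" using close_prob_bounds[OF k] by (intro mult_nonneg_nonpos) auto
    then show "cmod (exp (close_prob k * (cis \<theta> - 1))) \<le> 1" by simp
  qed
  also have "\<dots> \<le> (\<Sum>k=2..m. exp 2 * \<theta>\<^sup>2 * (close_prob k)\<^sup>2)"
  proof (rule sum_mono)
    fix k assume "k \<in> {2..m}"
    then have q: "0 \<le> close_prob k" "close_prob k \<le> 1" using close_prob_bounds by auto
    have cm: "cmod (cis \<theta> - 1) \<le> 2" using norm_triangle_ineq4[of "cis \<theta>" 1] by simp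
    have nw: "cmod (w k) = close_prob k * cmod (cis \<theta> - 1)" unfolding w_def using q by (simp add: norm_mult)
    have w1: "cmod (w k) \<le> close_prob k * \<bar>\<theta>\<bar>"
      unfolding nw using q norm_cis_minus_1 by (intro mult_left_mono) auto
    have "cmod (w k) \<le> 1 * 2" unfolding nw using q cm by (intro mult_mono) auto
    then have "\<bar>Re (w k)\<bar> \<le> 2" using abs_Re_le_cmod[of "w k"] by simp
    then have ex: "exp \<bar>Re (w k)\<bar> \<le> exp 2" by simp
    have "cmod (1 + w k - exp (w k)) = cmod (exp (w k) - (\<Sum>i\<le>1. w k ^ i / fact i))"
      by (simp add: norm_minus_commute)
    also have "\<dots> \<le> exp \<bar>Re (w k)\<bar> * (cmod (w k)) ^ Suc 1 / fact 1" by (rule Taylor_exp)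
    also have "\<dots> = exp \<bar>Re (w k)\<bar> * (cmod (w k))\<^sup>2" by (simp add: power2_eq_square)
    also have "\<dots> \<le> exp 2 * (close_prob k * \<bar>\<theta>\<bar>)\<^sup>2"
      using ex w1 by (intro mult_mono power_mono) auto
    also have "\<dots> = exp 2 * \<theta>\<^sup>2 * (close_prob k)\<^sup>2" by (simp add: power_mult_distrib)
    finally show "cmod (1 + w k - exp (w k)) \<le> exp 2 * \<theta>\<^sup>2 * (close_prob k)\<^sup>2" .
  qed
  also have "\<dots> = exp 2 * \<theta>\<^sup>2 * (\<Sum>k=2..m. (close_prob k)\<^sup>2)" by (simp add: sum_distrib_left)
  also have "\<dots> \<le> exp 2 * \<theta>\<^sup>2 * 1" using sum_close_prob_sq_le by (intro mult_left_mono) auto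
  finally show ?thesis by simp
qed

section \<open>The normal limit\<close>

lemma ln_nat_at_top: "filterlim (\<lambda>n. ln (real n)) at_top sequentially"
  by (rule filterlim_compose[OF ln_at_top filterlim_real_sequentially])

lemma sqrt_ln_at_top: "filterlim (\<lambda>n. sqrt (ln (real n))) at_top sequentially"
  by (rule filterlim_compose[OF sqrt_at_top ln_nat_at_top])

lemma std_normal_cdf:
  "cdf std_normal_distribution t = 1 / sqrt (2 * pi) * (LBINT x:{..t}. exp (- (x\<^sup>2) / 2))"
proof -
  interpret real_distribution std_normal_distribution by (rule real_dist_normal_dist)
  have "cdf std_normal_distribution t = (LINT x|std_normal_distribution. indicator {..t} x)"
    by (simp add: cdf_def2)
  also have "\<dots> = (LINT x|lborel. std_normal_density x *\<^sub>R indicator {..t} x)"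
    by (rule integral_density) auto
  also have "\<dots> = (LINT x|lborel. 1 / sqrt (2 * pi) * (indicator {..t} x *\<^sub>R exp (- (x\<^sup>2) / 2)))"
    by (intro Bochner_Integration.integral_cong refl) (simp add: std_normal_density_def)
  also have "\<dots> = 1 / sqrt (2 * pi) * (LBINT x:{..t}. exp (- (x\<^sup>2) / 2))"
    unfolding set_lebesgue_integral_def by (rule integral_mult_right_zero)
  finally show ?thesis .
qed

text \<open>Weak convergence gives convergence of distribution functions only at continuity points;
  a law with a density has no atoms.\<close>

lemma std_normal_isCont_cdf: "isCont (cdf std_normal_distribution) t"
proof -
  interpret real_distribution std_normal_distribution by (rule real_dist_normal_dist)
  have "emeasure std_normal_distribution {t} = (\<integral>\<^sup>+ x. ennreal (std_normal_density x) * indicator {t} x \<partial>lborel)"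
    by (rule emeasure_density) auto
  also have "\<dots> = (\<integral>\<^sup>+ x. 0 \<partial>(lborel :: real measure))"
  proof (rule nn_integral_cong_AE)
    have "AE x in lborel. x \<noteq> t" by (rule AE_lborel_singleton)
    then show "AE x in lborel. ennreal (std_normal_density x) * indicator {t} x = 0"
      by eventually_elim auto
  qed
  finally show ?thesis unfolding isCont_cdf by (simp add: measure_def)
qed

context
  fixes \<mu> :: "nat \<Rightarrow> nat pmf"
  assumes law: "\<And>n. n \<ge> 1 \<Longrightarrow> peel_law (3 * n) (\<mu> n)"
begin

lemma law_mean_bound:
  assumes "n \<ge> 1"
  shows "\<bar>expect (\<mu> n) real - ln (real n)\<bar> \<le> 4 + 2 * peel_const"
  using peel_law_mean[OF law[OF assms]] peel_mean_3n[OF assms] by (simp add: abs_le_iff)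

lemma law_second_moment_bound:
  assumes "n \<ge> 3"
  shows "\<bar>expect (\<mu> n) (\<lambda>f. (real f - ln (real n))\<^sup>2) - ln (real n)\<bar>
    \<le> (40 + 40 * peel_const) * sqrt (ln (real n))"
proof -
  have n1: "n \<ge> 1" using assms by simp
  note lw = law[OF n1]
  note [simp] = integrable_law[OF lw]
  define L where "L = ln (real n)"
  define S where "S = sqrt L"
  define H where "H = peel_mean (3 * n)"
  define c where "c = 1 + peel_const"
  let ?E = "expect (\<mu> n)"
  \<comment> \<open>The hypothesis \<open>n \<ge> 3\<close> yields \<open>L \<ge> 1\<close>, so
    constants can be absorbed into multiples of \<open>sqrt L\<close>.\<close>
  have "exp 1 \<le> (3::real)" by (rule exp_le)
  also have "\<dots> \<le> real n" using assms by simp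
  finally have "ln (exp 1) \<le> L" unfolding L_def by (intro ln_mono) auto
  then have L1: "L \<ge> 1" by simp
  then have S: "S \<ge> 1" "S * S = L" by (simp_all add: S_def)
  have HL: "\<bar>H - L\<bar> \<le> 2" using peel_mean_3n[OF n1] by (simp add: H_def L_def)
  have Em: "\<bar>?E real - H\<bar> \<le> 2 * c" using peel_law_mean[OF lw] by (simp add: H_def c_def)
  have c: "c \<ge> 1" using peel_const_nonneg by (simp add: c_def)
  have V: "L - 3 \<le> peel_var (3 * n)" "peel_var (3 * n) \<le> L + 2"
    using peel_var_mean[of "3 * n"] HL by (auto simp: H_def)
  have cS: "c \<le> c * S" using c S by (simp add: mult_le_cancel_left1)
  have V0: "peel_var (3 * n) / S \<le> 3 * S"
  proof -
    have "peel_var (3 * n) \<le> 3 * S * S" using V L1 S by simp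
    then show ?thesis using S by (simp add: divide_le_eq)
  qed
  have up: "?E (\<lambda>f. (real f - H)\<^sup>2) \<le> L + 21 * c * S"
  proof -
    \<comment> \<open>With \<open>l = 1 / S\<close> the loss \<open>l * peel_var\<close> and the
      cost \<open>8 / l\<close> are both of order \<open>S = sqrt L\<close>.\<close>
    have "?E (\<lambda>f. (real f - H)\<^sup>2) \<le> (1 + 1 / S) * peel_var (3 * n) + (8 + 8 / (1 / S)) * c"
      unfolding H_def c_def using S by (intro peel_law_second_moment_upper[OF lw]) auto
    also have "\<dots> = peel_var (3 * n) + peel_var (3 * n) / S + 8 * c + 8 * (c * S)"
      by (simp add: algebra_simps)
    also have "\<dots> \<le> (L + 2) + 3 * S + 8 * (c * S) + 8 * (c * S)"
      using V V0 cS by linarith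
    also have "\<dots> \<le> L + 21 * (c * S)"
    proof -
      have "S \<le> c * S" using c S by (simp add: mult_le_cancel_right1)
      then show ?thesis using S by linarith
    qed
    finally show ?thesis by simp
  qed
  have lo: "?E (\<lambda>f. (real f - H)\<^sup>2) \<ge> L - 21 * c * S"
  proof -
    have "(1 - 1 / S) * peel_var (3 * n) - (1 + 8 / (1 / S)) * c \<le> ?E (\<lambda>f. (real f - H)\<^sup>2)"
      unfolding H_def c_def using S by (intro peel_law_second_moment_lower[OF lw]) auto
    moreover have "(1 - 1 / S) * peel_var (3 * n) - (1 + 8 / (1 / S)) * c
        = peel_var (3 * n) - peel_var (3 * n) / S - c - 8 * (c * S)"
      by (simp add: algebra_simps)
    moreover have "\<dots> \<ge> L - 3 - 3 * S - c * S - 8 * (c * S)" using V V0 cS by linarith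
    moreover have "S \<le> c * S" using c S by (simp add: mult_le_cancel_right1)
    ultimately show ?thesis using S by linarith
  qed
  have "(real f - L)\<^sup>2 = (real f - H)\<^sup>2 + (2 * (H - L)) * real f + (- 2 * (H - L) * H + (H - L)\<^sup>2)" for f
    by (simp add: power2_eq_square algebra_simps)
  then have "?E (\<lambda>f. (real f - L)\<^sup>2) = ?E (\<lambda>f. (real f - H)\<^sup>2) + (2 * (H - L)) * ?E real + (- 2 * (H - L) * H + (H - L)\<^sup>2)"
    by simp
  also have "\<dots> = ?E (\<lambda>f. (real f - H)\<^sup>2) + 2 * ((H - L) * (?E real - H)) + (H - L)\<^sup>2"
    by (simp add: algebra_simps)
  finally have eq: "?E (\<lambda>f. (real f - L)\<^sup>2) = ?E (\<lambda>f. (real f - H)\<^sup>2) + 2 * ((H - L) * (?E real - H)) + (H - L)\<^sup>2" .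
  have "\<bar>(H - L) * (?E real - H)\<bar> \<le> 2 * (2 * c)"
    unfolding abs_mult using HL Em by (intro mult_mono) auto
  then have x: "\<bar>(H - L) * (?E real - H)\<bar> \<le> 4 * c" by simp
  have "(H - L)\<^sup>2 \<le> 2\<^sup>2" using HL by (metis abs_ge_zero power2_abs power_mono)
  then have y: "(H - L)\<^sup>2 \<le> 4" by simp
  have gen: "\<bar>e + 2 * x + y - L\<bar> \<le> 21 * k + 8 * c + 4"
    if "\<bar>x\<bar> \<le> 4 * c" "0 \<le> y" "y \<le> 4" "e \<le> L + 21 * k" "L - 21 * k \<le> e" for e x y k :: real
    using that by linarith
  have "\<bar>?E (\<lambda>f. (real f - L)\<^sup>2) - L\<bar> \<le> 21 * (c * S) + 8 * c + 4"
    unfolding eq by (rule gen[OF x _ y]) (use up lo in \<open>simp_all add: mult.assoc\<close>)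
  also have "\<dots> \<le> 40 * (c * S)"
  proof -
    have "S \<le> c * S" using c S by (simp add: mult_le_cancel_right1)
    then show ?thesis using S cS by linarith
  qed
  finally show ?thesis by (simp add: L_def S_def c_def algebra_simps)
qed

lemma law_fourth_moment_bound:
  assumes "n \<ge> 3"
  shows "expect (\<mu> n) (\<lambda>f. real f ^ 4) \<le> (10 ^ 6 + 4096 * peel_const) * ln (real n) ^ 4"
proof -
  have n1: "n \<ge> 1" using assms by simp
  note lw = law[OF n1]
  define L where "L = ln (real n)"
  have "exp 1 \<le> (3::real)" by (rule exp_le)
  also have "\<dots> \<le> real n" using assms by simp
  finally have "ln (exp 1) \<le> L" unfolding L_def by (intro ln_mono) auto
  then have L1: "L \<ge> 1" by simp
  have "1 + 4 * peel_mean (3 * n) \<le> 13 * L" using peel_mean_3n[OF n1] L1 unfolding L_def by linarith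
  then have "(1 + 4 * peel_mean (3 * n)) ^ 4 \<le> (13 * L) ^ 4"
    using peel_mean_bounds by (intro power_mono) auto
  also have "\<dots> = 28561 * L ^ 4" by (simp add: power_mult_distrib)
  finally have a: "(1 + 4 * peel_mean (3 * n)) ^ 4 \<le> 28561 * L ^ 4" .
  have "1 \<le> L ^ 4" using L1 by (rule one_le_power)
  then have "4096 * (1 + peel_const) * 1 \<le> 4096 * (1 + peel_const) * L ^ 4"
    using peel_const_nonneg by (intro mult_left_mono) auto
  moreover have "28561 * 8 * L ^ 4 + 4096 * (1 + peel_const) * L ^ 4 \<le> (10 ^ 6 + 4096 * peel_const) * L ^ 4"
    using L1 by (simp add: algebra_simps)
  ultimately show ?thesis using peel_law_fourth_moment[OF lw] a unfolding L_def by linarith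
qed

text \<open>At the angle \<open>th n = a / sqrt L\<close> the linear terms of the Poisson exponent
  and of the centring phase combine to \<open>(H - L) * th n\<close>, which vanishes since
  \<open>H - L\<close> is bounded; the quadratic term tends to half of \<open>- (a ^ 2)\<close>. A
  fixed shift \<open>c\<close> vanishes as well. It is carried along because Euler's formula shifts
  the face count by 2.\<close>

lemma law_char_tendsto:
  fixes a c :: real
  shows "(\<lambda>n. expect (\<mu> n) (\<lambda>f. cis (a / sqrt (ln (real n)) * (real f - ln (real n) - c))))
    \<longlonglongrightarrow> complex_of_real (exp (- (a\<^sup>2) / 2))"
proof -
  define th where "th n = a / sqrt (ln (real n))" for n
  define H where "H n = peel_mean (3 * n)" for n
  define L where "L n = ln (real n)" for n
  define z where "z n = complex_of_real (H n) * (cis (th n) - 1) - \<i> * (th n * (L n + c))" for n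
  have th0: "th \<longlonglongrightarrow> 0"
    unfolding th_def by (rule tendsto_divide_0[OF tendsto_const]) (rule filterlim_at_top_imp_at_infinity[OF sqrt_ln_at_top])
  have ev: "eventually (\<lambda>n. L n > 0 \<and> n \<ge> 1) sequentially"
    using filterlim_at_top_dense[THEN iffD1, OF ln_nat_at_top, rule_format, of 0] eventually_ge_at_top[of 1]
    by eventually_elim (auto simp: L_def)
  have Lth: "eventually (\<lambda>n. L n * (th n)\<^sup>2 = a\<^sup>2) sequentially"
    using ev by eventually_elim (auto simp: th_def L_def power_divide)
  have HLb: "eventually (\<lambda>n. \<bar>H n - L n\<bar> \<le> 2) sequentially"
    using ev by eventually_elim (auto simp: H_def L_def peel_mean_3n)
  have HLth: "(\<lambda>n. (H n - L n) * th n) \<longlonglongrightarrow> 0"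
  proof (rule tendsto_rabs_zero_cancel, rule tendsto_sandwich[OF _ _ tendsto_const])
    show "eventually (\<lambda>n. \<bar>(H n - L n) * th n\<bar> \<le> 2 * \<bar>th n\<bar>) sequentially"
      using HLb by eventually_elim (auto simp: abs_mult intro: mult_right_mono)
    show "(\<lambda>n. 2 * \<bar>th n\<bar>) \<longlonglongrightarrow> 0" using tendsto_mult[OF tendsto_const[of 2] tendsto_rabs[OF th0]] by simp
  qed simp
  have Hth2: "(\<lambda>n. H n * (th n)\<^sup>2) \<longlonglongrightarrow> a\<^sup>2"
  proof -
    have "(\<lambda>n. a\<^sup>2 + (H n - L n) * th n * th n) \<longlonglongrightarrow> a\<^sup>2 + 0 * 0"
      by (intro tendsto_intros HLth th0)
    moreover have "eventually (\<lambda>n. a\<^sup>2 + (H n - L n) * th n * th n = H n * (th n)\<^sup>2) sequentially"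
      using Lth by eventually_elim (simp add: algebra_simps power2_eq_square)
    ultimately show ?thesis using Lim_transform_eventually by fastforce
  qed
  have z: "z \<longlonglongrightarrow> complex_of_real (- (a\<^sup>2) / 2)"
  proof -
    \<comment> \<open>The Taylor remainder of third order: multiplied by \<open>H n\<close> it
      vanishes, since \<open>H n * th n ^ 2\<close> converges and \<open>th n\<close> tends to
      0.\<close>
    define r where "r n = cis (th n) - 1 - \<i> * th n + complex_of_real ((th n)\<^sup>2 / 2)" for n
    have zr: "z n = H n * r n + complex_of_real (- (H n * (th n)\<^sup>2) / 2)
        + \<i> * complex_of_real ((H n - L n) * th n - c * th n)" for n
      by (simp add: z_def r_def algebra_simps power2_eq_square)
    have "(\<lambda>n. H n * r n) \<longlonglongrightarrow> 0"
    proof (rule tendsto_norm_zero_cancel, rule tendsto_sandwich[OF _ _ tendsto_const])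
      have "cmod (complex_of_real (H n) * r n) \<le> H n * (th n)\<^sup>2 * \<bar>th n\<bar>" for n
      proof -
        have "r n = iexp (th n) - (\<Sum>k\<le>2. (\<i> * th n) ^ k / fact k)"
          by (simp add: r_def numeral_2_eq_2 cis_conv_exp algebra_simps power2_eq_square)
        then have "cmod (r n) \<le> \<bar>th n\<bar> ^ Suc 2 / fact (Suc 2)" using iexp_approx1[of "th n" 2] by simp
        also have "\<dots> \<le> \<bar>th n\<bar> ^ Suc 2" by (simp add: fact_numeral)
        also have "\<dots> = (th n)\<^sup>2 * \<bar>th n\<bar>" by (simp add: power2_eq_square numeral_2_eq_2)
        finally have "H n * cmod (r n) \<le> H n * ((th n)\<^sup>2 * \<bar>th n\<bar>)"
          using peel_mean_bounds by (intro mult_left_mono) (auto simp: H_def)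
        then show ?thesis using peel_mean_bounds by (simp add: norm_mult H_def)
      qed
      then show "eventually (\<lambda>n. cmod (complex_of_real (H n) * r n) \<le> H n * (th n)\<^sup>2 * \<bar>th n\<bar>) sequentially"
        by simp
      show "(\<lambda>n. H n * (th n)\<^sup>2 * \<bar>th n\<bar>) \<longlonglongrightarrow> 0"
        using tendsto_mult[OF Hth2 tendsto_rabs[OF th0]] by simp
    qed simp
    moreover have "(\<lambda>n. complex_of_real (- (H n * (th n)\<^sup>2) / 2)) \<longlonglongrightarrow> complex_of_real (- (a\<^sup>2) / 2)"
      by (intro tendsto_intros Hth2) simp
    moreover have "(\<lambda>n. \<i> * complex_of_real ((H n - L n) * th n - c * th n)) \<longlonglongrightarrow> \<i> * complex_of_real (0 - c * 0)"
      by (intro tendsto_intros HLth th0)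
    ultimately have "(\<lambda>n. H n * r n + complex_of_real (- (H n * (th n)\<^sup>2) / 2)
        + \<i> * complex_of_real ((H n - L n) * th n - c * th n))
        \<longlonglongrightarrow> 0 + complex_of_real (- (a\<^sup>2) / 2) + \<i> * complex_of_real (0 - c * 0)"
      by (intro tendsto_add)
    then show ?thesis unfolding zr[symmetric] by simp
  qed
  then have "(\<lambda>n. exp (z n)) \<longlonglongrightarrow> exp (complex_of_real (- (a\<^sup>2) / 2))" by (rule tendsto_exp)
  then have ez: "(\<lambda>n. exp (z n)) \<longlonglongrightarrow> complex_of_real (exp (- (a\<^sup>2) / 2))"
    by (simp only: exp_of_real)
  have "(\<lambda>n. expect (\<mu> n) (\<lambda>f. cis (th n * (real f - L n - c))) - exp (z n)) \<longlonglongrightarrow> 0"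
  proof (rule tendsto_norm_zero_cancel, rule tendsto_sandwich[OF _ _ tendsto_const])
    show "eventually (\<lambda>n. cmod (expect (\<mu> n) (\<lambda>f. cis (th n * (real f - L n - c))) - exp (z n))
        \<le> 3 * \<bar>th n\<bar> * (1 + peel_const) + exp 2 * (th n)\<^sup>2) sequentially"
      using ev
    proof eventually_elim
      case (elim n)
      then have n1: "n \<ge> 1" by simp
      note lw = law[OF n1]
      define w where "w = cis (- (th n * (L n + c)))"
      have nw: "cmod w = 1" by (simp add: w_def)
      have "expect (\<mu> n) (\<lambda>f. cis (th n * (real f - L n - c)))
          = expect (\<mu> n) (\<lambda>f. w * cis (th n * real f))"
        by (simp add: w_def cis_mult algebra_simps)
      also have "\<dots> = w * expect (\<mu> n) (\<lambda>f. cis (th n * real f))" by simp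
      finally have 1: "expect (\<mu> n) (\<lambda>f. cis (th n * (real f - L n - c)))
          = w * expect (\<mu> n) (\<lambda>f. cis (th n * real f))" .
      have 2: "exp (z n) = w * exp (H n * (cis (th n) - 1))"
        unfolding z_def w_def cis_conv_exp exp_add[symmetric] by (simp add: algebra_simps)
      have "cmod (expect (\<mu> n) (\<lambda>f. cis (th n * (real f - L n - c))) - exp (z n))
         = cmod (w * (expect (\<mu> n) (\<lambda>f. cis (th n * real f)) - exp (H n * (cis (th n) - 1))))"
        unfolding 1 2 by (simp add: algebra_simps)
      also have "\<dots> = cmod (expect (\<mu> n) (\<lambda>f. cis (th n * real f)) - exp (H n * (cis (th n) - 1)))"
        using nw by (simp add: norm_mult)
      also have "\<dots> \<le> cmod (expect (\<mu> n) (\<lambda>f. cis (th n * real f)) - peel_char (th n) (3 * n))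
         + cmod (peel_char (th n) (3 * n) - exp (H n * (cis (th n) - 1)))"
        by (metis dist_norm dist_triangle)
      also have "\<dots> \<le> 3 * \<bar>th n\<bar> * (1 + peel_const) + exp 2 * (th n)\<^sup>2"
        unfolding H_def by (intro add_mono peel_law_char[OF lw] peel_char_approx)
      finally show ?case .
    qed
    have "(\<lambda>n. 3 * \<bar>th n\<bar> * (1 + peel_const) + exp 2 * (th n)\<^sup>2) \<longlonglongrightarrow> 3 * \<bar>0\<bar> * (1 + peel_const) + exp 2 * 0\<^sup>2"
      by (intro tendsto_intros th0)
    then show "(\<lambda>n. 3 * \<bar>th n\<bar> * (1 + peel_const) + exp 2 * (th n)\<^sup>2) \<longlonglongrightarrow> 0" by simp
  qed simp
  from tendsto_add[OF this ez] show ?thesis by (simp add: th_def L_def)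
qed

text \<open>The sign -1 serves the genus, which decreases as the number of faces grows. The normal
  law is symmetric, so only \<open>sg ^ 2 = 1\<close> enters the limit.\<close>

lemma law_clt:
  fixes c t :: real
  assumes sg: "sg = 1 \<or> sg = (-1::real)"
  shows "(\<lambda>n. measure_pmf.prob (\<mu> n) {f. sg * (real f - ln (real n) - c) \<le> t * sqrt (ln (real n))})
    \<longlonglongrightarrow> 1 / sqrt (2 * pi) * (LBINT x:{..t}. exp (- (x\<^sup>2) / 2))"
proof -
  define X where "X n f = sg * (real f - ln (real n) - c) / sqrt (ln (real n))" for n f
  define M where "M n = distr (measure_pmf (\<mu> n)) borel (X n)" for n
  have rd: "real_distribution (M n)" for n
    unfolding M_def by (rule prob_space.real_distribution_distr[OF prob_space_measure_pmf]) simp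
  have "weak_conv_m M std_normal_distribution"
  proof (rule levy_continuity[OF rd real_dist_normal_dist])
    fix s :: real
    have "char (M n) s = expect (\<mu> n) (\<lambda>f. cis (sg * s / sqrt (ln (real n)) * (real f - ln (real n) - c)))" for n
    proof -
      have "char (M n) s = expect (\<mu> n) (\<lambda>f. iexp (s * X n f))"
        unfolding char_def M_def by (subst integral_distr) auto
      then show ?thesis by (simp add: X_def cis_conv_exp algebra_simps)
    qed
    moreover have "(sg * s)\<^sup>2 = s\<^sup>2" using sg by auto
    ultimately show "(\<lambda>n. char (M n) s) \<longlonglongrightarrow> char std_normal_distribution s"
      using law_char_tendsto[of "sg * s" c] by (simp add: char_std_normal_distribution)
  qed
  then have "(\<lambda>n. cdf (M n) t) \<longlonglongrightarrow> cdf std_normal_distribution t"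
    using std_normal_isCont_cdf unfolding weak_conv_m_def weak_conv_def by blast
  moreover have "eventually (\<lambda>n. cdf (M n) t
      = measure_pmf.prob (\<mu> n) {f. sg * (real f - ln (real n) - c) \<le> t * sqrt (ln (real n))}) sequentially"
    using filterlim_at_top_dense[THEN iffD1, OF ln_nat_at_top, rule_format, of 0]
  proof eventually_elim
    case (elim n)
    have "cdf (M n) t = measure_pmf.prob (\<mu> n) (X n -` {..t} \<inter> space (measure_pmf (\<mu> n)))"
      unfolding cdf_def2 M_def by (rule measure_distr) auto
    also have "X n -` {..t} \<inter> space (measure_pmf (\<mu> n)) = {f. sg * (real f - ln (real n) - c) \<le> t * sqrt (ln (real n))}"
      using elim by (auto simp: X_def divide_le_eq)
    finally show ?case .
  qed
  ultimately show ?thesis unfolding std_normal_cdf[symmetric] by (rule Lim_transform_eventually)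
qed

end

section \<open>Random pairs and connectivity\<close>

definition cubic_rots :: "'a set \<Rightarrow> ('a \<Rightarrow> 'a) set" where
  "cubic_rots U = {\<alpha>. \<alpha> permutes U \<and> (\<forall>x\<in>U. card (orbit \<alpha> x) = 3)}"

definition steps :: "'a set \<Rightarrow> ('a \<Rightarrow> 'a) \<Rightarrow> ('a \<Rightarrow> 'a) \<Rightarrow> ('a \<times> 'a) set" where
  "steps U \<alpha> \<beta> = {(x, y). x \<in> U \<and> (y = \<alpha> x \<or> y = \<beta> x)}"

definition connected_pair :: "'a set \<Rightarrow> ('a \<Rightarrow> 'a) \<Rightarrow> ('a \<Rightarrow> 'a) \<Rightarrow> bool" where
  "connected_pair U \<alpha> \<beta> \<longleftrightarrow> (\<forall>d\<in>U. \<forall>e\<in>U. (d, e) \<in> (steps U \<alpha> \<beta>)\<^sup>*)"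

definition pairs :: "nat \<Rightarrow> ((nat \<Rightarrow> nat) \<times> (nat \<Rightarrow> nat)) set" where
  "pairs n = cubic_rots {..<6 * n} \<times> matchings {..<6 * n}"

definition face_law :: "nat \<Rightarrow> nat pmf" where
  "face_law n = map_pmf (\<lambda>(\<alpha>, \<beta>). ncyc (\<alpha> \<circ> \<beta>) {..<6 * n}) (pmf_of_set (pairs n))"

section \<open>Uniform random pairs satisfy the peeling law\<close>

lemma finite_cubic_rots [simp]: "finite U \<Longrightarrow> finite (cubic_rots U)"
  unfolding cubic_rots_def by (rule finite_subset[OF _ finite_permutations]) auto

lemma card_orbit_3:
  assumes "f (f (f x)) = x" "f x \<noteq> x"
  shows "card (orbit f x) = 3"
proof -
  have "(f ^^ 3) x = x" using assms(1) by (simp add: numeral_3_eq_3)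
  then have "orbit f x = {(f ^^ m) x |m. m < 3}" by (intro orbit_altdef_bounded) auto
  also have "\<dots> = {x, f x, f (f x)}"
    by (auto simp: less_Suc_eq numeral_3_eq_3 intro: exI[of _ 0] exI[of _ "Suc 0"] exI[of _ "Suc (Suc 0)"])
  also have "card \<dots> = 3" using assms by (metis card_3_iff)
  finally show ?thesis .
qed

lemma card_orbit_2_le:
  assumes "f (f x) = x" shows "card (orbit f x) \<le> 2"
proof -
  have "y \<in> {x, f x}" if "y \<in> orbit f x" for y using that by induct (use assms in auto)
  then have "orbit f x \<subseteq> {x, f x}" by auto
  then have "card (orbit f x) \<le> card {x, f x}" by (intro card_mono) auto
  also have "\<dots> \<le> 2" by (simp add: card_insert_le_m1)
  finally show ?thesis .
qed

lemma short_pot_cubic: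
  assumes "\<alpha> \<in> cubic_rots U" shows "short_pot \<alpha> U = 0"
proof -
  have "\<alpha> (\<alpha> x) \<noteq> x" if "x \<in> U" for x
    using card_orbit_2_le[of \<alpha> x] that assms by (auto simp: cubic_rots_def)
  moreover from this have "\<alpha> x \<noteq> x" if "x \<in> U" for x using that by metis
  ultimately have "{x \<in> U. \<alpha> (\<alpha> x) = x} = {}" "{x \<in> U. \<alpha> x = x} = {}" by auto
  then show ?thesis unfolding short_pot_def by (simp only: card.empty)
qed

lemma cubic_rots_nonempty: "cubic_rots {..<6 * n :: nat} \<noteq> {}"
proof -
  \<comment> \<open>Cyclic rotation within consecutive blocks of three.\<close>
  define f where "f x = (if x < 6 * n then 3 * (x div 3) + (x + 1) mod 3 else x)" for x :: nat
  have lt: "f x < 6 * n" if "x < 6 * n" for x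
  proof -
    have "f x = 3 * (x div 3) + (x + 1) mod 3" using that by (simp add: f_def)
    then show ?thesis using that by presburger
  qed
  have f3: "f (f (f x)) = x" if "x < 6 * n" for x
  proof -
    define q r where "q = x div 3" and "r = x mod 3"
    have x: "x = 3 * q + r" and r: "r < 3" by (simp_all add: q_def r_def)
    have f: "f (3 * q + k) = 3 * q + (k + 1) mod 3" if "k < 3" "3 * q + k < 6 * n" for k
    proof -
      have "(3 * q + k + 1) mod 3 = (k + 1) mod 3" by (metis add.assoc mod_mult_self4)
      then show ?thesis using that by (simp add: f_def)
    qed
    have 1: "f x = 3 * q + (r + 1) mod 3" unfolding x using r that x by (intro f) auto
    have 2: "f (f x) = 3 * q + ((r + 1) mod 3 + 1) mod 3"
      unfolding 1 using lt[OF that] 1 by (intro f) auto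
    have 3: "f (f (f x)) = 3 * q + (((r + 1) mod 3 + 1) mod 3 + 1) mod 3"
      unfolding 2 using lt[OF lt[OF that]] 2 by (intro f) auto
    have "(((r + 1) mod 3 + 1) mod 3 + 1) mod 3 = r" using r by presburger
    then show ?thesis using 3 x by simp
  qed
  have f1: "f x \<noteq> x" if "x < 6 * n" for x
  proof -
    have "f x = 3 * (x div 3) + (x + 1) mod 3" using that by (simp add: f_def)
    then show ?thesis by presburger
  qed
  have "f permutes {..<6 * n}"
  proof (rule bij_imp_permutes)
    show "bij_betw f {..<6 * n} {..<6 * n}"
      by (rule bij_betw_byWitness[where f' = "\<lambda>x. f (f x)"]) (use lt f3 in auto)
  qed (auto simp: f_def)
  then have "f \<in> cubic_rots {..<6 * n}"
    using f1 f3 by (auto simp: cubic_rots_def intro: card_orbit_3)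
  then show ?thesis by blast
qed

lemma pairs_finite [simp]: "finite (pairs n)" by (simp add: pairs_def)

lemma pairs_nonempty [simp]: "pairs n \<noteq> {}"
proof -
  have "card (matchings {..<6 * n}) = odd_fact (3 * n)" by (intro card_matchings) auto
  then have "matchings {..<6 * n} \<noteq> {}" using odd_fact_pos[of "3 * n"] by auto
  then show ?thesis using cubic_rots_nonempty by (simp add: pairs_def)
qed

lemma expectation_pairs:
  "expect (pmf_of_set (pairs n)) (\<lambda>(\<alpha>, \<beta>). F \<alpha> \<beta> :: real)
    = (\<Sum>\<alpha>\<in>cubic_rots {..<6 * n}. mavg {..<6 * n} (F \<alpha>)) / card (cubic_rots {..<6 * n})"
  by (subst integral_pmf_of_set)
    (simp_all add: pairs_def[symmetric],
     simp add: pairs_def mavg_def sum.cartesian_product card_cartesian_product flip: sum_divide_distrib)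

text \<open>The comparison gives the same bound for every fixed rotation, hence also after
  averaging. A rotation with all cycles of length 3 has potential 0, so the initial error
  \<open>2 ^ 0 / (3 * n)\<close> is at most 1.\<close>

lemma face_law_peel_law:
  assumes "n \<ge> 1" shows "peel_law (3 * n) (face_law n)"
  unfolding peel_law_def
proof (intro conjI allI impI)
  show "set_pmf (face_law n) \<subseteq> {..2 * (3 * n)}"
    using ncyc_le_card[of "{..<6 * n}"] by (auto simp: face_law_def)
next
  fix A :: "nat \<Rightarrow> nat \<Rightarrow> real" and \<phi> :: "nat \<Rightarrow> real" and \<kappa> :: real
  assume k: "0 \<le> \<kappa>"
    and rec: "\<forall>m j. 2 \<le> m \<longrightarrow> (1 - close_prob m) * A (m - 1) j + close_prob m * A (m - 1) (Suc j) \<le> A m j"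
    and brk: "\<forall>m j f. 1 \<le> m \<longrightarrow> f \<le> 2 * m \<longrightarrow> \<phi> (j + f) \<le> A m j + \<kappa> * 2 ^ m"
  let ?U = "{..<6 * n}" and ?c = "A (3 * n) 0 + \<kappa> * (1 + peel_const)"
  have each: "mavg ?U (\<lambda>\<beta>. \<phi> (ncyc (\<alpha> \<circ> \<beta>) ?U)) \<le> ?c" if "\<alpha> \<in> cubic_rots ?U" for \<alpha>
  proof -
    have "mavg ?U (\<lambda>\<beta>. \<phi> (0 + ncyc (\<alpha> \<circ> \<beta>) ?U))
        \<le> A (3 * n) 0 + \<kappa> * (2 ^ short_pot \<alpha> ?U / real (3 * n) + peel_const * (1 - 1 / real (3 * n)))"
      by (rule peeling_comparison) (use that rec brk k assms in \<open>auto simp: cubic_rots_def\<close>)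
    also have "2 ^ short_pot \<alpha> ?U / real (3 * n) \<le> 1" using short_pot_cubic[OF that] assms by simp
    also have "peel_const * (1 - 1 / real (3 * n)) \<le> peel_const * 1"
      using peel_const_nonneg by (intro mult_left_mono) auto
    finally show ?thesis using k by (simp add: mult_left_mono)
  qed
  have "expect (face_law n) \<phi>
      = expect (pmf_of_set (pairs n)) (\<lambda>(\<alpha>, \<beta>). \<phi> (ncyc (\<alpha> \<circ> \<beta>) ?U))"
    by (simp add: face_law_def split_def)
  also have "\<dots> = (\<Sum>\<alpha>\<in>cubic_rots ?U. mavg ?U (\<lambda>\<beta>. \<phi> (ncyc (\<alpha> \<circ> \<beta>) ?U))) / card (cubic_rots ?U)"
    by (rule expectation_pairs)
  also have "\<dots> \<le> (\<Sum>\<alpha>\<in>cubic_rots ?U. ?c) / card (cubic_rots ?U)"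
    using each by (intro divide_right_mono sum_mono) auto
  also have "\<dots> = ?c" using cubic_rots_nonempty[of n] by simp
  finally show "expect (face_law n) \<phi> \<le> ?c" .
qed

section \<open>Counting matchings that split\<close>

lemma odd_fact_fact: "odd_fact m * 2 ^ m * fact m = fact (2 * m)"
proof (induction m)
  case (Suc m)
  have "odd_fact (Suc m) * 2 ^ Suc m * fact (Suc m)
      = (2 * m + 2) * ((2 * m + 1) * (odd_fact m * 2 ^ m * fact m))"
    by (simp add: algebra_simps)
  also have "\<dots> = fact (2 * Suc m)" unfolding Suc.IH by simp
  finally show ?case .
qed simp

lemma odd_fact_binomial:
  "odd_fact a * odd_fact b * ((2 * (a + b)) choose (2 * a)) = odd_fact (a + b) * ((a + b) choose a)"
proof -
  let ?P = "2 ^ (a + b) * fact a * fact b :: nat"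
  have "odd_fact a * odd_fact b * ((2 * (a + b)) choose (2 * a)) * ?P
      = fact (2 * a) * fact (2 * b) * ((2 * (a + b)) choose (2 * a))"
    unfolding odd_fact_fact[of a, symmetric] odd_fact_fact[of b, symmetric]
    by (simp add: power_add algebra_simps)
  also have "\<dots> = fact (2 * (a + b))"
    using binomial_fact_lemma[of "2 * a" "2 * (a + b)"] by (simp add: algebra_simps)
  also have "\<dots> = odd_fact (a + b) * 2 ^ (a + b) * fact (a + b)"
    by (rule odd_fact_fact[symmetric])
  also have "fact (a + b) = fact a * fact b * ((a + b) choose a)"
    using binomial_fact_lemma[of a "a + b"] by simp
  finally have "odd_fact a * odd_fact b * ((2 * (a + b)) choose (2 * a)) * ?P
      = odd_fact (a + b) * ((a + b) choose a) * ?P" by (simp add: algebra_simps)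
  then show ?thesis by (simp only: mult_cancel2) simp
qed

lemma binomial_mult_le: "(a choose i) * (b choose j) \<le> ((a + b) choose (i + j))"
proof -
  have "(a choose i) * (b choose (i + j - i)) \<le> (\<Sum>k\<le>i + j. (a choose k) * (b choose (i + j - k)))"
    by (rule member_le_sum) auto
  also have "\<dots> = (a + b) choose (i + j)" by (rule vandermonde)
  finally show ?thesis by simp
qed

text \<open>In terms of binomial coefficients this is \<open>((2 * n) choose (2 * j)) * ((3 * n)
  choose (3 * j)) * (n choose j) \<le> ((6 * n) choose (6 * j))\<close>, two uses of Vandermonde's
  identity along \<open>6 = 2 + 3 + 1\<close>. It bounds by \<open>1 / (n choose j)\<close> the
  probability that some set of \<open>2 * j\<close> vertices is closed under the matching.\<close>

lemma split_count_le:
  assumes "j \<le> n"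
  shows "((2 * n) choose (2 * j)) * (odd_fact (3 * j) * odd_fact (3 * (n - j))) * (n choose j) \<le> odd_fact (3 * n)"
proof -
  let ?X = "odd_fact (3 * j) * odd_fact (3 * (n - j))" and ?c = "(3 * n) choose (3 * j)"
  have s: "3 * j + 3 * (n - j) = 3 * n" using assms by simp
  have "((2 * n) choose (2 * j)) * ?c * (n choose j) \<le> ((2 * n + 3 * n) choose (2 * j + 3 * j)) * (n choose j)"
    by (intro mult_right_mono binomial_mult_le) auto
  also have "\<dots> \<le> (2 * n + 3 * n + n) choose (2 * j + 3 * j + j)" by (rule binomial_mult_le)
  also have "\<dots> = (2 * (3 * n)) choose (2 * (3 * j))" by simp
  finally have "?X * (((2 * n) choose (2 * j)) * ?c * (n choose j)) \<le> ?X * ((2 * (3 * n)) choose (2 * (3 * j)))"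
    by (rule mult_left_mono) simp
  also have "\<dots> = odd_fact (3 * n) * ?c" using odd_fact_binomial[of "3 * j" "3 * (n - j)"] unfolding s .
  finally have "(((2 * n) choose (2 * j)) * ?X * (n choose j)) * ?c \<le> odd_fact (3 * n) * ?c"
    by (simp add: algebra_simps)
  moreover have "?c > 0" using assms by simp
  ultimately show ?thesis by (simp only: mult_le_cancel2)
qed

lemma binomial_ge_inner:
  assumes "i \<le> j" "i + j \<le> n" shows "(n choose i) \<le> (n choose j)"
proof (cases "2 * j \<le> n")
  case True
  then show ?thesis using assms by (intro binomial_mono) auto
next
  case False
  then have "(n choose i) \<le> (n choose (n - j))" using assms by (intro binomial_mono) auto
  also have "\<dots> = (n choose j)" using assms by (intro binomial_symmetric[symmetric]) auto
  finally show ?thesis .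
qed

text \<open>A matching that preserves \<open>A\<close> also preserves the complement, being an
  involution, and it is determined by its two restrictions.\<close>

lemma card_matchings_invariant:
  assumes fin: "finite U" and A: "A \<subseteq> U"
  shows "card {\<beta> \<in> matchings U. \<forall>x\<in>A. \<beta> x \<in> A} \<le> card (matchings A) * card (matchings (U - A))"
proof -
  let ?B = "{\<beta> \<in> matchings U. \<forall>x\<in>A. \<beta> x \<in> A}"
  let ?r = "\<lambda>\<beta>. (perm_restrict \<beta> A, perm_restrict \<beta> (U - A))"
  have res: "perm_restrict \<beta> V \<in> matchings V"
    if "\<beta> \<in> matchings U" "V \<subseteq> U" "\<forall>x\<in>V. \<beta> x \<in> V" for \<beta> V
  proof -
    have inv: "\<beta> x \<noteq> x \<and> \<beta> (\<beta> x) = x" if "x \<in> V" for x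
      using that \<open>\<beta> \<in> matchings U\<close> \<open>V \<subseteq> U\<close> by (auto simp: matchings_def)
    have "perm_restrict \<beta> V permutes V"
    proof (rule bij_imp_permutes)
      show "bij_betw (perm_restrict \<beta> V) V V"
        by (rule bij_betw_byWitness[where f' = \<beta>]) (use inv that(3) in \<open>auto simp: perm_restrict_def\<close>)
    qed (simp add: perm_restrict_def)
    then show ?thesis using inv that(3) by (auto simp: matchings_def perm_restrict_def)
  qed
  have cl: "\<forall>x\<in>U - A. \<beta> x \<in> U - A" if b: "\<beta> \<in> ?B" for \<beta>
  proof
    fix x assume x: "x \<in> U - A"
    have "\<beta> permutes U" "\<beta> (\<beta> x) = x" using b x by (auto simp: matchings_def)
    then show "\<beta> x \<in> U - A" using b x by (auto simp: permutes_in_image)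
  qed
  have "?r ` ?B \<subseteq> matchings A \<times> matchings (U - A)"
    using res A cl by auto
  moreover have "inj_on ?r ?B"
  proof (rule inj_onI)
    fix \<beta> \<gamma> assume b: "\<beta> \<in> ?B" and g: "\<gamma> \<in> ?B" and eq: "?r \<beta> = ?r \<gamma>"
    then have e: "perm_restrict \<beta> A x = perm_restrict \<gamma> A x"
      "perm_restrict \<beta> (U - A) x = perm_restrict \<gamma> (U - A) x" for x by auto
    show "\<beta> = \<gamma>"
    proof
      fix x
      show "\<beta> x = \<gamma> x"
      proof (cases "x \<in> U")
        case True
        then show ?thesis using e[of x] by (cases "x \<in> A") (auto simp: perm_restrict_def)
      next
        case False
        then show ?thesis using b g by (auto simp: matchings_def permutes_not_in)
      qed
    qed
  qed
  ultimately have "card ?B \<le> card (matchings A \<times> matchings (U - A))"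
    using fin finite_subset[OF A fin] by (intro card_inj_on_le) auto
  then show ?thesis by (simp add: card_cartesian_product)
qed

lemma card_Union_orbits:
  assumes fin: "finite U" and p: "\<alpha> permutes U" and a: "\<forall>x\<in>U. card (orbit \<alpha> x) = k"
    and S: "S \<subseteq> orbit \<alpha> ` U"
  shows "card (\<Union>S) = k * card S"
proof -
  have c: "card C = k" if "C \<in> S" for C using that S a by auto
  have "card (\<Union>S) = (\<Sum>C\<in>S. card C)"
  proof (rule card_Union_disjoint)
    show "pairwise disjnt S"
    proof (rule pairwiseI)
      fix C D assume "C \<in> S" "D \<in> S" "C \<noteq> D"
      obtain x where x: "C = orbit \<alpha> x" using S \<open>C \<in> S\<close> by auto
      obtain y where y: "D = orbit \<alpha> y" using S \<open>D \<in> S\<close> by auto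
      show "disjnt C D"
      proof (rule ccontr)
        assume "\<not> disjnt C D"
        then obtain z where "z \<in> C" "z \<in> D" by (auto simp: disjnt_def)
        then have "orbit \<alpha> z = C" "orbit \<alpha> z = D"
          using x y orbit_cyclic_eq3[OF cyclic_on_orbit[OF p fin]] by metis+
        then show False using \<open>C \<noteq> D\<close> by simp
      qed
    qed
    show "finite C" if "C \<in> S" for C
    proof -
      obtain x where "x \<in> U" "C = orbit \<alpha> x" using S \<open>C \<in> S\<close> by auto
      then show ?thesis using permutes_orbit_subset[OF p] fin finite_subset by metis
    qed
  qed
  also have "\<dots> = k * card S" using c by simp
  finally show ?thesis .
qed

lemma Union_orbits:
  assumes "finite U" "\<alpha> permutes U" "A \<subseteq> U" "\<forall>x\<in>A. \<alpha> x \<in> A"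
  shows "\<Union>(orbit \<alpha> ` A) = A"
proof -
  have "permutation \<alpha>" using assms by (auto simp: permutation_permutes)
  then have "x \<in> orbit \<alpha> x" for x by (rule permutation_self_in_orbit)
  moreover have "orbit \<alpha> x \<subseteq> A" if "x \<in> A" for x
  proof
    fix y assume "y \<in> orbit \<alpha> x" then show "y \<in> A" by induct (use assms that in auto)
  qed
  ultimately show ?thesis by blast
qed

text \<open>A union bound over the number \<open>k\<close> of vertices in an invariant part. An odd
  \<open>k\<close> is impossible, since \<open>3 * k\<close> darts cannot be matched within the
  part; for \<open>k = 2 * j\<close> the bound \<open>1 / (n choose j)\<close> is summed.\<close>

lemma card_disconnected:
  assumes fin: "finite U" and cU: "card U = 6 * n" and n: "n \<ge> 2" and a: "\<alpha> \<in> cubic_rots U"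
  shows "real (card {\<beta> \<in> matchings U. \<not> connected_pair U \<alpha> \<beta>}) \<le> 10 / real n * real (card (matchings U))"
proof -
  have p: "\<alpha> permutes U" and a3: "\<forall>x\<in>U. card (orbit \<alpha> x) = 3" using a by (simp_all add: cubic_rots_def)
  define Q where "Q = orbit \<alpha> ` U"
  have finQ: "finite Q" using fin by (simp add: Q_def)
  have UQ: "\<Union>Q = U" unfolding Q_def using fin p
    by (intro Union_orbits) (auto simp: permutes_in_image)
  have cQ: "card Q = 2 * n" using card_Union_orbits[OF fin p a3, of Q] UQ cU by (simp add: Q_def)
  define B where "B A = {\<beta> \<in> matchings U. \<forall>x\<in>A. \<beta> x \<in> A}" for A
  define T where "T k = {S. S \<subseteq> Q \<and> card S = k}" for k
  have finT: "finite (T k)" for k unfolding T_def using finQ by simp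
  have finB: "finite (B A)" for A unfolding B_def using fin by simp
  have sub: "{\<beta> \<in> matchings U. \<not> connected_pair U \<alpha> \<beta>} \<subseteq> (\<Union>k\<in>{1..<2 * n}. \<Union>S\<in>T k. B (\<Union>S))"
  proof
    fix \<beta> assume "\<beta> \<in> {\<beta> \<in> matchings U. \<not> connected_pair U \<alpha> \<beta>}"
    then have b: "\<beta> \<in> matchings U" and nc: "\<not> connected_pair U \<alpha> \<beta>" by auto
    have bp: "\<beta> permutes U" using b by (simp add: matchings_def)
    from nc obtain d e where de: "d \<in> U" "e \<in> U" "(d, e) \<notin> (steps U \<alpha> \<beta>)\<^sup>*"
      by (auto simp: connected_pair_def)
    \<comment> \<open>The set reachable from \<open>d\<close> is closed under both permutations. It
      is thus a union of \<open>\<alpha>\<close>-cycles preserved by \<open>\<beta>\<close>, and it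
      is proper because it misses \<open>e\<close>.\<close>
    define A where "A = {y \<in> U. (d, y) \<in> (steps U \<alpha> \<beta>)\<^sup>*}"
    have A: "A \<subseteq> U" "d \<in> A" "e \<notin> A" using de by (auto simp: A_def)
    have cl: "\<alpha> x \<in> A \<and> \<beta> x \<in> A" if "x \<in> A" for x
    proof -
      have "(x, \<alpha> x) \<in> steps U \<alpha> \<beta>" "(x, \<beta> x) \<in> steps U \<alpha> \<beta>" using that A by (auto simp: steps_def)
      moreover have "\<alpha> x \<in> U" "\<beta> x \<in> U" using that A p bp by (auto simp: permutes_in_image)
      ultimately show ?thesis using that unfolding A_def by (auto intro: rtrancl_into_rtrancl)
    qed
    define S where "S = orbit \<alpha> ` A"
    have US: "\<Union>S = A" unfolding S_def using fin p A cl by (intro Union_orbits) auto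
    have SQ: "S \<subseteq> Q" using A by (auto simp: S_def Q_def)
    have "S \<noteq> Q" using US UQ A de by auto
    then have "card S < 2 * n" using SQ finQ cQ psubset_card_mono[of Q S] by auto
    moreover have "S \<noteq> {}" using A by (auto simp: S_def)
    then have "card S \<ge> 1" using finite_subset[OF SQ finQ] by (simp add: Suc_leI card_gt_0_iff)
    ultimately show "\<beta> \<in> (\<Union>k\<in>{1..<2 * n}. \<Union>S\<in>T k. B (\<Union>S))"
    proof (intro UN_I)
      show "S \<in> T (card S)" using SQ by (simp add: T_def)
      show "\<beta> \<in> B (\<Union>S)" unfolding B_def US using b cl by blast
    qed simp
  qed
  define F where "F = real (card (matchings U))"
  have F: "F = real (odd_fact (3 * n))" unfolding F_def using card_matchings[OF fin, of "3 * n"] cU by simp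
  have F0: "F > 0" using F odd_fact_pos by simp
  \<comment> \<open>The two extreme values belong to \<open>j = 1\<close> and
    \<open>j = n - 1\<close>, where the binomial coefficient is \<open>n\<close>; for the other
    \<open>j\<close> it is at least \<open>n choose 2\<close>. Odd \<open>k\<close> receive a value
    only to keep the formula uniform. In the sum, 10 is 2 for the extremes plus 8 from
    \<open>4 / (n - 1) \<le> 8 / n\<close>.\<close>
  define bd where "bd k = (if k \<in> {2, 2 * n - 2} then 1 / real n else 2 / (real n * (real n - 1)))" for k
  have level: "real (card (\<Union>S\<in>T k. B (\<Union>S))) \<le> bd k * F" if k: "k \<in> {1..<2 * n}" for k
  proof -
    have inv: "card (B (\<Union>S)) \<le> card (matchings (\<Union>S)) * card (matchings (U - \<Union>S))"
      and cS: "card (\<Union>S) = 3 * k" "card (U - \<Union>S) = 6 * n - 3 * k" "finite (\<Union>S)"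
      if "S \<in> T k" for S
    proof -
      have SU: "\<Union>S \<subseteq> U" using that UQ unfolding T_def by blast
      then show "card (B (\<Union>S)) \<le> card (matchings (\<Union>S)) * card (matchings (U - \<Union>S))"
        unfolding B_def using fin by (intro card_matchings_invariant)
      show "card (\<Union>S) = 3 * k" using card_Union_orbits[OF fin p a3, of S] that by (auto simp: T_def Q_def)
      then show "card (U - \<Union>S) = 6 * n - 3 * k" using SU fin cU by (simp add: card_Diff_subset finite_subset)
      show "finite (\<Union>S)" using SU fin by (rule finite_subset)
    qed
    have bd0: "bd k \<ge> 0" using n by (auto simp: bd_def)
    show ?thesis
    proof (cases "even k")
      case False
      have "B (\<Union>S) = {}" if "S \<in> T k" for S
      proof -
        have "matchings (\<Union>S) = {}" using cS[OF that] False by (intro matchings_odd) auto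
        then have "card (B (\<Union>S)) = 0" using inv[OF that] by simp
        then show ?thesis using finB by simp
      qed
      then have "(\<Union>S\<in>T k. B (\<Union>S)) = {}" by auto
      then show ?thesis using bd0 F0 by simp
    next
      case True
      then obtain j where j: "k = 2 * j" by auto
      then have jn: "1 \<le> j" "j < n" using k by auto
      let ?X = "odd_fact (3 * j) * odd_fact (3 * (n - j))"
      have "card (\<Union>S\<in>T k. B (\<Union>S)) \<le> (\<Sum>S\<in>T k. card (B (\<Union>S)))" using finT by (rule card_UN_le)
      also have "\<dots> \<le> (\<Sum>S\<in>T k. ?X)"
      proof (rule sum_mono)
        fix S assume S: "S \<in> T k"
        have "card (matchings (\<Union>S)) = odd_fact (3 * j)"
          using cS[OF S] j by (intro card_matchings) auto
        moreover have "card (matchings (U - \<Union>S)) = odd_fact (3 * (n - j))"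
          using cS[OF S] j fin jn by (intro card_matchings) auto
        ultimately show "card (B (\<Union>S)) \<le> ?X" using inv[OF S] by simp
      qed
      also have "\<dots> = ((2 * n) choose (2 * j)) * ?X"
        using n_subsets[OF finQ, of k] cQ j by (simp add: T_def)
      finally have "card (\<Union>S\<in>T k. B (\<Union>S)) * (n choose j) \<le> ((2 * n) choose (2 * j)) * ?X * (n choose j)"
        by (rule mult_right_mono) simp
      also have "\<dots> \<le> odd_fact (3 * n)" using jn by (intro split_count_le) auto
      finally have "real (card (\<Union>S\<in>T k. B (\<Union>S)) * (n choose j)) \<le> F" unfolding F by (rule of_nat_mono)
      then have le: "real (card (\<Union>S\<in>T k. B (\<Union>S))) * real (n choose j) \<le> F" by simp
      have pos: "real (n choose j) > 0" using jn by simp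
      have "1 / real (n choose j) \<le> bd k"
      proof (cases "j = 1 \<or> j = n - 1")
        case True
        moreover have "n choose (n - 1) = n" using binomial_symmetric[of 1 n] n by simp
        ultimately have "n choose j = n" by auto
        moreover have "k \<in> {2, 2 * n - 2}" using True j jn by auto
        ultimately show ?thesis by (simp add: bd_def)
      next
        case False
        then have "n choose 2 \<le> n choose j" using jn by (intro binomial_ge_inner) auto
        then have "real (n choose 2) \<le> real (n choose j)" by simp
        moreover have "real (n choose 2) = real n * (real n - 1) / 2"
        proof -
          have "real (n choose 2) = real (n * (n - 1) div 2)" by (simp add: choose_two)
          also have "\<dots> = real (n * (n - 1)) / 2" by (subst real_of_nat_div) auto
          finally show ?thesis using n by (simp add: of_nat_diff)
        qed
        ultimately have "real n * (real n - 1) / 2 \<le> real (n choose j)" by simp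
        then have "1 / real (n choose j) \<le> 1 / (real n * (real n - 1) / 2)"
          using n pos by (intro divide_left_mono) auto
        moreover have "k \<notin> {2, 2 * n - 2}" using False j jn by auto
        ultimately show ?thesis by (simp add: bd_def)
      qed
      then have "1 / real (n choose j) * F \<le> bd k * F" using F0 by (intro mult_right_mono) auto
      moreover have "real (card (\<Union>S\<in>T k. B (\<Union>S))) \<le> 1 / real (n choose j) * F"
        using le pos by (simp add: field_simps)
      ultimately show ?thesis by linarith
    qed
  qed
  have "real (card {\<beta> \<in> matchings U. \<not> connected_pair U \<alpha> \<beta>})
      \<le> real (card (\<Union>k\<in>{1..<2 * n}. \<Union>S\<in>T k. B (\<Union>S)))"
    using sub finT finB by (intro of_nat_mono card_mono) auto
  also have "\<dots> \<le> real (\<Sum>k\<in>{1..<2 * n}. card (\<Union>S\<in>T k. B (\<Union>S)))"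
    by (intro of_nat_mono card_UN_le) auto
  also have "\<dots> \<le> (\<Sum>k\<in>{1..<2 * n}. bd k * F)"
    unfolding of_nat_sum using level by (intro sum_mono)
  also have "\<dots> = (\<Sum>k\<in>{1..<2 * n}. bd k) * F" by (simp add: sum_distrib_right)
  also have "(\<Sum>k\<in>{1..<2 * n}. bd k) \<le> 10 / real n"
  proof -
    have "(\<Sum>k\<in>{1..<2 * n}. bd k)
        \<le> (\<Sum>k\<in>{1..<2 * n}. (1 / real n) * indicator {2, 2 * n - 2} k + 2 / (real n * (real n - 1)))"
      using n by (intro sum_mono) (auto simp: bd_def)
    also have "\<dots> = 1 / real n * real (card ({1..<2 * n} \<inter> {2, 2 * n - 2}))
        + real (card {1..<2 * n}) * (2 / (real n * (real n - 1)))"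
      by (simp add: sum.distrib sum_divide_distrib[symmetric] sum_indicator_real)
    also have "\<dots> \<le> 1 / real n * 2 + (2 * real n) * (2 / (real n * (real n - 1)))"
    proof (intro add_mono mult_left_mono mult_right_mono)
      have "card ({1..<2 * n} \<inter> {2, 2 * n - 2}) \<le> card {2, 2 * n - 2}" by (intro card_mono) auto
      also have "\<dots> \<le> 2" by (simp add: card_insert_le_m1)
      finally show "real (card ({1..<2 * n} \<inter> {2, 2 * n - 2})) \<le> 2" by simp
    qed (use n in auto)
    also have "\<dots> = 2 / real n + 4 / (real n - 1)" using n by (simp add: divide_simps)
    also have "4 / (real n - 1) \<le> 8 / real n" using n by (simp add: divide_simps)
    finally show ?thesis by simp
  qed
  finally show ?thesis using F0 by (simp add: F_def mult_right_mono)
qed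

lemma prob_disconnected:
  assumes "n \<ge> 2"
  shows "measure_pmf.prob (pmf_of_set (pairs n)) {(\<alpha>, \<beta>). \<not> connected_pair {..<6 * n} \<alpha> \<beta>} \<le> 10 / real n"
proof -
  let ?U = "{..<6 * n}"
  let ?D = "{(\<alpha>, \<beta>). \<not> connected_pair ?U \<alpha> \<beta>}"
  have "card (pairs n \<inter> ?D) = card (SIGMA \<alpha> : cubic_rots ?U. {\<beta> \<in> matchings ?U. \<not> connected_pair ?U \<alpha> \<beta>})"
    by (rule arg_cong[where f = card]) (auto simp: pairs_def)
  also have "\<dots> = (\<Sum>\<alpha>\<in>cubic_rots ?U. card {\<beta> \<in> matchings ?U. \<not> connected_pair ?U \<alpha> \<beta>})"
    by (subst card_SigmaI) auto
  finally have "real (card (pairs n \<inter> ?D)) = (\<Sum>\<alpha>\<in>cubic_rots ?U. real (card {\<beta> \<in> matchings ?U. \<not> connected_pair ?U \<alpha> \<beta>}))"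
    by simp
  also have "\<dots> \<le> (\<Sum>\<alpha>\<in>cubic_rots ?U. 10 / real n * real (card (matchings ?U)))"
    using assms by (intro sum_mono card_disconnected) auto
  also have "\<dots> = 10 / real n * real (card (pairs n))"
    by (simp add: pairs_def card_cartesian_product)
  finally have "real (card (pairs n \<inter> ?D)) \<le> 10 / real n * real (card (pairs n))" .
  moreover have "card (pairs n) > 0" by (simp add: card_gt_0_iff)
  ultimately show ?thesis by (simp add: measure_pmf_of_set divide_le_eq)
qed

section \<open>Counting rooted maps up to isomorphism\<close>

definition conn_pairs :: "nat \<Rightarrow> (nat \<Rightarrow> bool) \<Rightarrow> ((nat \<Rightarrow> nat) \<times> (nat \<Rightarrow> nat)) set" where
  "conn_pairs n Q = {(\<alpha>, \<beta>) \<in> pairs n. connected_pair {..<6 * n} \<alpha> \<beta> \<and> Q (ncyc (\<alpha> \<circ> \<beta>) {..<6 * n})}"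

lemma rooted_map_iff:
  "rooted_map M \<longleftrightarrow> finite (darts M) \<and> root_dart M \<in> darts M \<and> rotation M permutes darts M \<and>
     reversal M \<in> matchings (darts M) \<and> connected_pair (darts M) (rotation M) (reversal M)"
  by (auto simp: rooted_map_def matchings_def connected_pair_def dart_step_def steps_def)

lemma rooted_map_closed:
  assumes "rooted_map M" "d \<in> darts M"
  shows "rotation M d \<in> darts M" "reversal M d \<in> darts M"
  using assms by (auto simp: rooted_map_def permutes_in_image)

lemma map_faces_ncyc: "card (map_faces M) = ncyc (rotation M \<circ> reversal M) (darts M)"
  by (simp add: map_faces_def ncyc_def)

section \<open>Isomorphisms, relabelling and rigidity\<close>

definition map_hom :: "(nat \<Rightarrow> nat) \<Rightarrow> rooted_rotation_system \<Rightarrow> rooted_rotation_system \<Rightarrow> bool" where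
  "map_hom h M N \<longleftrightarrow> bij_betw h (darts M) (darts N) \<and> h (root_dart M) = root_dart N \<and>
     (\<forall>d\<in>darts M. h (rotation M d) = rotation N (h d) \<and> h (reversal M d) = reversal N (h d))"

lemma rooted_map_iso_iff:
  "(M, N) \<in> rooted_map_iso \<longleftrightarrow> rooted_map M \<and> rooted_map N \<and> (\<exists>h. map_hom h M N)"
  by (simp add: rooted_map_iso_def map_hom_def)

lemma map_hom_inverse:
  assumes M: "rooted_map M" and h: "map_hom h M N"
  shows "map_hom (inv_into (darts M) h) N M"
proof -
  let ?g = "inv_into (darts M) h"
  have b: "bij_betw h (darts M) (darts N)" using h by (simp add: map_hom_def)
  have gh: "?g (h d) = d" if "d \<in> darts M" for d using b that by (rule bij_betw_inv_into_left)
  have "?g (rotation N e) = rotation M (?g e) \<and> ?g (reversal N e) = reversal M (?g e)"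
    if "e \<in> darts N" for e
  proof -
    obtain d where d: "d \<in> darts M" "e = h d" using b \<open>e \<in> darts N\<close> by (auto simp: bij_betw_def)
    then have "rotation N e = h (rotation M d)" "reversal N e = h (reversal M d)"
      using h by (auto simp: map_hom_def)
    then show ?thesis using gh d rooted_map_closed[OF M d(1)] by simp
  qed
  moreover have "?g (root_dart N) = root_dart M"
    using h gh[of "root_dart M"] M by (auto simp: map_hom_def rooted_map_def)
  ultimately show ?thesis using bij_betw_inv_into[OF b] by (auto simp: map_hom_def)
qed

lemma map_hom_comp:
  assumes "map_hom h M N" "map_hom g N L"
  shows "map_hom (g \<circ> h) M L"
proof -
  have "h d \<in> darts N" if "d \<in> darts M" for d
    using assms(1) that by (auto simp: map_hom_def bij_betw_def)
  then show ?thesis using assms by (auto simp: map_hom_def intro: bij_betw_trans)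
qed

lemma equiv_rooted_map_iso: "equiv {M. rooted_map M} rooted_map_iso"
proof (rule equivI)
  show "rooted_map_iso \<subseteq> {M. rooted_map M} \<times> {M. rooted_map M}"
    by (auto simp: rooted_map_iso_iff)
  have "map_hom id M M" for M by (simp add: map_hom_def)
  then show "refl_on {M. rooted_map M} rooted_map_iso"
    by (auto simp: refl_on_def rooted_map_iso_iff)
  show "sym rooted_map_iso"
    using map_hom_inverse by (auto simp: sym_def rooted_map_iso_iff)
  show "trans rooted_map_iso"
    using map_hom_comp by (auto simp: trans_def rooted_map_iso_iff) blast
qed

definition transport :: "(nat \<Rightarrow> nat) \<Rightarrow> rooted_rotation_system \<Rightarrow> rooted_rotation_system" where
  "transport h M = \<lparr>darts = h ` darts M, rotation = map_permutation (darts M) h (rotation M),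
     reversal = map_permutation (darts M) h (reversal M), root_dart = h (root_dart M)\<rparr>"

lemma map_hom_steps:
  assumes "map_hom h M N" "rooted_map M" "d \<in> darts M" "(d, e) \<in> (dart_step M)\<^sup>*"
  shows "(h d, h e) \<in> (dart_step N)\<^sup>* \<and> e \<in> darts M"
  using assms(4)
proof (induction rule: rtrancl_induct)
  case base
  then show ?case using assms by simp
next
  case (step y z)
  then have y: "y \<in> darts M" "z = rotation M y \<or> z = reversal M y" by (auto simp: dart_step_def)
  have "h y \<in> darts N" using y assms(1) by (auto simp: map_hom_def bij_betw_def)
  then have "(h y, h z) \<in> dart_step N" using y assms(1) by (auto simp: dart_step_def map_hom_def)
  then show ?case using step.IH y rooted_map_closed[OF assms(2) y(1)] by auto
qed

lemma transport_iso:
  assumes M: "rooted_map M" and inj: "inj_on h (darts M)"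
  shows "(M, transport h M) \<in> rooted_map_iso"
proof -
  let ?N = "transport h M" and ?D = "darts M"
  have b: "bij_betw h ?D (h ` ?D)" using inj by (rule inj_on_imp_bij_betw)
  have ap: "map_permutation ?D h p (h d) = h (p d)" if "d \<in> ?D" for p d
    using inj that by (rule map_permutation_apply)
  have hom: "map_hom h M ?N" using b ap by (auto simp: map_hom_def transport_def)
  have "rotation ?N permutes h ` ?D" "reversal ?N permutes h ` ?D"
    using M b by (auto simp: transport_def rooted_map_def intro: map_permutation_permutes)
  moreover have "reversal ?N e \<noteq> e \<and> reversal ?N (reversal ?N e) = e" if "e \<in> h ` ?D" for e
  proof -
    obtain d where d: "d \<in> ?D" "e = h d" using \<open>e \<in> h ` ?D\<close> by auto
    have r: "reversal M d \<in> ?D" using rooted_map_closed[OF M d(1)] by simp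
    have "reversal M d \<noteq> d" "reversal M (reversal M d) = d" using M d by (auto simp: rooted_map_def)
    then show ?thesis using d r ap inj by (auto simp: transport_def inj_on_eq_iff)
  qed
  moreover have "(x, y) \<in> (dart_step ?N)\<^sup>*" if "x \<in> h ` ?D" "y \<in> h ` ?D" for x y
  proof -
    obtain d e where "d \<in> ?D" "x = h d" "e \<in> ?D" "y = h e"
      using \<open>x \<in> h ` ?D\<close> \<open>y \<in> h ` ?D\<close> by auto
    then show ?thesis using M map_hom_steps[OF hom M, of d e] by (auto simp: rooted_map_def)
  qed
  ultimately have "rooted_map ?N" using M by (auto simp: rooted_map_def transport_def)
  then show ?thesis using M hom by (auto simp: rooted_map_iso_iff)
qed

text \<open>Rigidity: the image of the root is prescribed, and connectivity propagates it along
  rotation and reversal to every dart.\<close>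

lemma map_hom_unique:
  assumes M: "rooted_map M" and h: "map_hom h M N" and g: "map_hom g M N" and e: "e \<in> darts M"
  shows "h e = g e"
proof -
  let ?r = "root_dart M"
  have r: "?r \<in> darts M" using M by (simp add: rooted_map_def)
  have "(?r, e) \<in> (dart_step M)\<^sup>*" using M e r by (simp add: rooted_map_def)
  then show ?thesis
  proof (induction rule: rtrancl_induct)
    case base
    then show ?case using h g by (simp add: map_hom_def)
  next
    case (step y z)
    then show ?case using h g by (auto simp: map_hom_def dart_step_def)
  qed
qed

text \<open>Rotation and reversal are the identity outside the darts, so an isomorphism determines
  the target as a record and not only its action on darts.\<close>

lemma map_hom_transport:
  assumes M: "rooted_map M" and N: "rooted_map N" and h: "map_hom h M N"
  shows "transport h M = N"
proof -
  have b: "bij_betw h (darts M) (darts N)" using h by (simp add: map_hom_def)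
  have inj: "inj_on h (darts M)" and im: "h ` darts M = darts N" using b by (auto simp: bij_betw_def)
  have eq: "map_permutation (darts M) h p = q"
    if "p permutes darts M" "q permutes darts N" "\<forall>d\<in>darts M. h (p d) = q (h d)" for p q
  proof
    fix x show "map_permutation (darts M) h p x = q x"
    proof (cases "x \<in> darts N")
      case True
      then obtain d where "d \<in> darts M" "x = h d" using im by auto
      then show ?thesis using map_permutation_apply[OF inj] that by simp
    next
      case False
      then show ?thesis
        using permutes_not_in[OF map_permutation_permutes[OF b that(1)]] permutes_not_in[OF that(2)] by simp
    qed
  qed
  have "map_permutation (darts M) h (rotation M) = rotation N"
    "map_permutation (darts M) h (reversal M) = reversal N"
    using M N h by (auto simp: rooted_map_def map_hom_def intro!: eq)
  then show ?thesis using h im by (simp add: transport_def map_hom_def)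
qed

text \<open>The symmetric group acts by relabelling on the members of the class with darts
  \<open>{..<N}\<close>; every member is reached, and by rigidity distinct permutations give
  distinct members.\<close>

lemma card_iso_labelled:
  assumes M: "rooted_map M" and D: "darts M = {..<N}"
  shows "card {L. (M, L) \<in> rooted_map_iso \<and> darts L = {..<N}} = fact N"
proof -
  have "bij_betw (\<lambda>h. transport h M) {h. h permutes {..<N}} {L. (M, L) \<in> rooted_map_iso \<and> darts L = {..<N}}"
  proof (rule bij_betw_imageI)
    have hom: "map_hom h M (transport h M)" if "h permutes {..<N}" for h
    proof -
      have i: "inj_on h (darts M)" using that by (rule permutes_inj_on)
      then show ?thesis
        using map_permutation_apply[OF i] inj_on_imp_bij_betw[OF i]
        by (auto simp: map_hom_def transport_def)
    qed
    show "inj_on (\<lambda>h. transport h M) {h. h permutes {..<N}}"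
    proof (rule inj_onI)
      fix h g assume hg: "h \<in> {h. h permutes {..<N}}" "g \<in> {h. h permutes {..<N}}"
        "transport h M = transport g M"
      then have "map_hom h M (transport g M)" "map_hom g M (transport g M)"
        using hom[of h] hom[of g] by simp_all
      then have "h e = g e" if "e \<in> {..<N}" for e
        using map_hom_unique[OF M, of h "transport g M" g e] that D by auto
      moreover have "h e = g e" if "e \<notin> {..<N}" for e
        using hg that by (simp add: permutes_not_in)
      ultimately show "h = g" by blast
    qed
    show "(\<lambda>h. transport h M) ` {h. h permutes {..<N}} = {L. (M, L) \<in> rooted_map_iso \<and> darts L = {..<N}}"
    proof (intro equalityI subsetI)
      fix L assume "L \<in> (\<lambda>h. transport h M) ` {h. h permutes {..<N}}"
      then obtain h where h: "h permutes {..<N}" "L = transport h M" by auto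
      then show "L \<in> {L. (M, L) \<in> rooted_map_iso \<and> darts L = {..<N}}"
        using transport_iso[OF M permutes_inj_on[OF h(1)]] D permutes_image[OF h(1)]
        by (simp add: transport_def)
    next
      fix L assume L: "L \<in> {L. (M, L) \<in> rooted_map_iso \<and> darts L = {..<N}}"
      then obtain h where h: "map_hom h M L" and rl: "rooted_map L" and dl: "darts L = {..<N}"
        by (auto simp: rooted_map_iso_iff)
      \<comment> \<open>An isomorphism is prescribed on the darts only; the identity elsewhere turns
        it into a permutation.\<close>
      define g where "g = restrict_id h {..<N}"
      have g: "g permutes {..<N}" unfolding g_def
        using h D dl by (intro permutes_restrict_id) (simp add: map_hom_def)
      have eq: "g d = h d" if "d \<in> darts M" for d using that D by (simp add: g_def)
      have "map_hom g M L"
        using h eq rooted_map_closed[OF M] M bij_betw_cong[of "darts M" g h "darts L"]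
        by (auto simp: map_hom_def rooted_map_def)
      then have "transport g M = L" using M rl by (intro map_hom_transport)
      then show "L \<in> (\<lambda>h. transport h M) ` {h. h permutes {..<N}}" using g by blast
    qed
  qed
  then have "card {h. h permutes {..<N}} = card {L. (M, L) \<in> rooted_map_iso \<and> darts L = {..<N}}"
    by (rule bij_betw_same_card)
  then show ?thesis using card_permutations[of "{..<N}" N] by simp
qed

lemma finite_labelled: "finite {M. rooted_map M \<and> darts M = {..<N}}"
proof -
  let ?P = "{p. p permutes {..<N}}"
  have "{M. rooted_map M \<and> darts M = {..<N}} \<subseteq>
      (\<lambda>(p, q, r). \<lparr>darts = {..<N}, rotation = p, reversal = q, root_dart = r\<rparr>) ` (?P \<times> ?P \<times> {..<N})"
  proof
    fix M assume "M \<in> {M. rooted_map M \<and> darts M = {..<N}}"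
    then have "M = (\<lambda>(p, q, r). \<lparr>darts = {..<N}, rotation = p, reversal = q, root_dart = r\<rparr>)
        (rotation M, reversal M, root_dart M)" "(rotation M, reversal M, root_dart M) \<in> ?P \<times> ?P \<times> {..<N}"
      by (auto simp: rooted_map_def)
    then show "M \<in> (\<lambda>(p, q, r). \<lparr>darts = {..<N}, rotation = p, reversal = q, root_dart = r\<rparr>) ` (?P \<times> ?P \<times> {..<N})"
      by blast
  qed
  then show ?thesis by (rule finite_subset) (simp add: finite_permutations)
qed

text \<open>
  Rooted maps have no nontrivial automorphisms, so every isomorphism class has exactly
  \<^term>\<open>fact N\<close> labellings by the first \<^term>\<open>N\<close> natural numbers.
\<close>

lemma card_quotient_rooted_maps:
  assumes inv: "\<And>M L. (M, L) \<in> rooted_map_iso \<Longrightarrow> P M \<Longrightarrow> P L"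
    and card: "\<And>M. rooted_map M \<Longrightarrow> P M \<Longrightarrow> card (darts M) = N"
  shows "card ({M. rooted_map M \<and> P M} // rooted_map_iso) * fact N
    = card {M. rooted_map M \<and> P M \<and> darts M = {..<N}}"
proof -
  let ?X = "{M. rooted_map M \<and> P M \<and> darts M = {..<N}}"
  let ?f = "\<lambda>M. rooted_map_iso `` {M}"
  have fin: "finite ?X" by (rule finite_subset[OF _ finite_labelled]) auto
  have quo: "{M. rooted_map M \<and> P M} // rooted_map_iso = ?f ` ?X"
  proof (intro equalityI subsetI)
    fix C assume "C \<in> {M. rooted_map M \<and> P M} // rooted_map_iso"
    then obtain M where M: "rooted_map M" "P M" "C = ?f M" by (auto simp: quotient_def)
    have "finite (darts M)" "card (darts M) = N" using M card by (auto simp: rooted_map_def)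
    then obtain h where h: "bij_betw h (darts M) {..<N}"
      using ex_bij_betw_finite_nat[of "darts M"] by (auto simp: atLeast0LessThan)
    have iso: "(M, transport h M) \<in> rooted_map_iso"
      using M h by (intro transport_iso) (auto simp: bij_betw_def)
    then have "transport h M \<in> ?X"
      using inv[OF iso M(2)] h by (auto simp: rooted_map_iso_iff transport_def bij_betw_def)
    moreover have "?f (transport h M) = C"
      unfolding M(3) using equiv_class_eq[OF equiv_rooted_map_iso iso] by simp
    ultimately show "C \<in> ?f ` ?X" by blast
  qed (auto simp: quotient_def)
  have "card ?X = (\<Sum>C\<in>?f ` ?X. card {M \<in> ?X. ?f M = C})"
    using sum.image_gen[OF fin, of "\<lambda>_. 1::nat" ?f] by simp
  also have "\<dots> = (\<Sum>C\<in>?f ` ?X. fact N)"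
  proof (rule sum.cong[OF refl])
    fix C assume "C \<in> ?f ` ?X"
    then obtain M where M: "M \<in> ?X" "C = ?f M" by auto
    have "{L \<in> ?X. ?f L = C} = {L. (M, L) \<in> rooted_map_iso \<and> darts L = {..<N}}"
    proof (intro equalityI subsetI)
      fix L assume L: "L \<in> {L \<in> ?X. ?f L = C}"
      then have "?f M = ?f L" using M by simp
      then have "(M, L) \<in> rooted_map_iso"
        using L M eq_equiv_class_iff[OF equiv_rooted_map_iso, of M L] by simp
      then show "L \<in> {L. (M, L) \<in> rooted_map_iso \<and> darts L = {..<N}}" using L by simp
    next
      fix L assume L: "L \<in> {L. (M, L) \<in> rooted_map_iso \<and> darts L = {..<N}}"
      then have "?f M = ?f L" using equiv_class_eq[OF equiv_rooted_map_iso, of M L] by simp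
      then show "L \<in> {L \<in> ?X. ?f L = C}" using L M inv[of M L] by (auto simp: rooted_map_iso_iff)
    qed
    then show "card {L \<in> ?X. ?f L = C} = fact N" using card_iso_labelled[of M N] M by simp
  qed
  finally show ?thesis unfolding quo by simp
qed

text \<open>The factor \<open>N\<close> is the free choice of the root dart, since \<open>Q\<close>
  sees only rotation and reversal.\<close>

lemma card_labelled:
  "card {M. rooted_map M \<and> darts M = {..<N} \<and> Q (rotation M) (reversal M)}
    = N * card {(\<alpha>, \<beta>). \<alpha> permutes {..<N} \<and> \<beta> \<in> matchings {..<N} \<and> connected_pair {..<N} \<alpha> \<beta> \<and> Q \<alpha> \<beta>}"
proof -
  let ?X = "{M. rooted_map M \<and> darts M = {..<N} \<and> Q (rotation M) (reversal M)}"
  let ?Y = "{(\<alpha>, \<beta>). \<alpha> permutes {..<N} \<and> \<beta> \<in> matchings {..<N} \<and> connected_pair {..<N} \<alpha> \<beta> \<and> Q \<alpha> \<beta>}"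
  have "bij_betw (\<lambda>M. (root_dart M, (rotation M, reversal M))) ?X ({..<N} \<times> ?Y)"
  proof (rule bij_betw_byWitness[where f' = "\<lambda>(r, (p, q)). \<lparr>darts = {..<N}, rotation = p, reversal = q, root_dart = r\<rparr>"])
    let ?g = "\<lambda>(r, (p, q)). \<lparr>darts = {..<N}, rotation = p, reversal = q, root_dart = r\<rparr>"
    show "\<forall>M\<in>?X. ?g (root_dart M, (rotation M, reversal M)) = M"
    proof
      fix M assume "M \<in> ?X"
      then have "darts M = {..<N}" by simp
      then show "?g (root_dart M, (rotation M, reversal M)) = M" by (cases M) simp
    qed
    show "\<forall>a\<in>{..<N} \<times> ?Y. (root_dart (?g a), (rotation (?g a), reversal (?g a))) = a"
      by (simp add: split_def)
    show "(\<lambda>M. (root_dart M, (rotation M, reversal M))) ` ?X \<subseteq> {..<N} \<times> ?Y"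
    proof
      fix a assume "a \<in> (\<lambda>M. (root_dart M, (rotation M, reversal M))) ` ?X"
      then obtain M where M: "rooted_map M" "darts M = {..<N}" "Q (rotation M) (reversal M)"
        "a = (root_dart M, (rotation M, reversal M))" by blast
      then show "a \<in> {..<N} \<times> ?Y" using rooted_map_iff[of M] by simp
    qed
    show "?g ` ({..<N} \<times> ?Y) \<subseteq> ?X"
    proof
      fix M assume "M \<in> ?g ` ({..<N} \<times> ?Y)"
      then obtain a where a: "a \<in> {..<N} \<times> ?Y" "M = ?g a" by blast
      then show "M \<in> ?X" using rooted_map_iff[of M] by (cases a) auto
    qed
  qed
  then have "card ?X = card ({..<N} \<times> ?Y)" by (rule bij_betw_same_card)
  then show ?thesis by (simp add: card_cartesian_product)
qed

section \<open>Invariants of cubic maps and Euler's formula\<close>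

lemma orbit_image_hom:
  assumes fin: "finite D" and p: "p permutes D" and b: "bij_betw h D D'"
    and eq: "\<forall>d\<in>D. h (p d) = q (h d)"
  shows "orbit q ` D' = (`) h ` orbit p ` D" "card (orbit q ` D') = card (orbit p ` D)"
proof -
  have perm: "permutation p" using fin p by (auto simp: permutation_permutes)
  have sub: "orbit p d \<subseteq> D" if "d \<in> D" for d using permutes_orbit_subset[OF p that] .
  have "h ` orbit p d = orbit q (h d)" if "d \<in> D" for d
    using permutation_self_in_orbit[OF perm] sub[OF that] eq by (intro orbit_inverse) auto
  moreover have "D' = h ` D" using b by (simp add: bij_betw_def)
  ultimately show 1: "orbit q ` D' = (`) h ` orbit p ` D" by (auto simp: image_image)
  have "inj_on ((`) h) (orbit p ` D)"
    using b sub inj_on_image_Pow[of h D] by (auto simp: bij_betw_def intro: inj_on_subset)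
  then show "card (orbit q ` D') = card (orbit p ` D)" unfolding 1 by (rule card_image)
qed

lemma iso_invariants:
  assumes iso: "(M, N) \<in> rooted_map_iso"
  shows "card (map_vertices N) = card (map_vertices M)" "card (map_edges N) = card (map_edges M)"
    "card (map_faces N) = card (map_faces M)" "cubic_map M \<Longrightarrow> cubic_map N"
proof -
  obtain h where M: "rooted_map M" and h: "map_hom h M N" using iso by (auto simp: rooted_map_iso_iff)
  have b: "bij_betw h (darts M) (darts N)" using h by (simp add: map_hom_def)
  have fin: "finite (darts M)" and p: "rotation M permutes darts M" "reversal M permutes darts M"
    using M by (auto simp: rooted_map_def)
  have pf: "rotation M \<circ> reversal M permutes darts M" using p by (intro permutes_compose)
  have e: "\<forall>d\<in>darts M. h (rotation M d) = rotation N (h d)" "\<forall>d\<in>darts M. h (reversal M d) = reversal N (h d)"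
    using h by (auto simp: map_hom_def)
  have ef: "\<forall>d\<in>darts M. h ((rotation M \<circ> reversal M) d) = (rotation N \<circ> reversal N) (h d)"
    using e rooted_map_closed[OF M] by simp
  show "card (map_vertices N) = card (map_vertices M)"
    unfolding map_vertices_def by (rule orbit_image_hom(2)[OF fin p(1) b e(1)])
  show "card (map_edges N) = card (map_edges M)"
    unfolding map_edges_def by (rule orbit_image_hom(2)[OF fin p(2) b e(2)])
  show "card (map_faces N) = card (map_faces M)"
    unfolding map_faces_def by (rule orbit_image_hom(2)[OF fin pf b ef])
  assume c: "cubic_map M"
  show "cubic_map N" unfolding cubic_map_def
  proof
    fix v assume "v \<in> map_vertices N"
    then have "v \<in> (`) h ` map_vertices M"
      unfolding map_vertices_def orbit_image_hom(1)[OF fin p(1) b e(1)] .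
    then obtain w where w: "w \<in> map_vertices M" "v = h ` w" by (rule imageE)
    then obtain d where "d \<in> darts M" "w = orbit (rotation M) d" by (auto simp: map_vertices_def)
    then have "w \<subseteq> darts M" using permutes_orbit_subset[OF p(1)] by simp
    then have "inj_on h w" using b inj_on_subset by (auto simp: bij_betw_def)
    then have "card v = card w" unfolding w(2) by (rule card_image)
    then show "card v = 3" using c w by (simp add: cubic_map_def)
  qed
qed

lemma card_permutes_orbits:
  assumes "finite D" "p permutes D" "\<forall>x\<in>D. card (orbit p x) = k"
  shows "card D = k * card (orbit p ` D)"
proof -
  have "\<Union>(orbit p ` D) = D"
    using assms by (intro Union_orbits) (auto simp: permutes_in_image)
  then show ?thesis using card_Union_orbits[OF assms, of "orbit p ` D"] by simp
qed

lemma card_orbit_matching: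
  assumes "\<beta> \<in> matchings D" "x \<in> D" shows "card (orbit \<beta> x) = 2"
proof -
  have b: "\<beta> x \<noteq> x" "\<beta> (\<beta> x) = x" using assms by (auto simp: matchings_def)
  then have "(\<beta> ^^ 2) x = x" by (simp add: numeral_2_eq_2)
  then have "orbit \<beta> x = {(\<beta> ^^ m) x |m. m < 2}" by (intro orbit_altdef_bounded) auto
  also have "\<dots> = {x, \<beta> x}"
    by (auto simp: less_Suc_eq numeral_2_eq_2 intro: exI[of _ 0] exI[of _ "Suc 0"])
  finally show ?thesis using b by simp
qed

lemma cubic_map_iff:
  assumes "rooted_map M" shows "cubic_map M \<longleftrightarrow> rotation M \<in> cubic_rots (darts M)"
  using assms by (auto simp: cubic_map_def map_vertices_def cubic_rots_def rooted_map_def)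

lemma cubic_map_cards:
  assumes M: "rooted_map M" and c: "cubic_map M"
  shows "card (darts M) = 3 * card (map_vertices M)" "card (darts M) = 2 * card (map_edges M)"
proof -
  have "rotation M \<in> cubic_rots (darts M)" using c cubic_map_iff[OF M] by simp
  then show "card (darts M) = 3 * card (map_vertices M)"
    unfolding map_vertices_def using M by (intro card_permutes_orbits) (auto simp: cubic_rots_def rooted_map_def)
  have "reversal M \<in> matchings (darts M)" using M by (simp add: rooted_map_iff)
  then show "card (darts M) = 2 * card (map_edges M)"
    unfolding map_edges_def using M card_orbit_matching
    by (intro card_permutes_orbits) (auto simp: rooted_map_def)
qed

text \<open>The common source of both counts: \<open>R\<close> is the condition on faces or genus,
  and \<open>Q\<close> is its translation to the number of cycles of the product, valid on cubic
  maps with \<open>2 * n\<close> vertices. Each class has \<open>(6 * n)!\<close> labellings and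
  each pair \<open>6 * n\<close> roots.\<close>

lemma card_quotient_cubic_maps:
  assumes inv: "\<And>M L. (M, L) \<in> rooted_map_iso \<Longrightarrow> R M \<Longrightarrow> R L"
    and R: "\<And>M. M \<in> rooted_cubic_maps n \<Longrightarrow> R M \<longleftrightarrow> Q (card (map_faces M))"
  shows "card ({M \<in> rooted_cubic_maps n. R M} // rooted_map_iso) * fact (6 * n)
    = 6 * n * card (conn_pairs n Q)"
proof -
  let ?P = "\<lambda>M. cubic_map M \<and> card (map_vertices M) = 2 * n \<and> R M"
  let ?Q = "\<lambda>\<alpha> \<beta>. \<alpha> \<in> cubic_rots {..<6 * n} \<and> Q (ncyc (\<alpha> \<circ> \<beta>) {..<6 * n})"
  have "{M \<in> rooted_cubic_maps n. R M} = {M. rooted_map M \<and> ?P M}"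
    by (auto simp: rooted_cubic_maps_def)
  moreover have "card ({M. rooted_map M \<and> ?P M} // rooted_map_iso) * fact (6 * n)
      = card {M. rooted_map M \<and> ?P M \<and> darts M = {..<6 * n}}"
  proof (rule card_quotient_rooted_maps)
    show "?P L" if "(M, L) \<in> rooted_map_iso" "?P M" for M L
      using iso_invariants[OF that(1)] inv[OF that(1)] that(2) by auto
    show "card (darts M) = 6 * n" if "rooted_map M" "?P M" for M
      using cubic_map_cards[OF that(1)] that(2) by simp
  qed
  moreover have "{M. rooted_map M \<and> ?P M \<and> darts M = {..<6 * n}}
      = {M. rooted_map M \<and> darts M = {..<6 * n} \<and> ?Q (rotation M) (reversal M)}"
  proof (rule Collect_cong)
    fix M
    have "?P M \<longleftrightarrow> ?Q (rotation M) (reversal M)" if M: "rooted_map M" and D: "darts M = {..<6 * n}"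
    proof -
      have "card (map_vertices M) = 2 * n" if "cubic_map M"
        using cubic_map_cards(1)[OF M that] D by simp
      then have "?P M \<longleftrightarrow> cubic_map M \<and> card (map_vertices M) = 2 * n \<and> Q (card (map_faces M))"
        using R[of M] M by (auto simp: rooted_cubic_maps_def)
      also have "\<dots> \<longleftrightarrow> ?Q (rotation M) (reversal M)"
      proof -
        have "cubic_map M \<longleftrightarrow> rotation M \<in> cubic_rots {..<6 * n}" using cubic_map_iff[OF M] D by simp
        moreover have "card (map_faces M) = ncyc (rotation M \<circ> reversal M) {..<6 * n}"
          using map_faces_ncyc[of M] D by simp
        ultimately show ?thesis using \<open>cubic_map M \<Longrightarrow> card (map_vertices M) = 2 * n\<close> by metis
      qed
      finally show ?thesis .
    qed
    then show "(rooted_map M \<and> ?P M \<and> darts M = {..<6 * n})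
        \<longleftrightarrow> (rooted_map M \<and> darts M = {..<6 * n} \<and> ?Q (rotation M) (reversal M))" by blast
  qed
  moreover have "{(\<alpha>, \<beta>). \<alpha> permutes {..<6 * n} \<and> \<beta> \<in> matchings {..<6 * n} \<and> connected_pair {..<6 * n} \<alpha> \<beta> \<and> ?Q \<alpha> \<beta>}
      = conn_pairs n Q"
    by (auto simp: conn_pairs_def pairs_def cubic_rots_def)
  ultimately show ?thesis using card_labelled[of "6 * n" ?Q] by simp
qed

lemma cubic_face_count_pairs:
  "cubic_face_count n f * fact (6 * n)
    = 6 * n * card (conn_pairs n (\<lambda>x. x = f))"
  unfolding cubic_face_count_def
  by (rule card_quotient_cubic_maps[where Q = "\<lambda>x. x = f"]) (auto dest: iso_invariants)

text \<open>Euler's relation \<open>2 * n - 3 * n + x = 2 - 2 * g\<close> for \<open>x\<close>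
  faces, written additively to avoid truncated subtraction.\<close>

lemma cubic_genus_count_pairs:
  "cubic_genus_count n g * fact (6 * n)
    = 6 * n * card (conn_pairs n (\<lambda>x. x + 2 * g = n + 2))"
  unfolding cubic_genus_count_def
proof (rule card_quotient_cubic_maps[where Q = "\<lambda>x. x + 2 * g = n + 2"])
  show "map_genus L g" if "(M, L) \<in> rooted_map_iso" "map_genus M g" for M L
    using that iso_invariants[OF that(1)] by (simp add: map_genus_def)
  show "map_genus M g \<longleftrightarrow> card (map_faces M) + 2 * g = n + 2" if "M \<in> rooted_cubic_maps n" for M
  proof -
    have M: "rooted_map M" "cubic_map M" "card (map_vertices M) = 2 * n"
      using that by (auto simp: rooted_cubic_maps_def)
    then have "card (map_edges M) = 3 * n" using cubic_map_cards[of M] by simp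
    then show ?thesis using M unfolding map_genus_def by linarith
  qed
qed

section \<open>Parity and negligible perturbations\<close>

text \<open>Deleting a point that is not fixed multiplies by a transposition and lowers only the
  size; deleting a fixed point keeps the sign and lowers both size and cycle count. In either case
  the parity of the exponent follows the sign.\<close>

lemma sign_ncyc:
  assumes "finite U" "p permutes U"
  shows "sign p = (-1) ^ (card U + ncyc p U)"
  using assms
proof (induction "card U" arbitrary: U p)
  case 0
  then have "U = {}" by simp
  then show ?case using 0 by (simp add: ncyc_def)
next
  case (Suc k)
  then obtain x where x: "x \<in> U" by (metis card.empty ex_in_conv nat.distinct(1))
  have d: "del x p permutes U - {x}" using Suc.prems x by (intro del_permutes)
  have k: "k = card (U - {x})" using Suc.hyps(2) x Suc.prems by simp
  have IH: "sign (del x p) = (-1) ^ (k + ncyc (del x p) (U - {x}))"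
    using Suc.hyps(1)[OF k _ d] k Suc.prems by simp
  have "sign (del x p) = sign (Transposition.transpose x (p x)) * sign p"
    unfolding del_def using Suc.prems
    by (intro sign_compose permutation_swap_id) (auto simp: permutation_permutes)
  then have s: "sign (del x p) = (if p x = x then sign p else - sign p)"
    by (simp add: sign_swap_id eq_commute)
  show ?case
    using IH s ncyc_del[OF Suc.prems x] Suc.hyps(2)[symmetric] by (cases "p x = x") auto
qed

text \<open>On \<open>6 * n\<close> points \<open>\<alpha>\<close> has \<open>2 * n\<close> cycles
  and \<open>\<beta>\<close> has \<open>3 * n\<close>; multiplicativity of the sign gives the parity
  of the third count. It makes \<open>n + 2 - f\<close> even, so that halving it yields a
  genus.\<close>

lemma parity_ncyc_pair:
  assumes "(\<alpha>, \<beta>) \<in> pairs n"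
  shows "even (ncyc (\<alpha> \<circ> \<beta>) {..<6 * n}) \<longleftrightarrow> even n"
proof -
  let ?U = "{..<6 * n}"
  have a: "\<alpha> permutes ?U" "\<forall>x\<in>?U. card (orbit \<alpha> x) = 3" and b: "\<beta> permutes ?U" "\<beta> \<in> matchings ?U"
    using assms by (auto simp: pairs_def cubic_rots_def matchings_def)
  have na: "ncyc \<alpha> ?U = 2 * n" using card_permutes_orbits[OF _ a] by (simp add: ncyc_def)
  have nb: "ncyc \<beta> ?U = 3 * n"
    using card_permutes_orbits[OF _ b(1), of 2] card_orbit_matching[OF b(2)] by (simp add: ncyc_def)
  have ab: "\<alpha> \<circ> \<beta> permutes ?U" using a b by (intro permutes_compose)
  have "sign (\<alpha> \<circ> \<beta>) = sign \<alpha> * sign \<beta>"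
    using a b by (intro sign_compose) (auto simp: permutation_permutes)
  then have "(-1::int) ^ (6 * n + ncyc (\<alpha> \<circ> \<beta>) ?U) = (-1) ^ (6 * n + 2 * n) * (-1) ^ (6 * n + 3 * n)"
    using sign_ncyc[OF _ ab] sign_ncyc[OF _ a(1)] sign_ncyc[OF _ b(1)] na nb by simp
  then have "(-1::int) ^ ncyc (\<alpha> \<circ> \<beta>) ?U = (-1) ^ n"
    by (simp add: power_add power_mult)
  then show ?thesis by (cases "even n"; cases "even (ncyc (\<alpha> \<circ> \<beta>) ?U)") auto
qed

lemma power_ln_over_sqrt: "(\<lambda>n. ln (real n) ^ 4 / sqrt (real n)) \<longlonglongrightarrow> 0"
  by real_asymp

lemma expectation_finite_sum:
  assumes "set_pmf \<mu> \<subseteq> {..N::nat}"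
  shows "expect \<mu> \<phi> = (\<Sum>f\<le>N. \<phi> f * pmf \<mu> f :: real)"
  using assms by (subst integral_measure_pmf[of "{..N}"]) (auto simp: mult.commute)

lemma prob_finite_sum:
  assumes "set_pmf \<mu> \<subseteq> {..N::nat}"
  shows "measure_pmf.prob \<mu> S = (\<Sum>f\<le>N. indicator S f * pmf \<mu> f)"
proof -
  have "measure_pmf.prob \<mu> S = expect \<mu> (indicator S)" by simp
  also have "\<dots> = (\<Sum>f\<le>N. indicator S f * pmf \<mu> f)" by (rule expectation_finite_sum[OF assms])
  finally show ?thesis .
qed

text \<open>
  A weight \<^term>\<open>w n\<close> that differs from the law of the faces by mass of order \<^term>\<open>1 / n\<close> has the
  same first two moments to leading order and the same limit: the fourth moment of the law is only
  polylogarithmic, so the missing mass carries a vanishing second moment.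
\<close>

context
  fixes \<mu> :: "nat \<Rightarrow> nat pmf" and w :: "nat \<Rightarrow> nat \<Rightarrow> real" and Z :: "nat \<Rightarrow> real" and K :: real
  assumes law: "\<And>n. n \<ge> 1 \<Longrightarrow> peel_law (3 * n) (\<mu> n)"
    and w: "\<And>n f. 0 \<le> w n f" "\<And>n f. w n f \<le> pmf (\<mu> n) f"
    and deficit: "eventually (\<lambda>n. (\<Sum>f\<le>6 * n. pmf (\<mu> n) f - w n f) \<le> K / real n) sequentially"
    and Z: "eventually (\<lambda>n. \<bar>Z n - 1\<bar> \<le> K / real n) sequentially"
begin

lemma support_law: "n \<ge> 1 \<Longrightarrow> set_pmf (\<mu> n) \<subseteq> {..6 * n}"
  using law[of n] unfolding peel_law_def by auto

lemma deficit_tendsto: "(\<lambda>n. \<Sum>f\<le>6 * n. pmf (\<mu> n) f - w n f) \<longlonglongrightarrow> 0"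
proof (rule tendsto_sandwich[OF _ deficit tendsto_const])
  show "eventually (\<lambda>n. 0 \<le> (\<Sum>f\<le>6 * n. pmf (\<mu> n) f - w n f)) sequentially"
    using w by (intro always_eventually allI sum_nonneg) simp
  show "(\<lambda>n. K / real n) \<longlonglongrightarrow> 0" by (rule lim_const_over_n)
qed

text \<open>The inequality \<open>x \<le> x ^ 2 / s + s\<close> at \<open>x = f ^ 2\<close> and
  \<open>s = sqrt n\<close> trades the second moment of the missing mass for a fourth moment divided
  by \<open>sqrt n\<close> plus \<open>sqrt n\<close> times the missing mass; both vanish.\<close>

lemma second_moment_deficit: "(\<lambda>n. \<Sum>f\<le>6 * n. (real f)\<^sup>2 * (pmf (\<mu> n) f - w n f)) \<longlonglongrightarrow> 0"
proof (rule tendsto_sandwich[OF _ _ tendsto_const])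
  show "eventually (\<lambda>n. 0 \<le> (\<Sum>f\<le>6 * n. (real f)\<^sup>2 * (pmf (\<mu> n) f - w n f))) sequentially"
    using w by (intro always_eventually allI sum_nonneg mult_nonneg_nonneg) auto
  show "eventually (\<lambda>n. (\<Sum>f\<le>6 * n. (real f)\<^sup>2 * (pmf (\<mu> n) f - w n f))
      \<le> (10 ^ 6 + 4096 * peel_const) * (ln (real n) ^ 4 / sqrt (real n)) + K / sqrt (real n)) sequentially"
    using deficit eventually_ge_at_top[of 3]
  proof eventually_elim
    case (elim n)
    define s where "s = sqrt (real n)"
    have s: "s > 0" "s * s = real n" using elim by (simp_all add: s_def)
    have amgm: "x \<le> x\<^sup>2 / s + s" for x :: real
    proof -
      have "0 \<le> (x - s)\<^sup>2 / s + x" if "x \<ge> 0" using s that by simp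
      moreover have "(x - s)\<^sup>2 / s + x = x\<^sup>2 / s + s - x"
        using s by (simp add: power2_eq_square field_simps)
      moreover have "0 \<le> x\<^sup>2 / s" using s by simp
      ultimately show ?thesis using s by (cases "x \<ge> 0") linarith+
    qed
    have "(\<Sum>f\<le>6 * n. (real f)\<^sup>2 * (pmf (\<mu> n) f - w n f))
        \<le> (\<Sum>f\<le>6 * n. (real f ^ 4 / s + s) * (pmf (\<mu> n) f - w n f))"
      using w amgm[of "(real _)\<^sup>2"] by (intro sum_mono mult_right_mono) (auto simp flip: power_mult)
    also have "\<dots> = (\<Sum>f\<le>6 * n. real f ^ 4 * (pmf (\<mu> n) f - w n f)) / s + s * (\<Sum>f\<le>6 * n. pmf (\<mu> n) f - w n f)"
      by (simp add: distrib_right sum.distrib sum_distrib_left sum_divide_distrib)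
    also have "(\<Sum>f\<le>6 * n. real f ^ 4 * (pmf (\<mu> n) f - w n f)) \<le> (\<Sum>f\<le>6 * n. real f ^ 4 * pmf (\<mu> n) f)"
      using w by (intro sum_mono mult_left_mono) auto
    also have "\<dots> = expect (\<mu> n) (\<lambda>f. real f ^ 4)"
      using support_law[of n] elim by (simp add: expectation_finite_sum)
    also have "\<dots> \<le> (10 ^ 6 + 4096 * peel_const) * ln (real n) ^ 4"
      using elim by (intro law_fourth_moment_bound[OF law]) auto
    also have "s * (\<Sum>f\<le>6 * n. pmf (\<mu> n) f - w n f) \<le> s * (K / real n)"
      using elim s by (intro mult_left_mono) auto
    also have "s * (K / real n) = K / s" using s(1) unfolding s(2)[symmetric] by simp
    finally show ?case using s by (simp add: s_def divide_right_mono)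
  qed
  have "(\<lambda>n. K / sqrt (real n)) \<longlonglongrightarrow> 0" by real_asymp
  then have "(\<lambda>n. (10 ^ 6 + 4096 * peel_const) * (ln (real n) ^ 4 / sqrt (real n)) + K / sqrt (real n))
      \<longlonglongrightarrow> (10 ^ 6 + 4096 * peel_const) * 0 + 0"
    by (intro tendsto_add tendsto_mult tendsto_const power_ln_over_sqrt)
  then show "(\<lambda>n. (10 ^ 6 + 4096 * peel_const) * (ln (real n) ^ 4 / sqrt (real n)) + K / sqrt (real n)) \<longlonglongrightarrow> 0"
    by simp
qed

lemma Z_tendsto: "Z \<longlonglongrightarrow> 1"
proof -
  have "(\<lambda>n. K / real n) \<longlonglongrightarrow> 0" by (rule lim_const_over_n)
  then have "(\<lambda>n. Z n - 1) \<longlonglongrightarrow> 0"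
    using Z by (intro Lim_null_comparison[of "\<lambda>n. Z n - 1"]) auto
  then show ?thesis by (simp add: LIM_zero_iff)
qed

lemma weight_clt:
  assumes "(\<lambda>n. measure_pmf.prob (\<mu> n) (S n)) \<longlonglongrightarrow> l"
  shows "(\<lambda>n. (\<Sum>f\<le>6 * n. indicator (S n) f * w n f) / Z n) \<longlonglongrightarrow> l"
proof -
  have "(\<lambda>n. \<Sum>f\<le>6 * n. indicator (S n) f * (pmf (\<mu> n) f - w n f)) \<longlonglongrightarrow> 0"
  proof (rule tendsto_sandwich[OF _ _ tendsto_const deficit_tendsto])
    show "eventually (\<lambda>n. 0 \<le> (\<Sum>f\<le>6 * n. indicator (S n) f * (pmf (\<mu> n) f - w n f))) sequentially"
      using w by (intro always_eventually allI sum_nonneg mult_nonneg_nonneg) auto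
    show "eventually (\<lambda>n. (\<Sum>f\<le>6 * n. indicator (S n) f * (pmf (\<mu> n) f - w n f))
        \<le> (\<Sum>f\<le>6 * n. pmf (\<mu> n) f - w n f)) sequentially"
      using w by (intro always_eventually allI sum_mono) (auto simp: indicator_def)
  qed
  then have "(\<lambda>n. measure_pmf.prob (\<mu> n) (S n) - (\<Sum>f\<le>6 * n. indicator (S n) f * (pmf (\<mu> n) f - w n f))) \<longlonglongrightarrow> l - 0"
    using assms by (intro tendsto_diff)
  moreover have "eventually (\<lambda>n. measure_pmf.prob (\<mu> n) (S n)
      - (\<Sum>f\<le>6 * n. indicator (S n) f * (pmf (\<mu> n) f - w n f)) = (\<Sum>f\<le>6 * n. indicator (S n) f * w n f)) sequentially"
    using eventually_ge_at_top[of 1]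
    by eventually_elim (simp add: prob_finite_sum[OF support_law] sum_subtractf right_diff_distrib)
  ultimately have "(\<lambda>n. \<Sum>f\<le>6 * n. indicator (S n) f * w n f) \<longlonglongrightarrow> l"
    by (simp add: Lim_transform_eventually)
  then show ?thesis using tendsto_divide[OF _ Z_tendsto] by fastforce
qed

text \<open>Moments are first centred at \<open>L\<close>. With mass \<open>W\<close> and centred
  moments \<open>A\<close> and \<open>B\<close>, the mean satisfies
  \<open>m - L = (A + L * (W - Z)) / Z\<close> and the variance is
  \<open>(B - 2 * (m - L) * A + (m - L) ^ 2 * W) / Z\<close>. \<open>Z\<close> is kept apart from
  \<open>W\<close> because the region distribution is normalised by a total over genera;
  \<open>W - Z\<close> is of order \<open>1 / n\<close>. The mean is controlled on the scale
  \<open>sqrt L\<close> because its squared error enters a variance of size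
  \<open>L\<close>.\<close>

lemma weight_moments:
  defines "L \<equiv> \<lambda>n. ln (real n)"
  defines "m \<equiv> \<lambda>n. (\<Sum>f\<le>6 * n. real f * w n f) / Z n"
  defines "v \<equiv> \<lambda>n. (\<Sum>f\<le>6 * n. (real f - m n)\<^sup>2 * w n f) / Z n"
  shows "(\<lambda>n. (m n - L n) / sqrt (L n)) \<longlonglongrightarrow> 0" "(\<lambda>n. v n / L n) \<longlonglongrightarrow> 1"
proof -
  define e where "e n f = pmf (\<mu> n) f - w n f" for n f
  define D where "D n = (\<Sum>f\<le>6 * n. e n f)" for n
  define W where "W n = (\<Sum>f\<le>6 * n. w n f)" for n
  define A where "A n = (\<Sum>f\<le>6 * n. (real f - L n) * w n f)" for n
  define B where "B n = (\<Sum>f\<le>6 * n. (real f - L n)\<^sup>2 * w n f)" for n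
  have e0: "0 \<le> e n f" for n f using w by (simp add: e_def)
  have D0: "D \<longlonglongrightarrow> 0"
  proof -
    have "D = (\<lambda>n. \<Sum>f\<le>6 * n. pmf (\<mu> n) f - w n f)" by (simp add: fun_eq_iff D_def e_def)
    then show ?thesis using deficit_tendsto by simp
  qed
  have Lev: "eventually (\<lambda>n. L n \<ge> 1 \<and> n \<ge> 3) sequentially"
  proof -
    have "eventually (\<lambda>n. L n \<ge> 1) sequentially"
      using filterlim_at_top[THEN iffD1, OF ln_nat_at_top] by (simp add: L_def)
    then show ?thesis using eventually_ge_at_top[of 3] by eventually_elim auto
  qed
  have Linf: "filterlim L at_top sequentially" unfolding L_def by (rule ln_nat_at_top)
  have sqinf: "filterlim (\<lambda>n. sqrt (L n)) at_top sequentially" unfolding L_def by (rule sqrt_ln_at_top)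
  have bnd0: "(\<lambda>n. c / sqrt (L n)) \<longlonglongrightarrow> 0" for c :: real
    by (rule tendsto_divide_0[OF tendsto_const]) (rule filterlim_at_top_imp_at_infinity[OF sqinf])
  have WD: "eventually (\<lambda>n. W n = 1 - D n) sequentially"
    using Lev
  proof eventually_elim
    case (elim n)
    have "(\<Sum>f\<le>6 * n. pmf (\<mu> n) f) = 1"
      using elim support_law[of n] by (intro sum_pmf_eq_1) auto
    then show ?case by (simp add: W_def D_def e_def sum_subtractf)
  qed
  have W1: "W \<longlonglongrightarrow> 1"
  proof (rule Lim_transform_eventually)
    have "(\<lambda>n. 1 - D n) \<longlonglongrightarrow> 1 - 0" by (intro tendsto_diff tendsto_const D0)
    then show "(\<lambda>n. 1 - D n) \<longlonglongrightarrow> 1" by simp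
    show "eventually (\<lambda>n. 1 - D n = W n) sequentially" using WD by eventually_elim simp
  qed
  have L2D: "(\<lambda>n. (L n)\<^sup>2 * D n) \<longlonglongrightarrow> 0"
  proof (rule tendsto_sandwich[OF _ _ tendsto_const])
    show "eventually (\<lambda>n. 0 \<le> (L n)\<^sup>2 * D n) sequentially"
      using e0 by (intro always_eventually allI) (simp add: D_def sum_nonneg)
    show "eventually (\<lambda>n. (L n)\<^sup>2 * D n \<le> (L n)\<^sup>2 * (K / real n)) sequentially"
      using deficit unfolding D_def e_def by eventually_elim (intro mult_left_mono zero_le_power2)
    show "(\<lambda>n. (L n)\<^sup>2 * (K / real n)) \<longlonglongrightarrow> 0" unfolding L_def by real_asymp
  qed
  have E2: "(\<lambda>n. \<Sum>f\<le>6 * n. (real f - L n)\<^sup>2 * e n f) \<longlonglongrightarrow> 0"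
  proof (rule tendsto_sandwich[OF _ _ tendsto_const])
    show "eventually (\<lambda>n. 0 \<le> (\<Sum>f\<le>6 * n. (real f - L n)\<^sup>2 * e n f)) sequentially"
      using e0 by (intro always_eventually allI sum_nonneg mult_nonneg_nonneg) auto
    have "(real f - L n)\<^sup>2 \<le> 2 * (real f)\<^sup>2 + 2 * (L n)\<^sup>2" for f n
      using zero_le_power2[of "real f + L n"] by (simp add: power2_eq_square algebra_simps)
    then have "(\<Sum>f\<le>6 * n. (real f - L n)\<^sup>2 * e n f) \<le> (\<Sum>f\<le>6 * n. (2 * (real f)\<^sup>2 + 2 * (L n)\<^sup>2) * e n f)" for n
      using e0 by (intro sum_mono mult_right_mono)
    then show "eventually (\<lambda>n. (\<Sum>f\<le>6 * n. (real f - L n)\<^sup>2 * e n f)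
        \<le> 2 * (\<Sum>f\<le>6 * n. (real f)\<^sup>2 * e n f) + 2 * ((L n)\<^sup>2 * D n)) sequentially"
      by (intro always_eventually allI) (simp add: D_def distrib_right sum.distrib sum_distrib_left mult.assoc)
    show "(\<lambda>n. 2 * (\<Sum>f\<le>6 * n. (real f)\<^sup>2 * e n f) + 2 * ((L n)\<^sup>2 * D n)) \<longlonglongrightarrow> 0"
      using tendsto_add[OF tendsto_mult[OF tendsto_const[of 2] second_moment_deficit]
          tendsto_mult[OF tendsto_const[of 2] L2D]] by (simp add: e_def)
  qed
  have E1: "(\<lambda>n. \<Sum>f\<le>6 * n. (real f - L n) * e n f) \<longlonglongrightarrow> 0"
  proof (rule tendsto_rabs_zero_cancel, rule tendsto_sandwich[OF _ _ tendsto_const])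
    have "\<bar>x\<bar> \<le> x\<^sup>2 + 1" for x :: real
      using zero_le_power2[of "\<bar>x\<bar> - 1"] by (simp add: power2_eq_square algebra_simps)
    then have "\<bar>real f - L n\<bar> * e n f \<le> ((real f - L n)\<^sup>2 + 1) * e n f" for f n
      using e0 by (intro mult_right_mono)
    then have "(\<Sum>f\<le>6 * n. \<bar>(real f - L n) * e n f\<bar>) \<le> (\<Sum>f\<le>6 * n. ((real f - L n)\<^sup>2 + 1) * e n f)" for n
      using e0 by (intro sum_mono) (simp add: abs_mult)
    then have "\<bar>\<Sum>f\<le>6 * n. (real f - L n) * e n f\<bar> \<le> (\<Sum>f\<le>6 * n. ((real f - L n)\<^sup>2 + 1) * e n f)" for n
      by (rule order_trans[OF sum_abs])
    then show "eventually (\<lambda>n. \<bar>\<Sum>f\<le>6 * n. (real f - L n) * e n f\<bar>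
        \<le> (\<Sum>f\<le>6 * n. (real f - L n)\<^sup>2 * e n f) + D n) sequentially"
      by (intro always_eventually allI) (simp add: D_def distrib_right sum.distrib)
    show "(\<lambda>n. (\<Sum>f\<le>6 * n. (real f - L n)\<^sup>2 * e n f) + D n) \<longlonglongrightarrow> 0"
      using tendsto_add[OF E2 D0] by simp
  qed simp
  have A: "(\<lambda>n. A n / sqrt (L n)) \<longlonglongrightarrow> 0"
  proof -
    define a where "a n = expect (\<mu> n) real - L n" for n
    have "(\<lambda>n. a n / sqrt (L n)) \<longlonglongrightarrow> 0"
    proof (rule Lim_null_comparison[OF _ bnd0[of "4 + 2 * peel_const"]])
      show "eventually (\<lambda>n. norm (a n / sqrt (L n)) \<le> (4 + 2 * peel_const) / sqrt (L n)) sequentially"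
        using Lev
      proof eventually_elim
        case (elim n)
        have "\<bar>a n\<bar> \<le> 4 + 2 * peel_const" unfolding a_def L_def using elim by (intro law_mean_bound[OF law]) auto
        then show ?case using elim by (simp add: divide_right_mono)
      qed
    qed
    moreover have "(\<lambda>n. (\<Sum>f\<le>6 * n. (real f - L n) * e n f) * (1 / sqrt (L n))) \<longlonglongrightarrow> 0 * 0"
      by (intro tendsto_mult E1 bnd0)
    ultimately have "(\<lambda>n. a n / sqrt (L n) - (\<Sum>f\<le>6 * n. (real f - L n) * e n f) * (1 / sqrt (L n))) \<longlonglongrightarrow> 0 - 0 * 0"
      by (rule tendsto_diff)
    moreover have "eventually (\<lambda>n. a n / sqrt (L n) - (\<Sum>f\<le>6 * n. (real f - L n) * e n f) * (1 / sqrt (L n))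
        = A n / sqrt (L n)) sequentially"
      using Lev WD
    proof eventually_elim
      case (elim n)
      have s: "set_pmf (\<mu> n) \<subseteq> {..6 * n}" using elim support_law[of n] by simp
      have "(\<Sum>f\<le>6 * n. pmf (\<mu> n) f) = 1" using s by (intro sum_pmf_eq_1) auto
      then have "a n = (\<Sum>f\<le>6 * n. (real f - L n) * pmf (\<mu> n) f)"
        unfolding a_def expectation_finite_sum[OF s] by (simp add: left_diff_distrib sum_subtractf flip: sum_distrib_left)
      then have "A n = a n - (\<Sum>f\<le>6 * n. (real f - L n) * e n f)"
        by (simp add: A_def e_def right_diff_distrib sum_subtractf)
      then show ?case by (simp add: diff_divide_distrib)
    qed
    ultimately show ?thesis by (simp add: Lim_transform_eventually)
  qed
  have B: "(\<lambda>n. B n / L n) \<longlonglongrightarrow> 1"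
  proof -
    define b where "b n = expect (\<mu> n) (\<lambda>f. (real f - L n)\<^sup>2)" for n
    have "(\<lambda>n. b n / L n - 1) \<longlonglongrightarrow> 0"
    proof (rule Lim_null_comparison[OF _ bnd0[of "40 + 40 * peel_const"]])
      show "eventually (\<lambda>n. norm (b n / L n - 1) \<le> (40 + 40 * peel_const) / sqrt (L n)) sequentially"
        using Lev
      proof eventually_elim
        case (elim n)
        then have L: "L n > 0" by simp
        have "\<bar>b n - L n\<bar> \<le> (40 + 40 * peel_const) * sqrt (L n)"
          unfolding b_def L_def using elim by (intro law_second_moment_bound[OF law]) auto
        then have "\<bar>b n - L n\<bar> / L n \<le> (40 + 40 * peel_const) * sqrt (L n) / L n"
          using L by (intro divide_right_mono) auto
        also have "\<dots> = (40 + 40 * peel_const) / sqrt (L n)"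
        proof -
          have "c * s / (s * s) = c / s" if "s > 0" for c s :: real using that by simp
          from this[of "sqrt (L n)" "40 + 40 * peel_const"] show ?thesis using L by simp
        qed
        also have "\<bar>b n - L n\<bar> / L n = \<bar>b n / L n - 1\<bar>" 
        proof -
          have "b n / L n - 1 = (b n - L n) / L n" using L by (simp add: diff_divide_distrib)
          then show ?thesis using L by (simp add: abs_divide)
        qed
        finally show ?case by simp
      qed
    qed
    then have b1: "(\<lambda>n. b n / L n) \<longlonglongrightarrow> 1" by (simp add: LIM_zero_iff)
    have "(\<lambda>n. (\<Sum>f\<le>6 * n. (real f - L n)\<^sup>2 * e n f) / L n) \<longlonglongrightarrow> 0"
      using E2 by (rule tendsto_divide_0) (rule filterlim_at_top_imp_at_infinity[OF Linf])
    with b1 have "(\<lambda>n. b n / L n - (\<Sum>f\<le>6 * n. (real f - L n)\<^sup>2 * e n f) / L n) \<longlonglongrightarrow> 1 - 0"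
      by (rule tendsto_diff)
    moreover have "eventually (\<lambda>n. b n / L n - (\<Sum>f\<le>6 * n. (real f - L n)\<^sup>2 * e n f) / L n = B n / L n) sequentially"
      using Lev
    proof eventually_elim
      case (elim n)
      have s: "set_pmf (\<mu> n) \<subseteq> {..6 * n}" using elim support_law[of n] by simp
      have "B n = b n - (\<Sum>f\<le>6 * n. (real f - L n)\<^sup>2 * e n f)"
        unfolding b_def expectation_finite_sum[OF s] by (simp add: B_def e_def right_diff_distrib sum_subtractf)
      then show ?case by (simp add: diff_divide_distrib)
    qed
    ultimately show ?thesis by (simp add: Lim_transform_eventually)
  qed
  have aZ: "(\<lambda>n. 1 / Z n) \<longlonglongrightarrow> 1" using tendsto_divide[OF tendsto_const[of 1] Z_tendsto] by simp
  have Zpos: "eventually (\<lambda>n. Z n > 0) sequentially"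
    using order_tendstoD(1)[OF Z_tendsto, of 0] by simp
  have LWZ: "(\<lambda>n. sqrt (L n) * (W n - Z n)) \<longlonglongrightarrow> 0"
  proof (rule Lim_null_comparison)
    show "eventually (\<lambda>n. norm (sqrt (L n) * (W n - Z n)) \<le> sqrt (L n) * (2 * (K / real n))) sequentially"
      using Lev WD Z deficit
    proof eventually_elim
      case (elim n)
      have "0 \<le> D n" using e0 by (simp add: D_def sum_nonneg)
      then have "\<bar>W n - Z n\<bar> \<le> 2 * (K / real n)" using elim by (simp add: D_def e_def abs_le_iff)
      then have "sqrt (L n) * \<bar>W n - Z n\<bar> \<le> sqrt (L n) * (2 * (K / real n))"
        using elim by (intro mult_left_mono) auto
      moreover have "norm (sqrt (L n) * (W n - Z n)) = sqrt (L n) * \<bar>W n - Z n\<bar>"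
        using elim by (simp only: real_norm_def abs_mult) simp
      ultimately show ?case by linarith
    qed
    show "(\<lambda>n. sqrt (L n) * (2 * (K / real n))) \<longlonglongrightarrow> 0" unfolding L_def by real_asymp
  qed
  have mL: "eventually (\<lambda>n. (m n - L n) / sqrt (L n)
      = 1 / Z n * (A n / sqrt (L n) + sqrt (L n) * (W n - Z n))) sequentially"
    using Lev Zpos
  proof eventually_elim
    case (elim n)
    have sq: "sqrt (L n) * sqrt (L n) = L n" "sqrt (L n) > 0" using elim by simp_all
    have "A n = (\<Sum>f\<le>6 * n. real f * w n f) - L n * W n"
      by (simp add: A_def W_def left_diff_distrib sum_subtractf sum_distrib_left)
    then have "m n - L n = 1 / Z n * (A n + L n * (W n - Z n))"
      using elim by (simp add: m_def field_simps)
    then have "(m n - L n) / sqrt (L n) = 1 / Z n * (A n / sqrt (L n) + L n * (W n - Z n) / sqrt (L n))"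
      by (simp add: add_divide_distrib mult.commute)
    also have "L n * (W n - Z n) / sqrt (L n) = sqrt (L n) * (W n - Z n)"
      using sq by (metis (no_types, lifting) less_irrefl mult.assoc nonzero_mult_div_cancel_left)
    finally show ?case .
  qed
  show m: "(\<lambda>n. (m n - L n) / sqrt (L n)) \<longlonglongrightarrow> 0"
  proof (rule Lim_transform_eventually)
    have "(\<lambda>n. 1 / Z n * (A n / sqrt (L n) + sqrt (L n) * (W n - Z n))) \<longlonglongrightarrow> 1 * (0 + 0)"
      by (intro tendsto_mult tendsto_add aZ A LWZ)
    then show "(\<lambda>n. 1 / Z n * (A n / sqrt (L n) + sqrt (L n) * (W n - Z n))) \<longlonglongrightarrow> 0" by simp
    show "eventually (\<lambda>n. 1 / Z n * (A n / sqrt (L n) + sqrt (L n) * (W n - Z n))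
        = (m n - L n) / sqrt (L n)) sequentially"
      using mL by eventually_elim simp
  qed
  have "(\<lambda>n. 1 / Z n * (B n / L n - 2 * ((m n - L n) / sqrt (L n)) * (A n / sqrt (L n))
      + ((m n - L n) / sqrt (L n))\<^sup>2 * W n)) \<longlonglongrightarrow> 1 * (1 - 2 * 0 * 0 + 0\<^sup>2 * 1)"
    by (intro tendsto_intros aZ B m A W1)
  moreover have "eventually (\<lambda>n. 1 / Z n * (B n / L n - 2 * ((m n - L n) / sqrt (L n)) * (A n / sqrt (L n))
      + ((m n - L n) / sqrt (L n))\<^sup>2 * W n) = v n / L n) sequentially"
    using Lev
  proof eventually_elim
    case (elim n)
    have sq: "sqrt (L n) * sqrt (L n) = L n" "(sqrt (L n))\<^sup>2 = L n" using elim by simp_all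
    have sq_shift: "(x - y)\<^sup>2 * u = (x - l)\<^sup>2 * u - (2 * (y - l)) * ((x - l) * u) + (y - l)\<^sup>2 * u" for x y l u :: real
      by (simp add: power2_eq_square algebra_simps)
    have "(\<Sum>f\<le>6 * n. (real f - m n)\<^sup>2 * w n f) = (\<Sum>f\<le>6 * n. (real f - L n)\<^sup>2 * w n f
        - (2 * (m n - L n)) * ((real f - L n) * w n f) + (m n - L n)\<^sup>2 * w n f)"
      by (intro sum.cong refl sq_shift)
    also have "\<dots> = B n - 2 * (m n - L n) * A n + (m n - L n)\<^sup>2 * W n"
      unfolding A_def B_def W_def sum.distrib sum_subtractf sum_distrib_left ..
    finally have "(\<Sum>f\<le>6 * n. (real f - m n)\<^sup>2 * w n f) = B n - 2 * (m n - L n) * A n + (m n - L n)\<^sup>2 * W n" .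
    then have "v n / L n = 1 / Z n * ((B n - 2 * (m n - L n) * A n + (m n - L n)\<^sup>2 * W n) / L n)"
      by (simp add: v_def)
    also have "(B n - 2 * (m n - L n) * A n + (m n - L n)\<^sup>2 * W n) / L n
        = B n / L n - 2 * ((m n - L n) / sqrt (L n)) * (A n / sqrt (L n)) + ((m n - L n) / sqrt (L n))\<^sup>2 * W n"
    proof -
      have "(b - 2 * x * y + x\<^sup>2 * z) / (s * s) = b / (s * s) - 2 * (x / s) * (y / s) + (x / s)\<^sup>2 * z"
        for b x y z s :: real
        by (simp add: diff_divide_distrib add_divide_distrib power2_eq_square)
      from this[of "B n" "m n - L n" "A n" "W n" "sqrt (L n)"] show ?thesis unfolding sq(1) .
    qed
    finally show ?case by simp
  qed
  ultimately show "(\<lambda>n. v n / L n) \<longlonglongrightarrow> 1" by (simp add: Lim_transform_eventually)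
qed

end

section \<open>Genus and region distributions\<close>

definition faces :: "nat \<Rightarrow> (nat \<Rightarrow> nat) \<times> (nat \<Rightarrow> nat) \<Rightarrow> nat" where
  "faces n = (\<lambda>(\<alpha>, \<beta>). ncyc (\<alpha> \<circ> \<beta>) {..<6 * n})"

definition conn :: "nat \<Rightarrow> ((nat \<Rightarrow> nat) \<times> (nat \<Rightarrow> nat)) set" where
  "conn n = {(\<alpha>, \<beta>). connected_pair {..<6 * n} \<alpha> \<beta>}"

definition conn_weight :: "nat \<Rightarrow> nat \<Rightarrow> real" where
  "conn_weight n f = measure_pmf.prob (pmf_of_set (pairs n)) (conn n \<inter> {\<omega>. faces n \<omega> = f})"

text \<open>Only \<open>f \<le> n + 2\<close> allows a natural number \<open>g\<close> with
  \<open>f + 2 * g = n + 2\<close>; the mass beyond that is bounded in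
  \<open>genus_deficit\<close>.\<close>

definition genus_weight :: "nat \<Rightarrow> nat \<Rightarrow> real" where
  "genus_weight n f = (if f \<le> n + 2 then conn_weight n f else 0)"

definition genus_total :: "nat \<Rightarrow> real" where
  "genus_total n = (\<Sum>f\<le>6 * n. genus_weight n f)"

text \<open>Turns probabilities of labelled pairs into numbers of rooted maps: \<open>6 * n\<close>
  roots per pair and \<open>(6 * n)!\<close> labellings per class. The factor cancels in both
  distributions.\<close>

definition map_scale :: "nat \<Rightarrow> real" where
  "map_scale n = real (6 * n * card (pairs n)) / fact (6 * n)"

lemma map_scale_pos: "n \<ge> 1 \<Longrightarrow> map_scale n > 0"
  by (simp add: map_scale_def card_gt_0_iff)

lemma face_law_faces: "face_law n = map_pmf (faces n) (pmf_of_set (pairs n))"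
  by (simp add: face_law_def faces_def)

lemma conn_weight_card:
  "conn_weight n f = real (card (conn_pairs n (\<lambda>x. x = f))) / real (card (pairs n))"
proof -
  have "pairs n \<inter> (conn n \<inter> {\<omega>. faces n \<omega> = f}) = conn_pairs n (\<lambda>x. x = f)"
    by (auto simp: conn_pairs_def conn_def faces_def)
  then show ?thesis by (simp add: conn_weight_def measure_pmf_of_set)
qed

lemma scale_count:
  assumes "c * fact (6 * n) = 6 * n * k"
  shows "real c = map_scale n * (real k / real (card (pairs n)))"
proof -
  have "real c * fact (6 * n) = real (6 * n) * real k"
    using arg_cong[OF assms, of real] by simp
  moreover have "card (pairs n) > 0" by (simp add: card_gt_0_iff)
  ultimately show ?thesis by (simp add: map_scale_def field_simps)
qed

lemma cubic_face_count_weight: "real (cubic_face_count n f) = map_scale n * conn_weight n f"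
  unfolding conn_weight_card by (rule scale_count[OF cubic_face_count_pairs])

lemma cubic_genus_count_weight:
  "real (cubic_genus_count n g)
    = map_scale n * (if 2 * g \<le> n + 2 then conn_weight n (n + 2 - 2 * g) else 0)"
proof -
  let ?S = "conn_pairs n (\<lambda>x. x + 2 * g = n + 2)"
  have c: "real (cubic_genus_count n g) = map_scale n * (real (card ?S) / real (card (pairs n)))"
    by (rule scale_count[OF cubic_genus_count_pairs])
  show ?thesis
  proof (cases "2 * g \<le> n + 2")
    case True
    then have "?S = conn_pairs n (\<lambda>x. x = n + 2 - 2 * g)" by (auto simp: conn_pairs_def)
    then show ?thesis unfolding c conn_weight_card using True by simp
  next
    case False
    then have "?S = {}" by (auto simp: conn_pairs_def)
    then show ?thesis unfolding c using False by simp
  qed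
qed

lemma conn_weight_nonneg: "0 \<le> conn_weight n f"
  by (simp add: conn_weight_def)

lemma pmf_face_law: "pmf (face_law n) f = measure_pmf.prob (pmf_of_set (pairs n)) {\<omega>. faces n \<omega> = f}"
  unfolding face_law_faces pmf_map by (simp add: vimage_def)

lemma conn_weight_le: "conn_weight n f \<le> pmf (face_law n) f"
  unfolding conn_weight_def pmf_face_law by (intro measure_pmf.finite_measure_mono) auto

lemma pmf_face_law_diff:
  "pmf (face_law n) f - conn_weight n f
    = measure_pmf.prob (pmf_of_set (pairs n)) ((- conn n) \<inter> {\<omega>. faces n \<omega> = f})"
proof -
  have "{\<omega>. faces n \<omega> = f} = (conn n \<inter> {\<omega>. faces n \<omega> = f}) \<union> ((- conn n) \<inter> {\<omega>. faces n \<omega> = f})" by auto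
  then have "pmf (face_law n) f = measure_pmf.prob (pmf_of_set (pairs n))
      ((conn n \<inter> {\<omega>. faces n \<omega> = f}) \<union> ((- conn n) \<inter> {\<omega>. faces n \<omega> = f}))"
    unfolding pmf_face_law by simp
  also have "\<dots> = conn_weight n f + measure_pmf.prob (pmf_of_set (pairs n)) ((- conn n) \<inter> {\<omega>. faces n \<omega> = f})"
    unfolding conn_weight_def by (rule measure_pmf.finite_measure_Union) auto
  finally show ?thesis by simp
qed

lemma conn_deficit:
  assumes "n \<ge> 2"
  shows "(\<Sum>f\<le>6 * n. pmf (face_law n) f - conn_weight n f) \<le> 10 / real n"
proof -
  have "(\<Sum>f\<le>6 * n. pmf (face_law n) f - conn_weight n f)
      = measure_pmf.prob (pmf_of_set (pairs n)) (\<Union>f\<le>6 * n. (- conn n) \<inter> {\<omega>. faces n \<omega> = f})"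
    unfolding pmf_face_law_diff
    by (intro measure_pmf.finite_measure_finite_Union[symmetric]) (auto simp: disjoint_family_on_def)
  also have "\<dots> \<le> measure_pmf.prob (pmf_of_set (pairs n)) {(\<alpha>, \<beta>). \<not> connected_pair {..<6 * n} \<alpha> \<beta>}"
    by (intro measure_pmf.finite_measure_mono) (auto simp: conn_def)
  also have "\<dots> \<le> 10 / real n" by (rule prob_disconnected[OF assms])
  finally show ?thesis .
qed

lemma face_law_support:
  assumes "n \<ge> 1" shows "set_pmf (face_law n) \<subseteq> {..6 * n}"
  using face_law_peel_law[OF assms] by (simp add: peel_law_def)

lemma conn_weight_nonzeroD:
  assumes "conn_weight n f \<noteq> 0"
  obtains \<alpha> \<beta> where "(\<alpha>, \<beta>) \<in> pairs n" "f = ncyc (\<alpha> \<circ> \<beta>) {..<6 * n}"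
proof -
  have "conn_pairs n (\<lambda>x. x = f) \<noteq> {}"
    using assms unfolding conn_weight_card by (metis card.empty div_0 of_nat_0)
  then obtain \<omega> where "\<omega> \<in> conn_pairs n (\<lambda>x. x = f)" by blast
  then show ?thesis using that by (cases \<omega>) (auto simp: conn_pairs_def)
qed

lemma conn_weight_parity: "conn_weight n f \<noteq> 0 \<Longrightarrow> even f \<longleftrightarrow> even n"
  using parity_ncyc_pair by (elim conn_weight_nonzeroD) simp

lemma conn_weight_support:
  assumes "n \<ge> 1" "conn_weight n f \<noteq> 0" shows "1 \<le> f" "f \<le> 6 * n"
proof -
  obtain \<alpha> \<beta> :: "nat \<Rightarrow> nat" where f: "f = ncyc (\<alpha> \<circ> \<beta>) {..<6 * n}"
    using assms(2) by (rule conn_weight_nonzeroD)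
  have "orbit (\<alpha> \<circ> \<beta>) ` {..<6 * n} \<noteq> {}" using assms(1) by (auto simp: lessThan_empty_iff)
  then show "1 \<le> f" unfolding f ncyc_def by (simp add: Suc_le_eq card_gt_0_iff)
  show "f \<le> 6 * n" unfolding f using ncyc_le_card[of "{..<6 * n}"] by simp
qed

lemma genus_weight_bounds: "0 \<le> genus_weight n f" "genus_weight n f \<le> pmf (face_law n) f"
  using conn_weight_nonneg conn_weight_le by (auto simp: genus_weight_def)

text \<open>Disconnected pairs cost \<open>10 / n\<close>. Face counts above \<open>n + 2\<close>
  are handled by Markov's inequality for the fourth moment: they carry at most a constant times
  \<open>ln n ^ 4 / n ^ 4\<close>, which is eventually below \<open>1 / n\<close>.\<close>

lemma genus_deficit:
  "eventually (\<lambda>n. (\<Sum>f\<le>6 * n. pmf (face_law n) f - genus_weight n f) \<le> 11 / real n) sequentially"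
proof -
  define C where "C = 10 ^ 6 + 4096 * peel_const"
  have "(\<lambda>n. ln (real n) ^ 4 / real n ^ 3) \<longlonglongrightarrow> 0" by real_asymp
  then have "(\<lambda>n. C * (ln (real n) ^ 4 / real n ^ 3)) \<longlonglongrightarrow> C * 0" by (intro tendsto_mult tendsto_const)
  then have "eventually (\<lambda>n. C * (ln (real n) ^ 4 / real n ^ 3) < 1) sequentially"
    by (intro order_tendstoD(2)) auto
  then show ?thesis using eventually_ge_at_top[of 3]
  proof eventually_elim
    case (elim n)
    have n: "real n > 0" using elim by simp
    have "pmf (face_law n) f - genus_weight n f
        \<le> (pmf (face_law n) f - conn_weight n f) + real f ^ 4 * pmf (face_law n) f / real n ^ 4" for f
    proof (cases "f \<le> n + 2")
      case True
      then show ?thesis by (simp add: genus_weight_def)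
    next
      case False
      then have "real n ^ 4 \<le> real f ^ 4" by (intro power_mono) auto
      then have "pmf (face_law n) f * real n ^ 4 \<le> pmf (face_law n) f * real f ^ 4"
        by (intro mult_left_mono) auto
      then have "pmf (face_law n) f \<le> real f ^ 4 * pmf (face_law n) f / real n ^ 4"
        using n by (simp add: le_divide_eq mult.commute)
      then show ?thesis using False conn_weight_le[of n f] by (simp add: genus_weight_def)
    qed
    then have "(\<Sum>f\<le>6 * n. pmf (face_law n) f - genus_weight n f)
        \<le> (\<Sum>f\<le>6 * n. (pmf (face_law n) f - conn_weight n f) + real f ^ 4 * pmf (face_law n) f / real n ^ 4)"
      by (intro sum_mono)
    also have "\<dots> = (\<Sum>f\<le>6 * n. pmf (face_law n) f - conn_weight n f)
        + (\<Sum>f\<le>6 * n. real f ^ 4 * pmf (face_law n) f) / real n ^ 4"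
      unfolding sum.distrib sum_divide_distrib ..
    also have "(\<Sum>f\<le>6 * n. real f ^ 4 * pmf (face_law n) f) = expect (face_law n) (\<lambda>f. real f ^ 4)"
      using elim by (intro expectation_finite_sum[symmetric] face_law_support) auto
    also have "\<dots> \<le> C * ln (real n) ^ 4"
      unfolding C_def using elim by (intro law_fourth_moment_bound face_law_peel_law) auto
    also have "C * ln (real n) ^ 4 / real n ^ 4 = C * (ln (real n) ^ 4 / real n ^ 3) / real n"
      using n by (simp add: power_numeral_reduce)
    also have "\<dots> \<le> 1 / real n" using elim n by (intro divide_right_mono) auto
    also have "(\<Sum>f\<le>6 * n. pmf (face_law n) f - conn_weight n f) \<le> 10 / real n"
      using elim by (intro conn_deficit) auto
    finally show ?case using n by (simp add: divide_right_mono add_divide_distrib[symmetric])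
  qed
qed

lemma genus_total_bound:
  "eventually (\<lambda>n. \<bar>genus_total n - 1\<bar> \<le> 11 / real n) sequentially"
  using genus_deficit eventually_ge_at_top[of 1]
proof eventually_elim
  case (elim n)
  have "(\<Sum>f\<le>6 * n. pmf (face_law n) f) = 1"
    using elim by (intro sum_pmf_eq_1 face_law_support) auto
  then have "(\<Sum>f\<le>6 * n. pmf (face_law n) f - genus_weight n f) = 1 - genus_total n"
    by (simp add: genus_total_def sum_subtractf)
  moreover have "0 \<le> (\<Sum>f\<le>6 * n. pmf (face_law n) f - genus_weight n f)"
    using genus_weight_bounds by (intro sum_nonneg) simp
  ultimately show ?case using elim by simp
qed

section \<open>From faces to genus\<close>

lemma sum_genus_weight:
  assumes "n \<ge> 1"
  shows "(\<Sum>g\<le>n + 2. \<psi> g * (if 2 * g \<le> n + 2 then conn_weight n (n + 2 - 2 * g) else 0))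
    = (\<Sum>f\<le>6 * n. \<psi> ((n + 2 - f) div 2) * genus_weight n f)"
proof -
  let ?G = "{g. 2 * g \<le> n + 2}" and ?F = "{f. f \<le> n + 2 \<and> even (n + 2 - f)}"
  have "(\<Sum>g\<le>n + 2. \<psi> g * (if 2 * g \<le> n + 2 then conn_weight n (n + 2 - 2 * g) else 0))
      = (\<Sum>g\<in>?G. \<psi> g * conn_weight n (n + 2 - 2 * g))"
    by (intro sum.mono_neutral_cong_right) auto
  also have "\<dots> = (\<Sum>f\<in>?F. \<psi> ((n + 2 - f) div 2) * conn_weight n f)"
    by (rule sum.reindex_bij_witness[where j = "\<lambda>g. n + 2 - 2 * g" and i = "\<lambda>f. (n + 2 - f) div 2"])
      (auto elim!: evenE)
  also have "\<dots> = (\<Sum>f\<le>6 * n. \<psi> ((n + 2 - f) div 2) * genus_weight n f)"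
  proof (rule sum.mono_neutral_cong_left)
    show "?F \<subseteq> {..6 * n}" using assms by auto
    show "\<forall>f\<in>{..6 * n} - ?F. \<psi> ((n + 2 - f) div 2) * genus_weight n f = 0"
      using conn_weight_parity by (auto simp: genus_weight_def) 
  qed (auto simp: genus_weight_def)
  finally show ?thesis .
qed

lemma cubic_genus_count_zero: "n + 2 < 2 * g \<Longrightarrow> cubic_genus_count n g = 0"
  using cubic_genus_count_weight[of n g] by simp

lemma suminf_genus:
  assumes "n \<ge> 1"
  shows "(\<Sum>g. \<psi> g * real (cubic_genus_count n g))
    = map_scale n * (\<Sum>f\<le>6 * n. \<psi> ((n + 2 - f) div 2) * genus_weight n f)"
proof -
  have "(\<Sum>g. \<psi> g * real (cubic_genus_count n g)) = (\<Sum>g\<le>n + 2. \<psi> g * real (cubic_genus_count n g))"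
    by (rule suminf_finite) (auto simp: cubic_genus_count_zero)
  also have "\<dots> = map_scale n * (\<Sum>g\<le>n + 2. \<psi> g * (if 2 * g \<le> n + 2 then conn_weight n (n + 2 - 2 * g) else 0))"
    unfolding cubic_genus_count_weight sum_distrib_left by (intro sum.cong refl) (simp only: mult.left_commute)
  finally show ?thesis unfolding sum_genus_weight[OF assms] .
qed

lemma cubic_count_total: "n \<ge> 1 \<Longrightarrow> cubic_count n = map_scale n * genus_total n"
  using suminf_genus[of n "\<lambda>_. 1"] by (simp add: cubic_count_def genus_total_def)

lemma suminf_genus_distribution:
  assumes "n \<ge> 1"
  shows "(\<Sum>g. \<psi> g * genus_distribution n g)
    = (\<Sum>f\<le>6 * n. \<psi> ((n + 2 - f) div 2) * genus_weight n f) / genus_total n"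
proof -
  have "(\<Sum>g. \<psi> g * genus_distribution n g) = (\<Sum>g. \<psi> g / cubic_count n * real (cubic_genus_count n g))"
    by (simp add: genus_distribution_def)
  also have "\<dots> = map_scale n * (\<Sum>f\<le>6 * n. \<psi> ((n + 2 - f) div 2) / cubic_count n * genus_weight n f)"
    by (rule suminf_genus[OF assms])
  also have "\<dots> = map_scale n * ((\<Sum>f\<le>6 * n. \<psi> ((n + 2 - f) div 2) * genus_weight n f) / cubic_count n)"
    by (simp add: sum_divide_distrib)
  finally show ?thesis using map_scale_pos[OF assms] by (simp add: cubic_count_total[OF assms])
qed

lemma region_distribution_weight:
  assumes "n \<ge> 1" shows "region_distribution n f = conn_weight n f / genus_total n"
  using map_scale_pos[OF assms]
  by (simp add: region_distribution_def cubic_face_count_weight cubic_count_total[OF assms])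

lemma suminf_region_distribution:
  assumes "n \<ge> 1"
  shows "(\<Sum>f. \<psi> f * region_distribution n f) = (\<Sum>f\<le>6 * n. \<psi> f * conn_weight n f) / genus_total n"
proof -
  have "(\<Sum>f. \<psi> f * region_distribution n f) = (\<Sum>f\<le>6 * n. \<psi> f * region_distribution n f)"
    using conn_weight_support[OF assms]
    by (intro suminf_finite) (auto simp: region_distribution_weight[OF assms])
  then show ?thesis by (simp add: region_distribution_weight[OF assms] sum_divide_distrib)
qed

text \<open>Where the weight is nonzero, the bound on \<open>f\<close> and the parity make the
  truncated subtraction and the integer division exact.\<close>

lemma sum_genus_weight_half:
  "(\<Sum>f\<le>6 * n. \<phi> (real ((n + 2 - f) div 2)) * genus_weight n f)
    = (\<Sum>f\<le>6 * n. \<phi> ((real n + 2 - real f) / 2) * genus_weight n f)"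
proof (rule sum.cong[OF refl])
  fix f
  show "\<phi> (real ((n + 2 - f) div 2)) * genus_weight n f = \<phi> ((real n + 2 - real f) / 2) * genus_weight n f"
  proof (cases "genus_weight n f = 0")
    case False
    then have "f \<le> n + 2" "conn_weight n f \<noteq> 0" by (auto simp: genus_weight_def split: if_splits)
    then have "f \<le> n + 2" "even (n + 2 - f)" using conn_weight_parity[of n f] by auto
    then have "real ((n + 2 - f) div 2) = (real n + 2 - real f) / 2"
      by (subst real_of_nat_div) (auto simp: of_nat_diff)
    then show ?thesis by (simp only:)
  qed simp
qed

lemma finite_real_le: "finite {k::nat. real k \<le> x}"
proof (rule finite_subset)
  show "{k::nat. real k \<le> x} \<subseteq> {..nat \<lfloor>x\<rfloor>}" by (auto simp: le_nat_floor)
qed simp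

theorem theorem1:
  shows
    "(((\<lambda>n. distribution_mean (genus_distribution n))
        \<sim>[sequentially] (\<lambda>n. (real n - ln (real n)) / 2)) \<and>
     ((\<lambda>n. distribution_variance (genus_distribution n))
        \<sim>[sequentially] (\<lambda>n. ln (real n) / 4)) \<and>
     (\<forall>t::real.
        (\<lambda>n. \<Sum>g | real g \<le> (real n - ln (real n)) / 2 + t * sqrt (ln (real n)) / 2.
               genus_distribution n g)
        \<longlonglongrightarrow> 1 / sqrt (2 * pi) * (LBINT x:{..t}. exp (- (x\<^sup>2) / 2)))) \<and>
     (((\<lambda>n. distribution_mean (region_distribution n))
        \<sim>[sequentially] (\<lambda>n. ln (real n))) \<and>
     ((\<lambda>n. distribution_variance (region_distribution n))
        \<sim>[sequentially] (\<lambda>n. ln (real n))) \<and>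
     (\<forall>t::real.
        (\<lambda>n. \<Sum>f | 1 \<le> f \<and> real f \<le> ln (real n) + t * sqrt (ln (real n)).
               region_distribution n f)
        \<longlonglongrightarrow> 1 / sqrt (2 * pi) * (LBINT x:{..t}. exp (- (x\<^sup>2) / 2))))"
proof -
  define L where "L n = ln (real n)" for n
  have cd: "eventually (\<lambda>n. (\<Sum>f\<le>6 * n. pmf (face_law n) f - conn_weight n f) \<le> 11 / real n) sequentially"
    using eventually_ge_at_top[of 2]
  proof eventually_elim
    case (elim n)
    then show ?case using conn_deficit[OF elim] by (simp add: divide_right_mono order_trans)
  qed
  define mr where "mr n = (\<Sum>f\<le>6 * n. real f * conn_weight n f) / genus_total n" for n
  define vr where "vr n = (\<Sum>f\<le>6 * n. (real f - mr n)\<^sup>2 * conn_weight n f) / genus_total n" for n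
  define mg where "mg n = (\<Sum>f\<le>6 * n. real f * genus_weight n f) / genus_total n" for n
  define vg where "vg n = (\<Sum>f\<le>6 * n. (real f - mg n)\<^sup>2 * genus_weight n f) / genus_total n" for n
  \<comment> \<open>Both distributions are perturbations of \<open>face_law\<close> with the same
    normaliser \<open>genus_total\<close>; only the weights differ.\<close>
  note wr = weight_moments[OF face_law_peel_law conn_weight_nonneg conn_weight_le cd genus_total_bound,
      folded mr_def, folded vr_def, folded L_def]
  note wg = weight_moments[OF face_law_peel_law genus_weight_bounds genus_deficit genus_total_bound,
      folded mg_def, folded vg_def, folded L_def]
  note cr = weight_clt[OF face_law_peel_law conn_weight_nonneg conn_weight_le cd genus_total_bound]
  note cg = weight_clt[OF face_law_peel_law genus_weight_bounds genus_deficit genus_total_bound]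
  have Lev: "eventually (\<lambda>n. L n \<ge> 1 \<and> n \<ge> 3) sequentially"
  proof -
    have "eventually (\<lambda>n. L n \<ge> 1) sequentially"
      using filterlim_at_top[THEN iffD1, OF ln_nat_at_top] by (simp add: L_def)
    then show ?thesis using eventually_ge_at_top[of 3] by eventually_elim auto
  qed
  have Zpos: "eventually (\<lambda>n. genus_total n > 0) sequentially"
    using order_tendstoD(1)[OF Z_tendsto[OF face_law_peel_law genus_weight_bounds genus_deficit genus_total_bound], of 0]
    by simp

  have mean_r: "n \<ge> 1 \<Longrightarrow> distribution_mean (region_distribution n) = mr n" for n
    unfolding distribution_mean_def mr_def by (rule suminf_region_distribution)
  have var_r: "n \<ge> 1 \<Longrightarrow> distribution_variance (region_distribution n) = vr n" for n
    unfolding distribution_variance_def vr_def mean_r by (rule suminf_region_distribution)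
  have mean_g: "distribution_mean (genus_distribution n) = (real n + 2 - mg n) / 2"
    if "n \<ge> 1" "genus_total n > 0" for n
  proof -
    have "distribution_mean (genus_distribution n)
        = (\<Sum>f\<le>6 * n. real ((n + 2 - f) div 2) * genus_weight n f) / genus_total n"
      unfolding distribution_mean_def by (rule suminf_genus_distribution[OF that(1)])
    also have "\<dots> = (\<Sum>f\<le>6 * n. (real n + 2 - real f) / 2 * genus_weight n f) / genus_total n"
      using sum_genus_weight_half[of "\<lambda>x. x"] by simp
    also have "(\<Sum>f\<le>6 * n. (real n + 2 - real f) / 2 * genus_weight n f)
        = (real n + 2) / 2 * genus_total n - (\<Sum>f\<le>6 * n. real f * genus_weight n f) / 2"
      by (simp add: genus_total_def sum_distrib_left sum_divide_distrib flip: sum_subtractf)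
        (simp add: algebra_simps add_divide_distrib diff_divide_distrib)
    finally show ?thesis using that(2) by (simp add: mg_def diff_divide_distrib)
  qed
  have var_g: "distribution_variance (genus_distribution n) = vg n / 4"
    if "n \<ge> 1" "genus_total n > 0" for n
  proof -
    have "distribution_variance (genus_distribution n)
        = (\<Sum>f\<le>6 * n. (real ((n + 2 - f) div 2) - (real n + 2 - mg n) / 2)\<^sup>2 * genus_weight n f) / genus_total n"
      unfolding distribution_variance_def mean_g[OF that] by (rule suminf_genus_distribution[OF that(1)])
    also have "\<dots> = (\<Sum>f\<le>6 * n. ((real n + 2 - real f) / 2 - (real n + 2 - mg n) / 2)\<^sup>2 * genus_weight n f) / genus_total n"
      using sum_genus_weight_half[of "\<lambda>x. (x - (real n + 2 - mg n) / 2)\<^sup>2"] by simp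
    also have "(\<Sum>f\<le>6 * n. ((real n + 2 - real f) / 2 - (real n + 2 - mg n) / 2)\<^sup>2 * genus_weight n f)
        = (\<Sum>f\<le>6 * n. (real f - mg n)\<^sup>2 * genus_weight n f) / 4"
      unfolding sum_divide_distrib
      by (intro sum.cong refl) (simp add: power2_eq_square field_simps)
    finally show ?thesis by (simp add: vg_def)
  qed

  have inv_sq: "(\<lambda>n. 1 / sqrt (L n)) \<longlonglongrightarrow> 0" unfolding L_def
    by (rule tendsto_divide_0[OF tendsto_const]) (rule filterlim_at_top_imp_at_infinity[OF sqrt_ln_at_top])

  have r1: "(\<lambda>n. distribution_mean (region_distribution n)) \<sim>[sequentially] (\<lambda>n. ln (real n))"
  proof (rule asymp_equivI'_const[where c = 1, simplified])
    have "(\<lambda>n. 1 + (mr n - L n) / sqrt (L n) * (1 / sqrt (L n))) \<longlonglongrightarrow> 1 + 0 * 0"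
      by (intro tendsto_add tendsto_mult tendsto_const wr(1) inv_sq)
    moreover have "eventually (\<lambda>n. 1 + (mr n - L n) / sqrt (L n) * (1 / sqrt (L n))
        = distribution_mean (region_distribution n) / ln (real n)) sequentially"
      using Lev
    proof eventually_elim
      case (elim n)
      then have "sqrt (L n) * sqrt (L n) = L n" by simp
      then show ?case using elim mean_r[of n] by (simp add: L_def[symmetric] diff_divide_distrib)
    qed
    ultimately show "(\<lambda>n. distribution_mean (region_distribution n) / ln (real n)) \<longlonglongrightarrow> 1"
      by (simp add: Lim_transform_eventually)
  qed
  have r2: "(\<lambda>n. distribution_variance (region_distribution n)) \<sim>[sequentially] (\<lambda>n. ln (real n))"
  proof (rule asymp_equivI'_const[where c = 1, simplified])
    have "eventually (\<lambda>n. vr n / L n = distribution_variance (region_distribution n) / ln (real n)) sequentially"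
      using Lev by eventually_elim (simp add: var_r L_def)
    then show "(\<lambda>n. distribution_variance (region_distribution n) / ln (real n)) \<longlonglongrightarrow> 1"
      using Lim_transform_eventually[OF wr(2)] by simp
  qed
  have g1: "(\<lambda>n. distribution_mean (genus_distribution n)) \<sim>[sequentially] (\<lambda>n. (real n - ln (real n)) / 2)"
  proof (rule asymp_equivI'_const[where c = 1, simplified])
    have "(\<lambda>n. 2 / (real n - ln (real n))) \<longlonglongrightarrow> 0" by real_asymp
    moreover have "(\<lambda>n. sqrt (ln (real n)) / (real n - ln (real n))) \<longlonglongrightarrow> 0" by real_asymp
    \<comment> \<open>The mean genus is \<open>(n + 2 - mg) / 2\<close>, so its ratio to
      \<open>(n - L) / 2\<close> is \<open>1 + 2 / (n - L) - (mg - L) / (n - L)\<close>, and both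
      corrections vanish.\<close>
    ultimately have "(\<lambda>n. 1 + 2 / (real n - L n) - (mg n - L n) / sqrt (L n) * (sqrt (L n) / (real n - L n)))
        \<longlonglongrightarrow> 1 + 0 - 0 * 0"
      unfolding L_def[symmetric] by (intro tendsto_add tendsto_diff tendsto_mult tendsto_const wg(1))
    moreover have "eventually (\<lambda>n. real n - ln (real n) > 0) sequentially" by real_asymp
    then have "eventually (\<lambda>n. 1 + 2 / (real n - L n) - (mg n - L n) / sqrt (L n) * (sqrt (L n) / (real n - L n))
        = distribution_mean (genus_distribution n) / ((real n - ln (real n)) / 2)) sequentially"
      using Lev Zpos
    proof eventually_elim
      case (elim n)
      define d where "d = real n - L n"
      have d: "d > 0" "ln (real n) = L n" "real n = d + L n" using elim by (simp_all add: d_def L_def)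
      have "(mg n - L n) / sqrt (L n) * (sqrt (L n) / d) = (mg n - L n) / d" using elim by simp
      moreover have "1 + 2 / d - (mg n - L n) / d = (d + L n + 2 - mg n) / d"
        using d(1) by (simp add: divide_simps)
      moreover have "distribution_mean (genus_distribution n) = (d + L n + 2 - mg n) / 2"
        using elim mean_g[of n] by (simp add: d_def)
      ultimately show ?case unfolding d(2) d_def[symmetric] using elim by (auto simp del: ln_gt_zero_iff)
    qed
    ultimately show "(\<lambda>n. distribution_mean (genus_distribution n) / ((real n - ln (real n)) / 2)) \<longlonglongrightarrow> 1"
      by (simp add: Lim_transform_eventually)
  qed
  have g2: "(\<lambda>n. distribution_variance (genus_distribution n)) \<sim>[sequentially] (\<lambda>n. ln (real n) / 4)"
  proof (rule asymp_equivI'_const[where c = 1, simplified])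
    have "eventually (\<lambda>n. vg n / L n = distribution_variance (genus_distribution n) / (ln (real n) / 4)) sequentially"
      using Lev Zpos by eventually_elim (simp add: var_g L_def)
    then show "(\<lambda>n. distribution_variance (genus_distribution n) / (ln (real n) / 4)) \<longlonglongrightarrow> 1"
      using Lim_transform_eventually[OF wg(2)] by simp
  qed
  have r3: "(\<lambda>n. \<Sum>f | 1 \<le> f \<and> real f \<le> ln (real n) + t * sqrt (ln (real n)). region_distribution n f)
      \<longlonglongrightarrow> 1 / sqrt (2 * pi) * (LBINT x:{..t}. exp (- (x\<^sup>2) / 2))" for t :: real
  proof (rule Lim_transform_eventually)
    let ?S = "\<lambda>n. {f. 1 * (real f - ln (real n) - 0) \<le> t * sqrt (ln (real n))}"
    show "(\<lambda>n. (\<Sum>f\<le>6 * n. indicator (?S n) f * conn_weight n f) / genus_total n)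
        \<longlonglongrightarrow> 1 / sqrt (2 * pi) * (LBINT x:{..t}. exp (- (x\<^sup>2) / 2))"
      by (intro cr law_clt face_law_peel_law) auto
    show "eventually (\<lambda>n. (\<Sum>f\<le>6 * n. indicator (?S n) f * conn_weight n f) / genus_total n
        = (\<Sum>f | 1 \<le> f \<and> real f \<le> ln (real n) + t * sqrt (ln (real n)). region_distribution n f)) sequentially"
      using eventually_ge_at_top[of 1]
    proof eventually_elim
      case (elim n)
      let ?T = "{f. 1 \<le> f \<and> real f \<le> ln (real n) + t * sqrt (ln (real n))}"
      have fin: "finite ?T" by (rule finite_subset[OF _ finite_real_le]) auto
      \<comment> \<open>The two sums differ only in terms where the indicator or the weight is zero:
        a map has at least one and at most \<open>6 * n\<close> faces.\<close>
      have "(\<Sum>f\<le>6 * n. indicator (?S n) f * conn_weight n f) = (\<Sum>f\<in>?T. conn_weight n f)"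
        using fin conn_weight_support[OF elim]
        by (intro sum.mono_neutral_cong) (auto simp: indicator_def)
      then show ?case by (simp add: region_distribution_weight[OF elim] sum_divide_distrib)
    qed
  qed
  have g3: "(\<lambda>n. \<Sum>g | real g \<le> (real n - ln (real n)) / 2 + t * sqrt (ln (real n)) / 2. genus_distribution n g)
      \<longlonglongrightarrow> 1 / sqrt (2 * pi) * (LBINT x:{..t}. exp (- (x\<^sup>2) / 2))" for t :: real
  proof (rule Lim_transform_eventually)
    \<comment> \<open>For \<open>g = (n + 2 - f) / 2\<close> the bound on \<open>g\<close> reads
      \<open>- (f - ln n - 2) \<le> t * sqrt (ln n)\<close>: a lower bound on \<open>f\<close>,
      hence the sign, with the shift 2 from Euler's formula.\<close>
    let ?S = "\<lambda>n. {f. - 1 * (real f - ln (real n) - 2) \<le> t * sqrt (ln (real n))}"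
    show "(\<lambda>n. (\<Sum>f\<le>6 * n. indicator (?S n) f * genus_weight n f) / genus_total n)
        \<longlonglongrightarrow> 1 / sqrt (2 * pi) * (LBINT x:{..t}. exp (- (x\<^sup>2) / 2))"
      by (intro cg law_clt face_law_peel_law) auto
    show "eventually (\<lambda>n. (\<Sum>f\<le>6 * n. indicator (?S n) f * genus_weight n f) / genus_total n
        = (\<Sum>g | real g \<le> (real n - ln (real n)) / 2 + t * sqrt (ln (real n)) / 2. genus_distribution n g)) sequentially"
      using eventually_ge_at_top[of 1]
    proof eventually_elim
      case (elim n)
      let ?b = "(real n - ln (real n)) / 2 + t * sqrt (ln (real n)) / 2"
      let ?\<chi> = "\<lambda>x. if x \<le> ?b then 1 else 0 :: real"
      have "(\<Sum>g | real g \<le> ?b. genus_distribution n g) = (\<Sum>g | real g \<le> ?b. ?\<chi> (real g) * genus_distribution n g)"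
        by (intro sum.cong) auto
      also have "\<dots> = (\<Sum>g. ?\<chi> (real g) * genus_distribution n g)"
        by (rule suminf_finite[symmetric]) (auto intro: finite_real_le)
      also have "\<dots> = (\<Sum>f\<le>6 * n. ?\<chi> (real ((n + 2 - f) div 2)) * genus_weight n f) / genus_total n"
        by (rule suminf_genus_distribution[OF elim])
      also have "\<dots> = (\<Sum>f\<le>6 * n. ?\<chi> ((real n + 2 - real f) / 2) * genus_weight n f) / genus_total n"
        unfolding sum_genus_weight_half[of ?\<chi>] ..
      also have "(\<Sum>f\<le>6 * n. ?\<chi> ((real n + 2 - real f) / 2) * genus_weight n f)
          = (\<Sum>f\<le>6 * n. indicator (?S n) f * genus_weight n f)"
        by (intro sum.cong refl) (auto simp: indicator_def field_simps)
      finally show ?case by simp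
    qed
  qed
  show ?thesis using r1 r2 r3 g1 g2 g3 by blast
qed

end
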